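(* Let $p$ be the extremal projector of $U_q(sl(3))$ and let $p_T$ be the extremal projector of the subalgebra $U_q(su_T(2))$. Let $$R^{j(q)}_{j_z}=\sqrt{\frac{[2j]!}{[j-j_z]![j+j_z]!}}\;q^{2j^2-j}\,e_{21}^{j+j_z}e_{31}^{j-j_z}\,q^{-jh_{\alpha_1}-(j-j_z)T_0},\qquad \tilde R^{j(q)}_{j_z}:=(-1)^{j_z}q^{j_z}R^{j(q)}_{-j_z},$$ $$R'^{\,j(q)}_{j_z}=\sqrt{\frac{[2j]!}{[j-j_z]![j+j_z]!}}\;q^{-2j^2+j}\,e_{12}^{j-j_z}e'^{\,j+j_z}_{13}\,q^{-jh_{\alpha_1}-(j+j_z)T_0}.$$ Then $$p=p_T\Bigl(\sum_{j\in\frac12\mathbb Z_{\ge0}}\ \sum_{j_z=-j}^{j}A_{jj_z}\,\tilde R^{j(q)}_{j_z}R'^{\,j(q)}_{j_z}\Bigr)p_T,$$ where $$A_{jj_z}=\frac{(-1)^{3j}\,[\varphi_{12}]\,[\varphi_{12}+j+j_z-1]!\,[\varphi_{13}]!}{[2j]!\,[\varphi_{12}+2j]!\,[\varphi_{13}+j+j_z]!}\;q^{4j^2+j+2jh_{\alpha_1}+2(j+j_z)T_0},$$ $\varphi_{12}=h_{\alpha_1}+1$ and $\varphi_{13}=h_{\alpha_1}+h_{\alpha_2}+2$.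
   Context: Conventions: $q>0$, $q\ne1$, $[a]=(q^a-q^{-a})/(q-q^{-1})$, $[n]!=[1][2]\cdots[n]$, and $(-1)^x:=e^{i\pi x}$ for $x\in\frac12\mathbb Z$. For Cartan arguments the factorials occur only in ratios, which are read as finite products: $\frac{[\varphi_{12}][\varphi_{12}+j+j_z-1]!}{[\varphi_{12}+2j]!}=[\varphi_{12}]\prod_{s=j+j_z}^{2j}[\varphi_{12}+s]^{-1}$ and $\frac{[\varphi_{13}]!}{[\varphi_{13}+j+j_z]!}=\prod_{s=1}^{j+j_z}[\varphi_{13}+s]^{-1}$. $U_q(sl(3))$ has simple roots $\alpha_1,\alpha_2$ with $(\alpha_i,\alpha_i)=2$, $(\alpha_1,\alpha_2)=-1$, and generators $q^{\pm h_{\alpha_i}}$, $e_{\pm\alpha_i}$. The relations are: the $q^{h_{\alpha_i}}$ commute, $q^{h_{\alpha_i}}e_{\pm\alpha_j}q^{-h_{\alpha_i}}=q^{\pm(\alpha_i,\alpha_j)}e_{\pm\alpha_j}$, $[e_{\alpha_i},e_{-\alpha_j}]=\delta_{ij}[h_{\alpha_i}]$, and $[[e_{\pm\alpha_i},e_{\pm\alpha_j}]_q,e_{\pm\alpha_j}]_q=0$ for $i\ne j$, where $[e_\alpha,e_\beta]_q=e_\alpha e_\beta-q^{(\alpha,\beta)}e_\beta e_\alpha$. Notation: $e_{12}=e_{\alpha_1}$, $e_{21}=e_{-\alpha_1}$, $e_{23}=e_{\alpha_2}$, $e_{32}=e_{-\alpha_2}$, $e_{13}=e_{12}e_{23}-q\,e_{23}e_{12}$,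 $e_{31}=e_{32}e_{21}-q^{-1}e_{21}e_{32}$, $e'_{13}=e_{23}e_{12}-q\,e_{12}e_{23}$. The subalgebra $U_q(su_T(2))$ is generated by $T_+=e_{23}$, $T_-=e_{32}$, $q^{\pm T_0}$, $T_0=\frac12h_{\alpha_2}$. The identity holds in the completion (Taylor extension) of $U_q(sl(3))$. This is the algebra of formal series in ordered monomials $e_{21}^{a_1}e_{31}^{a_2}e_{32}^{a_3}\,f\,e_{12}^{b_1}e_{13}^{b_2}e_{23}^{b_3}$, where $f$ is a rational function of the (half-integer powers of) Cartan elements $q^{h_{\alpha_i}}$ and the total weights of the monomials occurring in one series are bounded (finitely many). In it the extremal projector $p$ of $U_q(sl(3))$ is the unique nonzero element with $e_{ij}p=p\,e_{ji}=0$ for $1\le i<j\le3$ and $p^2=p$. Similarly, $p_T$ is the unique nonzero element of the analogous extension of $U_q(su_T(2))$ with $e_{23}p_T=p_Te_{32}=0$ and $p_T^2=p_T$. *)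

theory Defs
  imports
    Complex_Main
    "HOL-Library.Poly_Mapping"
    "HOL-Computational_Algebra.Polynomial"
    "HOL-Computational_Algebra.Fraction_Field"
begin

section \<open>Scalars and Cartan functions\<close>

definition qnum :: "real \<Rightarrow> nat \<Rightarrow> real" where
  "qnum q n = (q ^ n - inverse q ^ n) / (q - inverse q)"

definition qfact :: "real \<Rightarrow> nat \<Rightarrow> real" where
  "qfact q n = (\<Prod>i = 1..n. qnum q i)"

text \<open>The power \<open>(-1)\<^sup>x\<close> with the convention \<open>exp (\<i> \<pi> x)\<close>.\<close>

definition mone_pow :: "real \<Rightarrow> complex" where
  "mone_pow x = exp (\<i> * of_real (pi * x))"

text \<open>
  Rational functions of the two half powers \<open>q\<^bsup>h\<^sub>1/2\<^esup>\<close> and \<open>q\<^bsup>h\<^sub>2/2\<^esup>\<close>, where \<open>h\<^sub>i\<close> is the Cartan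
  generator for the simple root \<open>\<alpha>\<^sub>i\<close>. The outer polynomial variable is \<open>q\<^bsup>h\<^sub>1/2\<^esup>\<close>, the inner one
  is \<open>q\<^bsup>h\<^sub>2/2\<^esup>\<close>.
\<close>

type_synonym cartan = "complex poly poly fract"

definition kconst :: "complex \<Rightarrow> cartan" where
  "kconst c = Fract [:[:c:]:] 1"

datatype node = N1 | N2

fun zvar :: "node \<Rightarrow> cartan" where
  "zvar N1 = Fract [:0, 1:] 1"
| "zvar N2 = Fract [:[:0, 1:]:] 1"

text \<open>\<open>qH m\<^sub>1 m\<^sub>2\<close> is \<open>q\<^bsup>(m\<^sub>1 h\<^sub>1 + m\<^sub>2 h\<^sub>2)/2\<^esup>\<close>; as \<open>T\<^sub>0 = h\<^sub>2/2\<close>, also \<open>q\<^bsup>m T\<^sub>0\<^esup> = qH 0 m\<close>.\<close>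

definition qH :: "int \<Rightarrow> int \<Rightarrow> cartan" where
  "qH m1 m2 = zvar N1 powi m1 * zvar N2 powi m2"

text \<open>\<open>qnumH q m\<^sub>1 m\<^sub>2 s\<close> is \<open>[m\<^sub>1 h\<^sub>1 + m\<^sub>2 h\<^sub>2 + s]\<close>.\<close>

definition qnumH :: "real \<Rightarrow> int \<Rightarrow> int \<Rightarrow> int \<Rightarrow> cartan" where
  "qnumH q m1 m2 s =
     (kconst (of_real (q powi s)) * qH (2 * m1) (2 * m2)
        - kconst (of_real (q powi (- s))) * qH (- 2 * m1) (- 2 * m2))
     / kconst (of_real (q - inverse q))"


section \<open>The quantum group \<open>U\<^sub>q(sl(3))\<close> with rational Cartan functions\<close>

text \<open>
  The algebra is given by generators and relations: it is the quotient of the free associative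
  complex algebra on the generators below by the ideal \<open>rel_ideal q\<close>. The Cartan generators
  comprise all rational functions of \<open>q\<^bsup>h\<^sub>i/2\<^esup>\<close>. Elements are handled through representatives in
  the free algebra.
\<close>

datatype gen = Pos node | Neg node | Car cartan

datatype 'g fword = FWord "'g list"

instantiation fword :: (type) monoid_add
begin

definition zero_fword :: "'a fword" where
  "zero_fword = FWord []"

fun plus_fword :: "'a fword \<Rightarrow> 'a fword \<Rightarrow> 'a fword" where
  "plus_fword (FWord xs) (FWord ys) = FWord (xs @ ys)"

instance
proof
  fix a b c :: "'a fword"
  show "a + b + c = a + (b + c)" by (cases a; cases b; cases c) simp
  show "0 + a = a" by (cases a) (simp add: zero_fword_def)
  show "a + 0 = a" by (cases a) (simp add: zero_fword_def)
qed

end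

type_synonym falg = "gen fword \<Rightarrow>\<^sub>0 complex"

definition scl :: "complex \<Rightarrow> falg" where
  "scl c = Poly_Mapping.single 0 c"

definition gn :: "gen \<Rightarrow> falg" where
  "gn g = Poly_Mapping.single (FWord [g]) 1"

text \<open>The inner product \<open>(\<alpha>\<^sub>i, \<alpha>\<^sub>j)\<close>.\<close>

definition ip :: "node \<Rightarrow> node \<Rightarrow> int" where
  "ip i j = (if i = j then 2 else - 1)"

definition hnum :: "real \<Rightarrow> node \<Rightarrow> cartan" where
  "hnum q i = (case i of N1 \<Rightarrow> qnumH q 1 0 0 | N2 \<Rightarrow> qnumH q 0 1 0)"

text \<open>With \<open>n\<close> the inner product of the weights of \<open>x\<close> and \<open>y\<close>, this is \<open>[x, y]\<^sub>q\<close>.\<close>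

definition qcomm :: "real \<Rightarrow> int \<Rightarrow> falg \<Rightarrow> falg \<Rightarrow> falg" where
  "qcomm q n x y = x * y - scl (of_real (q powi n)) * y * x"

inductive_set relators :: "real \<Rightarrow> falg set" for q :: real where
  car_const: "gn (Car (kconst c)) - scl c \<in> relators q"
| car_add: "gn (Car (f + g)) - (gn (Car f) + gn (Car g)) \<in> relators q"
| car_mult: "gn (Car (f * g)) - gn (Car f) * gn (Car g) \<in> relators q"
| car_pos: "gn (Car (zvar i)) * gn (Pos j) * gn (Car (inverse (zvar i)))
     - scl (of_real (q powr (of_int (ip i j) / 2))) * gn (Pos j) \<in> relators q"
| car_neg: "gn (Car (zvar i)) * gn (Neg j) * gn (Car (inverse (zvar i)))
     - scl (of_real (q powr (- of_int (ip i j) / 2))) * gn (Neg j) \<in> relators q"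
| pos_neg: "gn (Pos i) * gn (Neg j) - gn (Neg j) * gn (Pos i)
     - (if i = j then gn (Car (hnum q i)) else 0) \<in> relators q"
| serre_pos: "i \<noteq> j \<Longrightarrow>
     qcomm q (ip i j + ip j j) (qcomm q (ip i j) (gn (Pos i)) (gn (Pos j))) (gn (Pos j))
       \<in> relators q"
| serre_neg: "i \<noteq> j \<Longrightarrow>
     qcomm q (ip i j + ip j j) (qcomm q (ip i j) (gn (Neg i)) (gn (Neg j))) (gn (Neg j))
       \<in> relators q"

inductive_set rel_ideal :: "real \<Rightarrow> falg set" for q :: real where
  zero: "0 \<in> rel_ideal q"
| rel: "r \<in> relators q \<Longrightarrow> x * r * y \<in> rel_ideal q"
| add: "u \<in> rel_ideal q \<Longrightarrow> v \<in> rel_ideal q \<Longrightarrow> u + v \<in> rel_ideal q"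

abbreviation e12 :: falg where "e12 \<equiv> gn (Pos N1)"
abbreviation e23 :: falg where "e23 \<equiv> gn (Pos N2)"
abbreviation e21 :: falg where "e21 \<equiv> gn (Neg N1)"
abbreviation e32 :: falg where "e32 \<equiv> gn (Neg N2)"

definition e13 :: "real \<Rightarrow> falg" where
  "e13 q = e12 * e23 - scl (of_real q) * e23 * e12"

definition e31 :: "real \<Rightarrow> falg" where
  "e31 q = e32 * e21 - scl (of_real (inverse q)) * e21 * e32"

definition e13' :: "real \<Rightarrow> falg" where
  "e13' q = e23 * e12 - scl (of_real q) * e12 * e23"


section \<open>The Taylor extension\<close>

text \<open>
  A formal series assigns to each exponent tuple \<open>(a\<^sub>1, a\<^sub>2, a\<^sub>3, b\<^sub>1, b\<^sub>2, b\<^sub>3)\<close> the Cartan coefficient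
  standing in the middle of the corresponding ordered monomial.
\<close>

type_synonym expo = "nat \<times> nat \<times> nat \<times> nat \<times> nat \<times> nat"
type_synonym series = "expo \<Rightarrow> cartan"

fun monom_pbw :: "real \<Rightarrow> expo \<Rightarrow> cartan \<Rightarrow> falg" where
  "monom_pbw q (a1, a2, a3, b1, b2, b3) f =
     e21 ^ a1 * e31 q ^ a2 * e32 ^ a3 * gn (Car f) * e12 ^ b1 * e13 q ^ b2 * e23 ^ b3"

text \<open>The total weight, as its coefficients with respect to \<open>\<alpha>\<^sub>1\<close> and \<open>\<alpha>\<^sub>2\<close>.\<close>

fun weight :: "expo \<Rightarrow> int \<times> int" where
  "weight (a1, a2, a3, b1, b2, b3) =
     (int b1 + int b2 - int a1 - int a2, int b2 + int b3 - int a2 - int a3)"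

definition taylor :: "series set" where
  "taylor = {F. finite (weight ` {m. F m \<noteq> 0})}"

text \<open>
  The series of an element of the algebra: its coefficients in the basis of ordered monomials
  (Poincare-Birkhoff-Witt), which are finitely many.
\<close>

definition to_taylor :: "real \<Rightarrow> falg \<Rightarrow> series" where
  "to_taylor q u = (THE F. finite {m. F m \<noteq> 0} \<and>
     u - (\<Sum>m | F m \<noteq> 0. monom_pbw q m (F m)) \<in> rel_ideal q)"

text \<open>
  Multiplication is term by term. For \<open>F, G \<in> taylor\<close> only finitely many pairs of terms
  contribute to a given monomial \<open>m\<close>, so that \<open>Sum_any\<close> is a genuine finite sum.
\<close>

definition tmul :: "real \<Rightarrow> series \<Rightarrow> series \<Rightarrow> series" where
  "tmul q F G m =
     Sum_any (\<lambda>(k, l). to_taylor q (monom_pbw q k (F k) * monom_pbw q l (G l)) m)"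

text \<open>Formal infinite sums: every monomial receives only finitely many contributions.\<close>

definition has_tsum :: "('i \<Rightarrow> series) \<Rightarrow> 'i set \<Rightarrow> series \<Rightarrow> bool" where
  "has_tsum f I S \<longleftrightarrow> S \<in> taylor \<and>
     (\<forall>m. finite {i \<in> I. f i m \<noteq> 0} \<and> S m = (\<Sum>i | i \<in> I \<and> f i m \<noteq> 0. f i m))"

definition extremal_projector :: "real \<Rightarrow> series \<Rightarrow> bool" where
  "extremal_projector q p \<longleftrightarrow> p \<in> taylor \<and> p \<noteq> (\<lambda>_. 0) \<and>
     (\<forall>e \<in> {e12, e23, e13 q}. tmul q (to_taylor q e) p = (\<lambda>_. 0)) \<and>
     (\<forall>e \<in> {e21, e32, e31 q}. tmul q p (to_taylor q e) = (\<lambda>_. 0)) \<and>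
     tmul q p p = p"

text \<open>
  The analogous extension for the subalgebra generated by \<open>e\<^sub>2\<^sub>3\<close>, \<open>e\<^sub>3\<^sub>2\<close>, \<open>q\<^bsup>\<plusminus>T\<^sub>0\<^esup>\<close>: series in the
  monomials \<open>e\<^sub>3\<^sub>2\<^sup>a f e\<^sub>2\<^sub>3\<^sup>b\<close> with \<open>f\<close> a rational function of \<open>q\<^bsup>T\<^sub>0\<^esup> = q\<^bsup>h\<^sub>2/2\<^esup>\<close>.
\<close>

definition cartan_T :: "cartan set" where
  "cartan_T = {Fract [:a:] [:b:] | a b. b \<noteq> 0}"

definition taylor_T :: "series set" where
  "taylor_T = {F \<in> taylor. (\<forall>m. F m \<in> cartan_T) \<and>
     (\<forall>m. F m \<noteq> 0 \<longrightarrow> (\<exists>a b. m = (0, 0, a, 0, 0, b)))}"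

definition extremal_projector_T :: "real \<Rightarrow> series \<Rightarrow> bool" where
  "extremal_projector_T q p \<longleftrightarrow> p \<in> taylor_T \<and> p \<noteq> (\<lambda>_. 0) \<and>
     tmul q (to_taylor q e23) p = (\<lambda>_. 0) \<and>
     tmul q p (to_taylor q e32) = (\<lambda>_. 0) \<and>
     tmul q p p = p"


section \<open>The tensor operators and the coefficients\<close>

text \<open>
  The half-integers \<open>j\<close> and \<open>j\<^sub>z\<close> with \<open>-j \<le> j\<^sub>z \<le> j\<close> are encoded by the natural numbers \<open>n = 2j\<close> and
  \<open>k = j + j\<^sub>z \<le> n\<close>. Thus \<open>j - j\<^sub>z = n - k\<close>, and \<open>j\<^sub>z \<mapsto> -j\<^sub>z\<close> is \<open>k \<mapsto> n - k\<close>.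
\<close>

definition Rop :: "real \<Rightarrow> nat \<Rightarrow> nat \<Rightarrow> falg" where
  "Rop q n k = (let j = real n / 2 in
     scl (of_real (sqrt (qfact q n / (qfact q (n - k) * qfact q k)) * q powr (2 * j\<^sup>2 - j)))
     * e21 ^ k * e31 q ^ (n - k) * gn (Car (qH (- int n) (- int (n - k)))))"

definition Rop_tilde :: "real \<Rightarrow> nat \<Rightarrow> nat \<Rightarrow> falg" where
  "Rop_tilde q n k = (let jz = real k - real n / 2 in
     scl (mone_pow jz * of_real (q powr jz)) * Rop q n (n - k))"

definition Rop' :: "real \<Rightarrow> nat \<Rightarrow> nat \<Rightarrow> falg" where
  "Rop' q n k = (let j = real n / 2 in
     scl (of_real (sqrt (qfact q n / (qfact q (n - k) * qfact q k)) * q powr (- 2 * j\<^sup>2 + j)))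
     * e12 ^ (n - k) * e13' q ^ k * gn (Car (qH (- int n) (- int k))))"

definition phi12 :: "real \<Rightarrow> nat \<Rightarrow> cartan" where  \<comment> \<open>\<open>[\<phi>\<^sub>1\<^sub>2 + s]\<close> with \<open>\<phi>\<^sub>1\<^sub>2 = h\<^sub>1 + 1\<close>\<close>
  "phi12 q s = qnumH q 1 0 (1 + int s)"

definition phi13 :: "real \<Rightarrow> nat \<Rightarrow> cartan" where  \<comment> \<open>\<open>[\<phi>\<^sub>1\<^sub>3 + s]\<close> with \<open>\<phi>\<^sub>1\<^sub>3 = h\<^sub>1 + h\<^sub>2 + 2\<close>\<close>
  "phi13 q s = qnumH q 1 1 (2 + int s)"

definition Acoef :: "real \<Rightarrow> nat \<Rightarrow> nat \<Rightarrow> cartan" where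
  "Acoef q n k = (let j = real n / 2 in
     kconst (mone_pow (3 * j) / of_real (qfact q n))
     * (phi12 q 0 * (\<Prod>s = k..n. inverse (phi12 q s)))
     * (\<Prod>s = 1..k. inverse (phi13 q s))
     * (kconst (of_real (q powr (4 * j\<^sup>2 + j))) * qH (2 * int n) (2 * int k)))"

end

theory Submission
  imports Defs "HOL-Library.Function_Algebras"
begin

text \<open>
  Left multiplication on ordered monomials gives explicit operators on series, which satisfy the
  defining relations. This proves the Poincare-Birkhoff-Witt theorem and turns the products of the
  Taylor extension into computations with coefficients.

  Since \<open>e\<^sub>2\<^sub>3 p = 0 = p e\<^sub>3\<^sub>2\<close>, we have \<open>p = p\<^sub>T p p\<^sub>T\<close>, and \<open>p\<^sub>T F p\<^sub>T\<close> depends only on \<open>F\<close> modulo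
  left multiples of \<open>e\<^sub>3\<^sub>2\<close> and right multiples of \<open>e\<^sub>2\<^sub>3\<close>. Every class contains exactly one series in
  the monomials \<open>e\<^sub>2\<^sub>1\<^sup>a e\<^sub>3\<^sub>1\<^sup>b f e\<^sub>1\<^sub>2\<^sup>c e\<^sub>1\<^sub>3\<^sup>d\<close>. For \<open>p\<close> the coefficients of this reduced series satisfy
  two recursions, one from \<open>e\<^sub>1\<^sub>2 p = 0\<close> and one from a combination of \<open>e\<^sub>1\<^sub>3\<close> and \<open>e\<^sub>1\<^sub>2 e\<^sub>2\<^sub>3\<close> that
  preserves the left multiples of \<open>e\<^sub>3\<^sub>2\<close>. The recursions leave only the constant term free, which
  is \<open>1\<close> because \<open>p\<close> is a nonzero idempotent. The sum on the right-hand side reduces to the same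
  coefficients.
\<close>

section \<open>Shift automorphisms of the Cartan field\<close>

text \<open>Both projectors are given, so the argument is one of uniqueness: annihilation forces the
  reduced series of \<open>p\<close>. Three obstacles shape it. Products are sums of PBW
  coefficients of products of monomials, and these coefficients come from a definite description; no
  product can be evaluated before the ordered monomials are known to span and to be independent. The
  action on series settles independence, because an element applied to the unit series returns its
  own coefficients. Associativity of the completed product is not built into its definition and is
  obtained by truncating to finite series. Finally, \<open>e13\<close> does not respect left
  multiples of \<open>e32\<close>: moving it past \<open>e32\<close> leaves q^(-h2) e12. The factor
  [h2 + 1] and the correction e12 q^(1-h2) e23 are chosen so that both leftovers are the same Cartan
  multiple of \<open>e12\<close> and cancel.\<close>

definition fract_map :: "('a::idom \<Rightarrow> 'b::idom) \<Rightarrow> 'a fract \<Rightarrow> 'b fract" where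
  "fract_map f x = (let (a, b) = SOME (a, b). b \<noteq> 0 \<and> x = Fract a b in Fract (f a) (f b))"

locale inj_ring_hom =
  fixes f :: "'a::idom \<Rightarrow> 'b::idom"
  assumes hom_add: "f (x + y) = f x + f y"
    and hom_mult: "f (x * y) = f x * f y"
    and hom_one: "f 1 = 1"
    and hom_inj: "f x = 0 \<Longrightarrow> x = 0"
begin

lemma hom_zero: "f 0 = 0"
  using hom_add[of 0 0] by (metis add_cancel_right_right)

lemma hom_ne: "x \<noteq> 0 \<Longrightarrow> f x \<noteq> 0"
  using hom_inj by blast

text \<open>The value is independent of the chosen fraction: a homomorphism preserves a * b' = a' *
  b, and injectivity keeps denominators nonzero.\<close>

lemma fract_map_Fract:
  assumes "b \<noteq> 0"
  shows "fract_map f (Fract a b) = Fract (f a) (f b)"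
proof -
  define ab where "ab = (SOME (a', b'). b' \<noteq> 0 \<and> Fract a b = Fract a' b')"
  obtain a' b' where ab: "ab = (a', b')" by fastforce
  have "case ab of (a', b') \<Rightarrow> b' \<noteq> 0 \<and> Fract a b = Fract a' b'"
    unfolding ab_def by (rule someI[of _ "(a, b)"]) (simp add: assms)
  then have *: "b' \<noteq> 0" "Fract a b = Fract a' b'" by (auto simp: ab)
  then have "a * b' = a' * b" using assms by (simp add: eq_fract)
  then have "f a * f b' = f a' * f b" by (metis hom_mult)
  then have "Fract (f a) (f b) = Fract (f a') (f b')"
    using assms * by (simp add: eq_fract hom_ne)
  then show ?thesis
    by (simp add: fract_map_def ab_def[symmetric] ab)
qed

lemma fract_map_add: "fract_map f (x + y) = fract_map f x + fract_map f y"
  by (cases x; cases y) (simp add: fract_map_Fract hom_add hom_mult hom_ne)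

lemma fract_map_mult: "fract_map f (x * y) = fract_map f x * fract_map f y"
  by (cases x; cases y) (simp add: fract_map_Fract hom_mult)

lemma fract_map_zero: "fract_map f 0 = 0"
  by (simp add: Zero_fract_def fract_map_Fract hom_zero hom_one)

lemma fract_map_one: "fract_map f 1 = 1"
  by (simp add: One_fract_def fract_map_Fract hom_one)

end

definition shift_poly :: "complex \<Rightarrow> complex \<Rightarrow> complex poly poly \<Rightarrow> complex poly poly" where
  "shift_poly s t p = pcompose (map_poly (\<lambda>c. pcompose c [:0, t:]) p) [:0, [:s:]:]"

lemma coeff_shift_poly: "coeff (coeff (shift_poly s t p) i) j = s ^ i * t ^ j * coeff (coeff p i) j"
proof -
  have "[:s:] ^ i = [:s ^ i:]" by (induct i) (simp_all add: mult.commute)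
  then show ?thesis
    by (simp add: shift_poly_def coeff_pcompose_linear coeff_map_poly)
qed

lemma map_poly_mult_hom:
  fixes f :: "'a::comm_ring_1 \<Rightarrow> 'b::comm_ring_1"
  assumes "f 0 = 0" "\<And>x y. f (x + y) = f x + f y" "\<And>x y. f (x * y) = f x * f y"
  shows "map_poly f (p * q) = map_poly f p * map_poly f q"
proof (rule poly_eqI)
  fix n
  have sum: "f (\<Sum>i\<in>A. g i) = (\<Sum>i\<in>A. f (g i))" for A and g :: "nat \<Rightarrow> 'a"
    by (induct A rule: infinite_finite_induct) (simp_all add: assms)
  show "coeff (map_poly f (p * q)) n = coeff (map_poly f p * map_poly f q) n"
    by (simp add: coeff_map_poly coeff_mult assms sum)
qed

text \<open>Injectivity is visible on coefficients: they are only rescaled by s^i t^j, which is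
  nonzero.\<close>

lemma shift_poly_hom:
  assumes "s \<noteq> 0" "t \<noteq> 0"
  shows "inj_ring_hom (shift_poly s t)"
proof
  show "shift_poly s t (x + y) = shift_poly s t x + shift_poly s t y" for x y
    by (intro poly_eqI) (simp add: coeff_shift_poly algebra_simps)
  show "shift_poly s t (x * y) = shift_poly s t x * shift_poly s t y" for x y
    by (simp add: shift_poly_def pcompose_mult map_poly_mult_hom pcompose_add)
  show "shift_poly s t 1 = 1"
    by (simp add: shift_poly_def one_pCons map_poly_pCons)
  show "x = 0" if "shift_poly s t x = 0" for x
  proof (intro poly_eqI)
    fix i j
    have "s ^ i * t ^ j * coeff (coeff x i) j = 0"
      using that coeff_shift_poly[of s t x i j] by simp
    then show "coeff (coeff x i) j = coeff (coeff 0 i) j" using assms by simp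
  qed
qed

text \<open>The substitution \<open>h\<^sub>1 \<mapsto> h\<^sub>1 + x\<close>, \<open>h\<^sub>2 \<mapsto> h\<^sub>2 + y\<close>; the variables of \<^typ>\<open>cartan\<close> are half powers.\<close>

definition tau :: "real \<Rightarrow> int \<Rightarrow> int \<Rightarrow> cartan \<Rightarrow> cartan" where
  "tau q x y = fract_map (shift_poly (of_real (q powr (of_int x / 2))) (of_real (q powr (of_int y / 2))))"

section \<open>Powers of q, q-numbers and their behaviour under shifts\<close>

definition Qp :: "real \<Rightarrow> int \<Rightarrow> cartan" where
  "Qp q n = kconst (of_real (q powi n))"

text \<open>Arguments are integers, so that [0] = 0 and [-n] = -[n] are available at the boundary of
  the exponent range.\<close>

definition qn :: "real \<Rightarrow> int \<Rightarrow> cartan" where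
  "qn q n = (Qp q n - Qp q (- n)) / (Qp q 1 - Qp q (- 1))"

lemma kconst_add: "kconst (a + b) = kconst a + kconst b"
  by (simp add: kconst_def)

lemma kconst_mult: "kconst (a * b) = kconst a * kconst b"
  by (simp add: kconst_def mult.commute)

lemma kconst_0 [simp]: "kconst 0 = 0"
  by (simp add: kconst_def Zero_fract_def)

lemma kconst_1 [simp]: "kconst 1 = 1"
  by (simp add: kconst_def One_fract_def one_pCons)

lemma kconst_eq_0_iff [simp]: "kconst a = 0 \<longleftrightarrow> a = 0"
  by (simp add: kconst_def Zero_fract_def eq_fract)

lemma kconst_minus: "kconst (- a) = - kconst a"
  by (simp add: kconst_def)

lemma kconst_diff: "kconst (a - b) = kconst a - kconst b"
  using kconst_add[of a "-b"] kconst_minus[of b] by simp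

lemma kconst_inverse: "kconst (inverse a) = inverse (kconst a)"
proof (cases "a = 0")
  case False
  then have "kconst (inverse a) * kconst a = 1" by (simp flip: kconst_mult)
  then show ?thesis by (metis inverse_unique mult.commute)
qed simp

lemma kconst_divide: "kconst (a / b) = kconst a / kconst b"
  by (simp add: divide_inverse kconst_mult kconst_inverse)

lemma zvar_ne_0 [simp]: "zvar i \<noteq> 0"
  by (cases i) (simp_all add: Zero_fract_def eq_fract zvar.simps)

declare zvar.simps [simp del]

lemma qH_ne_0 [simp]: "qH a b \<noteq> 0"
  by (simp add: qH_def)

lemma qH_add: "qH (a + b) (c + d) = qH a c * qH b d"
  by (simp add: qH_def power_int_add)

lemma qH_minus: "qH (- a) (- b) = inverse (qH a b)"
  by (simp add: qH_def power_int_minus)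

locale qparam =
  fixes q :: real
  assumes q_pos: "q > 0" and q_ne_1: "q \<noteq> 1"
begin

lemma q_ne_0 [simp]: "q \<noteq> 0"
  using q_pos by simp

lemma tau_hom: "inj_ring_hom (shift_poly (of_real (q powr (of_int x / 2))) (of_real (q powr (of_int y / 2))))"
  by (rule shift_poly_hom) (use q_pos in auto)

lemma tau_add: "tau q x y (f + g) = tau q x y f + tau q x y g"
  unfolding tau_def by (rule inj_ring_hom.fract_map_add[OF tau_hom])

lemma tau_mult: "tau q x y (f * g) = tau q x y f * tau q x y g"
  unfolding tau_def by (rule inj_ring_hom.fract_map_mult[OF tau_hom])

lemma tau_0 [simp]: "tau q x y 0 = 0"
  unfolding tau_def by (rule inj_ring_hom.fract_map_zero[OF tau_hom])

lemma tau_1 [simp]: "tau q x y 1 = 1"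
  unfolding tau_def by (rule inj_ring_hom.fract_map_one[OF tau_hom])

lemma tau_Fract: "b \<noteq> 0 \<Longrightarrow> tau q x y (Fract a b) =
   Fract (shift_poly (of_real (q powr (of_int x / 2))) (of_real (q powr (of_int y / 2))) a)
     (shift_poly (of_real (q powr (of_int x / 2))) (of_real (q powr (of_int y / 2))) b)"
  unfolding tau_def by (rule inj_ring_hom.fract_map_Fract[OF tau_hom])

lemma tau_minus: "tau q x y (- f) = - tau q x y f"
  using tau_add[of x y f "-f"] by (simp add: eq_neg_iff_add_eq_0 add.commute)

lemma tau_diff: "tau q x y (f - g) = tau q x y f - tau q x y g"
  using tau_add[of x y f "-g"] by (simp add: tau_minus)

lemma tau_inverse: "tau q x y (inverse f) = inverse (tau q x y f)"
proof (cases "f = 0")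
  case False
  then have "tau q x y (inverse f) * tau q x y f = 1" by (simp flip: tau_mult)
  then show ?thesis by (metis inverse_unique mult.commute)
qed simp

lemma tau_divide: "tau q x y (f / g) = tau q x y f / tau q x y g"
  by (simp add: divide_inverse tau_mult tau_inverse)

text \<open>Shifts form an action of the group Z^2, so the shifts caused by successive generators
  add up.\<close>

lemma tau_tau [simp]: "tau q x y (tau q x' y' f) = tau q (x + x') (y + y') f"
proof (cases f)
  case (Fract a b)
  have *: "shift_poly s t (shift_poly s' t' c) = shift_poly (s * s') (t * t') c" for s t s' t' c
    by (intro poly_eqI) (simp add: coeff_shift_poly power_mult_distrib)
  have ne: "shift_poly (of_real (q powr (of_int x' / 2))) (of_real (q powr (of_int y' / 2))) b \<noteq> 0"
    using inj_ring_hom.hom_ne[OF tau_hom Fract(2)] .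
  have "q powr (real_of_int x / 2) * q powr (real_of_int x' / 2) = q powr (of_int (x + x') / 2)" for x x'
    by (simp add: add_divide_distrib powr_add)
  then have "complex_of_real (q powr (real_of_int x / 2)) * of_real (q powr (real_of_int x' / 2)) = of_real (q powr (of_int (x + x') / 2))" for x x'
    by (metis of_real_mult)
  then show ?thesis
    by (simp add: Fract tau_Fract ne *)
qed

lemma tau_id [simp]: "tau q 0 0 f = f"
proof (cases f)
  case (Fract a b)
  have "shift_poly 1 1 c = c" for c by (intro poly_eqI) (simp add: coeff_shift_poly)
  then show ?thesis using q_pos by (simp add: Fract tau_Fract)
qed

lemma tau_eq_0_iff [simp]: "tau q x y f = 0 \<longleftrightarrow> f = 0"
proof
  assume "tau q x y f = 0"
  then have "tau q (-x) (-y) (tau q x y f) = 0" by simp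
  then show "f = 0" unfolding tau_tau by simp
qed simp

lemma tau_kconst [simp]: "tau q x y (kconst c) = kconst c"
proof -
  have "shift_poly s t [:[:c:]:] = [:[:c:]:]" for s t c
    by (simp add: shift_poly_def map_poly_pCons)
  then show ?thesis
    by (simp add: kconst_def tau_Fract) (simp add: shift_poly_def one_pCons map_poly_pCons)
qed

lemma tau_zvar1: "tau q x y (zvar N1) = kconst (of_real (q powr (of_int x / 2))) * zvar N1"
  by (simp add: zvar.simps tau_Fract kconst_def shift_poly_def one_pCons map_poly_pCons pcompose_pCons)

lemma tau_zvar2: "tau q x y (zvar N2) = kconst (of_real (q powr (of_int y / 2))) * zvar N2"
  by (simp add: zvar.simps tau_Fract kconst_def shift_poly_def one_pCons map_poly_pCons pcompose_pCons)

lemma tau_power_int: "tau q x y (f powi n) = tau q x y f powi n"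
proof -
  have "tau q x y (f ^ m) = tau q x y f ^ m" for m f by (induct m) (simp_all add: tau_mult)
  then show ?thesis by (simp add: power_int_def tau_inverse)
qed

lemma kconst_power_int: "kconst (c powi n) = kconst c powi n"
proof -
  have "kconst (c ^ m) = kconst c ^ m" for m c by (induct m) (simp_all add: kconst_mult)
  then show ?thesis by (simp add: power_int_def kconst_inverse)
qed

lemma powr_power_int: "(q powr x) powi n = q powr (x * of_int n)"
proof (cases "n \<ge> 0")
  case True
  then have "(q powr x) powi n = (q powr x) ^ nat n" by (simp add: power_int_def)
  also have "\<dots> = q powr (x * of_int n)"
    using True q_pos by (simp add: powr_powr flip: powr_realpow)
  finally show ?thesis .
next
  case False
  then have "(q powr x) powi n = inverse ((q powr x) ^ nat (- n))"
    by (simp add: power_int_def power_inverse)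
  also have "\<dots> = q powr (x * of_int n)"
    using False q_pos by (simp add: powr_powr powr_minus flip: powr_realpow)
  finally show ?thesis .
qed

lemma tau_qH: "tau q x y (qH m n) = kconst (of_real (q powr ((of_int m * of_int x + of_int n * of_int y) / 2))) * qH m n"
proof -
  have "kconst (complex_of_real (q powr (of_int x / 2))) powi m
      = kconst (of_real (q powr (of_int m * of_int x / 2)))" for x m
    by (simp add: powr_power_int mult.commute flip: kconst_power_int of_real_power_int)
  then show ?thesis
    by (simp add: qH_def tau_mult tau_power_int tau_zvar1 tau_zvar2 power_int_mult_distrib
        add_divide_distrib powr_add kconst_mult)
qed

lemma Qp_powr: "Qp q n = kconst (of_real (q powr of_int n))"
  using q_pos by (simp add: Qp_def powr_real_of_int')

lemma Qp_0 [simp]: "Qp q 0 = 1" by (simp add: Qp_def)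
lemma Qp_ne_0 [simp]: "Qp q n \<noteq> 0" by (simp add: Qp_def)
lemma Qp_add: "Qp q (m + n) = Qp q m * Qp q n"
  by (simp add: Qp_def power_int_add kconst_mult)
lemma Qp_minus: "Qp q (- n) = inverse (Qp q n)"
  by (simp add: Qp_def power_int_minus kconst_inverse flip: kconst_inverse)
lemma Qp_diff: "Qp q (m - n) = Qp q m / Qp q n"
  using Qp_add[of m "-n"] by (simp add: Qp_minus divide_inverse)

lemma q_powi_ne_1: "n \<noteq> 0 \<Longrightarrow> q powi n \<noteq> 1"
  using q_pos q_ne_1 powr_eq_one_iff_gen[of q "of_int n"] by (simp add: powr_real_of_int')

lemma Qp_eq_1_iff: "Qp q n = 1 \<longleftrightarrow> n = 0"
proof -
  have "Qp q n = 1 \<longleftrightarrow> kconst (of_real (q powi n) - 1) = 0"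
    by (simp add: Qp_def kconst_diff)
  also have "\<dots> \<longleftrightarrow> q powi n = 1" unfolding kconst_eq_0_iff
    by (metis of_real_1 of_real_eq_iff right_minus_eq)
  finally show ?thesis using q_powi_ne_1 by fastforce
qed

lemma Qp_neq_minus: "n \<noteq> 0 \<Longrightarrow> Qp q n - Qp q (- n) \<noteq> 0"
proof
  assume "n \<noteq> 0" "Qp q n - Qp q (- n) = 0"
  then have "Qp q (n + n) = Qp q (- n + n)" by (simp only: Qp_add) simp
  then show False using Qp_eq_1_iff[of "n + n"] \<open>n \<noteq> 0\<close> by simp
qed

lemma qn_eq_0_iff [simp]: "qn q n = 0 \<longleftrightarrow> n = 0"
  using Qp_neq_minus[of n] Qp_neq_minus[of 1] by (auto simp: qn_def)

lemma qn_0 [simp]: "qn q 0 = 0" by (simp add: qn_def)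
lemma qn_1 [simp]: "qn q 1 = 1" using Qp_neq_minus[of 1] by (simp add: qn_def)

lemma qnumH_eq: "qnumH q m n s =
  (Qp q s * qH (2 * m) (2 * n) - inverse (Qp q s * qH (2 * m) (2 * n))) / (Qp q 1 - Qp q (- 1))"
proof -
  have "qH (- 2 * m) (- 2 * n) = inverse (qH (2 * m) (2 * n))"
    using qH_minus[of "2 * m" "2 * n"] by simp
  then show ?thesis
    by (simp add: qnumH_def Qp_def kconst_diff power_int_minus flip: kconst_inverse)
qed

lemma tau_Qp [simp]: "tau q x y (Qp q n) = Qp q n" by (simp add: Qp_def)
lemma tau_qn [simp]: "tau q x y (qn q n) = qn q n" by (simp add: qn_def tau_divide tau_diff)

lemma tau_qH2: "tau q x y (qH (2 * m) (2 * n)) = Qp q (m * x + n * y) * qH (2 * m) (2 * n)"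
  by (simp add: tau_qH Qp_powr add_divide_distrib)

lemma tau_qnumH: "tau q x y (qnumH q m n s) = qnumH q m n (s + m * x + n * y)"
proof -
  have *: "Qp q s * (Qp q (m * x + n * y) * k) = Qp q (s + m * x + n * y) * k" for k
    by (simp only: Qp_add mult.assoc)
  show ?thesis
    by (simp only: qnumH_eq tau_divide tau_diff tau_inverse tau_mult tau_qH2 tau_Qp *)
qed

text \<open>A vanishing bracket stays zero under the shift by (m, n), which adds d = m^2 + n^2 > 0
  to its constant. Two vanishing brackets whose constants differ by d force q^(2d) = 1. This
  justifies every division by a Cartan bracket below.\<close>

lemma qnumH_ne_0:
  assumes "m \<noteq> 0 \<or> n \<noteq> 0"
  shows "qnumH q m n s \<noteq> 0"
proof
  assume 0: "qnumH q m n s = 0"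
  have "qnumH q m n (s + (m * m + n * n)) = 0"
    using 0 tau_qnumH[of m n m n s] by (simp add: add.assoc)
  define d where "d = m * m + n * n"
  have d: "d > 0" unfolding d_def using assms by (simp add: sum_squares_gt_zero_iff)
  have D: "Qp q 1 - Qp q (-1) \<noteq> 0" using Qp_neq_minus[of 1] by simp
  define k where "k = qH (2 * m) (2 * n)"
  have k: "k \<noteq> 0" by (simp add: k_def)
  have e: "Qp q (2 * t) * k ^ 2 = 1" if "qnumH q m n t = 0" for t
  proof -
    have "Qp q t * k = inverse (Qp q t * k)" using that D by (simp add: qnumH_eq flip: k_def)
    moreover have "Qp q t * k \<noteq> 0" using k by simp
    ultimately have "(Qp q t * k) * (Qp q t * k) = 1" using right_inverse by metis
    moreover have "Qp q (2 * t) = Qp q t * Qp q t" by (simp only: mult_2 Qp_add)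
    ultimately show ?thesis by (simp only: power2_eq_square mult_ac)
  qed
  have "Qp q (2 * (s + d)) * k ^ 2 = Qp q (2 * s) * k ^ 2"
    using e[OF 0] e[of "s + d"] \<open>qnumH q m n (s + (m * m + n * n)) = 0\<close> unfolding d_def by metis
  then have "Qp q (2 * (s + d)) = Qp q (2 * s)" using k by simp
  then have "Qp q (2 * s) * Qp q (2 * d) = Qp q (2 * s)" by (simp only: distrib_left Qp_add)
  then have "Qp q (2 * d) = 1" by simp
  then show False using d by (simp add: Qp_eq_1_iff)
qed

end


section \<open>The left regular representation on series\<close>

text \<open>
  The coefficients of \<open>e F\<close> in terms of those of \<open>F\<close>, obtained by moving the generator \<open>e\<close> into the
  ordered monomials. Exponents range over the integers, so that the relations between these
  operators hold without case distinctions at the boundary.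
\<close>

type_synonym zseries = "int \<Rightarrow> int \<Rightarrow> int \<Rightarrow> int \<Rightarrow> int \<Rightarrow> int \<Rightarrow> cartan"

definition zL21 :: "zseries \<Rightarrow> zseries" where
  "zL21 F a1 a2 a3 b1 b2 b3 = F (a1 - 1) a2 a3 b1 b2 b3"

text \<open>Encodes e32 e21^n = q^(-n) e21^n e32 + [n] e21^(n-1) e31 and e32 e31 = q e31 e32. The
  index on the left is that of the result, whence [a1 + 1].\<close>

definition zL32 :: "real \<Rightarrow> zseries \<Rightarrow> zseries" where
  "zL32 q F a1 a2 a3 b1 b2 b3 =
     Qp q (a2 - a1) * F a1 a2 (a3 - 1) b1 b2 b3 + qn q (a1 + 1) * F (a1 + 1) (a2 - 1) a3 b1 b2 b3"

definition zLC :: "real \<Rightarrow> cartan \<Rightarrow> zseries \<Rightarrow> zseries" where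
  "zLC q g F a1 a2 a3 b1 b2 b3 =
     tau q (- 2 * a1 - a2 + a3) (a1 - a2 - 2 * a3) g * F a1 a2 a3 b1 b2 b3"

text \<open>The three terms come from the commutator of \<open>e12\<close> with a power of
  \<open>e21\<close>, from e12 e31 - e31 e12 = -q^(-h1) e32, and from \<open>e12\<close> passing the
  Cartan factor.\<close>

definition zL12 :: "real \<Rightarrow> zseries \<Rightarrow> zseries" where
  "zL12 q F a1 a2 a3 b1 b2 b3 =
     qn q (a1 + 1) * qnumH q 1 0 (a3 - a1 - a2) * F (a1 + 1) a2 a3 b1 b2 b3
     - qn q (a2 + 1) * Qp q (a2 - a3) * qH (- 2) 0 * F a1 (a2 + 1) (a3 - 1) b1 b2 b3
     + tau q (- 2) 1 (F a1 a2 a3 (b1 - 1) b2 b3)"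

text \<open>The first two terms come from e23 e31 - e31 e23 = e21 q^(h2) and from the commutator of
  \<open>e23\<close> with a power of \<open>e32\<close>. The last two arise beyond the Cartan
  factor, from e23 e12^n = q^(-n) e12^n e23 - q^(-1) [n] e12^(n-1) e13 and e23 e13 = q e13
  e23.\<close>

definition zL23 :: "real \<Rightarrow> zseries \<Rightarrow> zseries" where
  "zL23 q F a1 a2 a3 b1 b2 b3 =
     qn q (a2 + 1) * Qp q (- 2 * a3) * qH 0 2 * F (a1 - 1) (a2 + 1) a3 b1 b2 b3
     + qn q (a3 + 1) * qnumH q 0 1 (- a3) * F a1 a2 (a3 + 1) b1 b2 b3
     + Qp q (b2 - b1) * tau q 1 (- 2) (F a1 a2 a3 b1 b2 (b3 - 1))
     - Qp q (- 1) * qn q (b1 + 1) * tau q 1 (- 2) (F a1 a2 a3 (b1 + 1) (b2 - 1) b3)"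

lemmas zdefs = zL21_def zL32_def zLC_def zL12_def zL23_def

section \<open>Bracket identities and the defining relations on coefficients\<close>

context qparam begin

text \<open>Numerical and Cartan-valued brackets are both values of this function, so each identity
  is proved once for both.\<close>

definition br :: "cartan \<Rightarrow> cartan" where
  "br x = (x - inverse x) / (Qp q 1 - Qp q (- 1))"

lemma qn_br: "qn q n = br (Qp q n)"
  by (simp add: qn_def br_def Qp_minus)

lemma qnumH_br: "qnumH q m n s = br (Qp q s * qH (2 * m) (2 * n))"
  by (simp add: qnumH_eq br_def)

lemma br_mult: "x \<noteq> 0 \<Longrightarrow> y \<noteq> 0 \<Longrightarrow> br (x * y) = y * br x + br y / x"
  by (simp add: br_def diff_divide_distrib divide_inverse algebra_simps)

text \<open>Multiplicative form of [a+1][s] = [a][s+1] + [s-a], with q^a and q^s replaced by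
  arbitrary nonzero Cartan elements. The commutators of raising with lowering generators reduce to
  it.\<close>

lemma br_exchange:
  assumes "x \<noteq> 0" "t \<noteq> 0"
  shows "br (x * Qp q 1) * br t = br x * br (t * Qp q 1) + br (t / x)"
proof -
  define d where "d = Qp q 1 - Qp q (- 1)"
  have d: "d \<noteq> 0" using Qp_neq_minus[of 1] by (simp add: d_def)
  have "(x * Qp q 1 - inverse (x * Qp q 1)) * (t - inverse t)
      - (x - inverse x) * (t * Qp q 1 - inverse (t * Qp q 1)) = d * (t / x - inverse (t / x))"
    using assms by (simp add: d_def Qp_minus field_simps)
  moreover have "A / d * (B / d) = C / d * (E / d) + G / d" if "A * B - C * E = d * G" for A B C E G
    using that d by (simp add: field_simps)
  ultimately show ?thesis
    unfolding br_def d_def by blast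
qed

lemma qn_add: "qn q (m + n) = Qp q n * qn q m + qn q n / Qp q m"
  by (simp add: qn_br Qp_add br_mult)

lemma qn_minus: "qn q (- n) = - qn q n"
  by (simp add: qn_def minus_divide_left)

lemma qn_diff: "qn q (m - n) = qn q m / Qp q n - qn q n / Qp q m"
  using qn_add[of m "-n"] by (simp add: qn_minus Qp_minus divide_inverse)

lemma qn_exchange: "qn q (a + 1) * qn q s = qn q a * qn q (s + 1) + qn q (s - a)"
  by (simp add: qn_br Qp_add Qp_diff br_exchange)

lemma qn_qnumH_exchange:
  "qn q (a + 1) * qnumH q m n s = qn q a * qnumH q m n (s + 1) + qnumH q m n (s - a)"
  using br_exchange[of "Qp q a" "Qp q s * qH (2 * m) (2 * n)"]
  by (simp add: qn_br qnumH_br Qp_add Qp_diff mult_ac)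

lemma qnumH_add: "qnumH q m n (s + t) = Qp q t * qnumH q m n s + qn q t / (Qp q s * qH (2 * m) (2 * n))"
  using br_mult[of "Qp q s * qH (2 * m) (2 * n)" "Qp q t"] by (simp add: qn_br qnumH_br Qp_add mult_ac)

lemma qnumH_add': "qnumH q m n (s + t) = qnumH q m n s / Qp q t + qn q t * Qp q s * qH (2 * m) (2 * n)"
  using br_mult[of "Qp q t" "Qp q s * qH (2 * m) (2 * n)"] by (simp add: qn_br qnumH_br Qp_add mult_ac)

lemma qn_add': "qn q (m + n) = qn q m / Qp q n + qn q n * Qp q m"
  using qn_add[of n m] by (simp add: algebra_simps)

lemma qn_plus_1: "qn q (a + 1) = Qp q 1 * qn q a + inverse (Qp q a)"
    and qn_minus_1: "qn q (a - 1) = qn q a / Qp q 1 - inverse (Qp q a)"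
  using qn_add[of a 1] qn_diff[of a 1] by (simp_all add: divide_inverse)

lemma qn_three_term: "qn q (a + 1) + qn q (a - 1) = (Qp q 1 + Qp q (- 1)) * qn q a"
  unfolding qn_plus_1 qn_minus_1 by (simp add: Qp_minus field_simps)

lemma Qp_double: "Qp q (2 * a) = Qp q a * Qp q a" "Qp q (a * 2) = Qp q a * Qp q a"
    "Qp q 2 = Qp q 1 * Qp q 1" "Qp q 3 = Qp q 1 * (Qp q 1 * Qp q 1)"
  using Qp_add[of a a] Qp_add[of 1 1] Qp_add[of 1 2] by (simp_all add: mult.commute)

lemma qH2_expand: "qH 2 2 = qH 2 0 * qH 0 2" "qH (- 2) 0 = inverse (qH 2 0)" "qH 0 (- 2) = inverse (qH 0 2)"
  using qH_add[of 2 0 0 2] qH_minus[of 2 0] qH_minus[of 0 2] by simp_all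

lemma tau_qH_expand: "tau q x y (qH 2 0) = Qp q x * qH 2 0" "tau q x y (qH 0 2) = Qp q y * qH 0 2"
    "tau q x y (qH (- 2) 0) = inverse (Qp q x * qH 2 0)"
  using tau_qH2[of x y 1 0] tau_qH2[of x y 0 1] tau_qH2[of x y "-1" 0]
  by (simp_all add: qH2_expand Qp_minus)

lemma zL12_zL21: "zL12 q (zL21 F) = (\<lambda>a1 a2 a3 b1 b2 b3. zL21 (zL12 q F) a1 a2 a3 b1 b2 b3
     + zLC q (qnumH q 1 0 0) F a1 a2 a3 b1 b2 b3)"
proof (intro ext)
  fix a1 a2 a3 b1 b2 b3
  have c: "qn q (a1 + 1) * qnumH q 1 0 (a3 - a1 - a2)
     = qn q a1 * qnumH q 1 0 (a3 - a1 - a2 + 1) + qnumH q 1 0 (a3 - a1 - a2 - a1)"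
    by (rule qn_qnumH_exchange)
  have "zL12 q (zL21 F) a1 a2 a3 b1 b2 b3 - (zL21 (zL12 q F) a1 a2 a3 b1 b2 b3
     + zLC q (qnumH q 1 0 0) F a1 a2 a3 b1 b2 b3) = (qn q (a1 + 1) * qnumH q 1 0 (a3 - a1 - a2)
     - (qn q a1 * qnumH q 1 0 (a3 - a1 - a2 + 1) + qnumH q 1 0 (a3 - a1 - a2 - a1))) * F a1 a2 a3 b1 b2 b3"
    by (simp add: zdefs tau_qnumH algebra_simps)
  then show "zL12 q (zL21 F) a1 a2 a3 b1 b2 b3 = zL21 (zL12 q F) a1 a2 a3 b1 b2 b3
     + zLC q (qnumH q 1 0 0) F a1 a2 a3 b1 b2 b3"
    using c by simp
qed

lemma zL12_zL32: "zL12 q (zL32 q F) = zL32 q (zL12 q F)"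
proof (intro ext)
  fix a1 a2 a3 b1 b2 b3
  define T where "T = qnumH q 1 0 (a3 - a1 - a2)"
  have 1: "qnumH q 1 0 (a3 - 1 - a1 - a2) = T / Qp q 1 - inverse (Qp q (a3 - a1 - a2) * qH 2 0)"
    using qnumH_add[of 1 0 "a3 - a1 - a2" "-1"]
    by (simp add: T_def qn_minus Qp_minus algebra_simps divide_inverse)
  have 2: "qn q (a2 + 1) = qn q a2 / Qp q 1 + Qp q a2"
    using qn_add'[of a2 1] by simp
  \<comment> \<open>All entries cancel identically except F (a1 + 1) a2 (a3 - 1); \<open>c\<close>
    compares its coefficients along the two orders of multiplication.\<close>
  have c: "T * Qp q (a2 - a1 - 1) - qn q (a2 + 1) * Qp q (a2 - a3) * qH (- 2) 0
      = Qp q (a2 - a1) * qnumH q 1 0 (a3 - 1 - a1 - a2) - qn q a2 * Qp q (a2 - 1 - a3) * qH (- 2) 0"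
    unfolding 1 2 by (simp add: Qp_diff Qp_add qH2_expand field_simps)
  have "zL12 q (zL32 q F) a1 a2 a3 b1 b2 b3 - zL32 q (zL12 q F) a1 a2 a3 b1 b2 b3
    = qn q (a1 + 1) * (T * Qp q (a2 - a1 - 1) - qn q (a2 + 1) * Qp q (a2 - a3) * qH (- 2) 0
      - (Qp q (a2 - a1) * qnumH q 1 0 (a3 - 1 - a1 - a2) - qn q a2 * Qp q (a2 - 1 - a3) * qH (- 2) 0))
      * F (a1 + 1) a2 (a3 - 1) b1 b2 b3"
    by (simp add: zdefs T_def tau_add tau_mult tau_divide tau_inverse Qp_diff Qp_add algebra_simps divide_inverse)
  then show "zL12 q (zL32 q F) a1 a2 a3 b1 b2 b3 = zL32 q (zL12 q F) a1 a2 a3 b1 b2 b3"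
    unfolding c by simp
qed

lemma zL23_zL21: "zL23 q (zL21 F) = zL21 (zL23 q F)"
  by (intro ext) (simp add: zdefs)

lemma zL23_zL32: "zL23 q (zL32 q F) = (\<lambda>a1 a2 a3 b1 b2 b3. zL32 q (zL23 q F) a1 a2 a3 b1 b2 b3
     + zLC q (qnumH q 0 1 0) F a1 a2 a3 b1 b2 b3)"
proof (intro ext)
  fix a1 a2 a3 b1 b2 b3
  define T where "T = qnumH q 0 1 (- 2 * a3)"
  have 1: "qn q (a3 + 1) * qnumH q 0 1 (- a3) = qn q a3 * qnumH q 0 1 (1 - a3) + T"
    using qn_qnumH_exchange[of a3 0 1 "- a3"] by (simp add: T_def algebra_simps)
  have 2: "qn q (a1 + 1) * qn q a2 = qn q a1 * qn q (a2 + 1) + qn q (a2 - a1)"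
    by (rule qn_exchange)
  have 3: "qnumH q 0 1 (- 2 * a3 - (a2 - a1)) = Qp q (a2 - a1) * T - qn q (a2 - a1) * Qp q (- 2 * a3) * qH 0 2"
  proof -
    have "qnumH q 0 1 (- 2 * a3 + - (a2 - a1)) = Qp q (a2 - a1) * T - qn q (a2 - a1) * Qp q (- 2 * a3) * qH 0 2"
      unfolding T_def qnumH_add' qn_minus Qp_minus[of "a2 - a1"] by (simp add: divide_inverse mult.commute)
    moreover have "- 2 * a3 - (a2 - a1) = - 2 * a3 + - (a2 - a1)" by simp
    ultimately show ?thesis by metis
  qed
  \<comment> \<open>Total coefficient of the diagonal entry F a1 a2 a3, the one place where the two
    sides do not match term by term.\<close>
  have c: "qn q (a2 + 1) * qn q a1 * Qp q (- 2 * a3) * qH 0 2 + qn q (a3 + 1) * qnumH q 0 1 (- a3) * Qp q (a2 - a1)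
     - Qp q (a2 - a1) * (qn q a3 * qnumH q 0 1 (1 - a3)) - (qn q (a1 + 1) * qn q a2) * Qp q (- 2 * a3) * qH 0 2
     - qnumH q 0 1 (- 2 * a3 - (a2 - a1)) = 0"
    unfolding 1 2 3 by (simp add: algebra_simps)
  have "zL23 q (zL32 q F) a1 a2 a3 b1 b2 b3 - (zL32 q (zL23 q F) a1 a2 a3 b1 b2 b3
     + zLC q (qnumH q 0 1 0) F a1 a2 a3 b1 b2 b3)
    = (qn q (a2 + 1) * qn q a1 * Qp q (- 2 * a3) * qH 0 2 + qn q (a3 + 1) * qnumH q 0 1 (- a3) * Qp q (a2 - a1)
     - Qp q (a2 - a1) * (qn q a3 * qnumH q 0 1 (1 - a3)) - (qn q (a1 + 1) * qn q a2) * Qp q (- 2 * a3) * qH 0 2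
     - qnumH q 0 1 (- 2 * a3 - (a2 - a1))) * F a1 a2 a3 b1 b2 b3"
    by (simp add: zdefs tau_add tau_diff tau_mult tau_inverse tau_qnumH Qp_double Qp_minus Qp_diff Qp_add
        algebra_simps divide_inverse)
  then show "zL23 q (zL32 q F) a1 a2 a3 b1 b2 b3 = zL32 q (zL23 q F) a1 a2 a3 b1 b2 b3
     + zLC q (qnumH q 0 1 0) F a1 a2 a3 b1 b2 b3"
    unfolding c by simp
qed

text \<open>Entry by entry the relation reduces to [a+1] + [a-1] = (q + q^(-1)) [a] and its analogue
  for powers of q.\<close>

lemma zserre_neg_211: "zL32 q (zL21 (zL21 F)) a1 a2 a3 b1 b2 b3
  - (Qp q 1 + Qp q (- 1)) * zL21 (zL32 q (zL21 F)) a1 a2 a3 b1 b2 b3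
  + zL21 (zL21 (zL32 q F)) a1 a2 a3 b1 b2 b3 = 0" (is "?L = 0")
proof -
  have "?L = (qn q (a1 + 1) + qn q (a1 - 1) - (Qp q 1 + Qp q (- 1)) * qn q a1) * F (a1 - 1) (a2 - 1) a3 b1 b2 b3
    + (Qp q (a2 - a1) - (Qp q 1 + Qp q (- 1)) * Qp q (a2 - (a1 - 1)) + Qp q (a2 - (a1 - 2))) * F (a1 - 2) a2 (a3 - 1) b1 b2 b3"
    by (simp add: zdefs Qp_diff Qp_minus Qp_add algebra_simps)
  also have "Qp q (a2 - a1) - (Qp q 1 + Qp q (- 1)) * Qp q (a2 - (a1 - 1)) + Qp q (a2 - (a1 - 2)) = 0"
    by (simp add: Qp_diff Qp_add Qp_minus Qp_double field_simps)
  finally show ?thesis unfolding qn_three_term by simp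
qed

lemma zserre_neg_322: "zL21 (zL32 q (zL32 q F)) a1 a2 a3 b1 b2 b3
  - (Qp q 1 + Qp q (- 1)) * zL32 q (zL21 (zL32 q F)) a1 a2 a3 b1 b2 b3
  + zL32 q (zL32 q (zL21 F)) a1 a2 a3 b1 b2 b3 = 0" (is "?L = 0")
proof -
  define x y Q where "x = Qp q a1" and "y = Qp q a2" and "Q = Qp q 1"
  have [simp]: "x \<noteq> 0" "y \<noteq> 0" "Q \<noteq> 0" by (simp_all add: x_def y_def Q_def)
  have "?L = qn q (a1 + 1) * (qn q (a1 + 1 + 1) + qn q (a1 + 1 - 1)
        - (Qp q 1 + Qp q (- 1)) * qn q (a1 + 1)) * F (a1 + 1) (a2 - 2) a3 b1 b2 b3
    + (y / x * Q * (y / x * Q) - (Q + inverse Q) * (y / x) * (y / x * Q) + y / x * (y / x)) * F (a1 - 1) a2 (a3 - 2) b1 b2 b3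
    + (y / x * Q * qn q a1 + qn q a1 * (y / (x * Q)) - (Q + inverse Q) * (y / x * qn q a1 + qn q (a1 + 1) * (y / (x * Q)))
       + (y / x * qn q (a1 + 1) + qn q (a1 + 1) * (y / (x * Q * Q)))) * F a1 (a2 - 1) (a3 - 1) b1 b2 b3"
    unfolding x_def y_def Q_def
    by (simp add: zdefs Qp_diff Qp_minus Qp_add Qp_double algebra_simps divide_inverse)
  also have "y / x * Q * qn q a1 + qn q a1 * (y / (x * Q)) - (Q + inverse Q) * (y / x * qn q a1 + qn q (a1 + 1) * (y / (x * Q)))
       + (y / x * qn q (a1 + 1) + qn q (a1 + 1) * (y / (x * Q * Q))) = 0"
    by (simp add: field_simps)
  also have "y / x * Q * (y / x * Q) - (Q + inverse Q) * (y / x) * (y / x * Q) + y / x * (y / x) = 0"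
    by (simp add: field_simps)
  finally show ?thesis unfolding qn_three_term by simp
qed

end


section \<open>From integer exponents to series with natural exponents\<close>

definition zext :: "series \<Rightarrow> zseries" where
  "zext F a1 a2 a3 b1 b2 b3 =
     (if 0 \<le> a1 \<and> 0 \<le> a2 \<and> 0 \<le> a3 \<and> 0 \<le> b1 \<and> 0 \<le> b2 \<and> 0 \<le> b3
      then F (nat a1, nat a2, nat a3, nat b1, nat b2, nat b3) else 0)"

definition zrest :: "zseries \<Rightarrow> series" where
  "zrest Z = (\<lambda>(a1, a2, a3, b1, b2, b3). Z (int a1) (int a2) (int a3) (int b1) (int b2) (int b3))"

fun zop :: "real \<Rightarrow> gen \<Rightarrow> zseries \<Rightarrow> zseries" where
  "zop q (Pos N1) = zL12 q"
| "zop q (Pos N2) = zL23 q"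
| "zop q (Neg N1) = zL21"
| "zop q (Neg N2) = zL32 q"
| "zop q (Car f) = zLC q f"

definition Lop :: "real \<Rightarrow> gen \<Rightarrow> series \<Rightarrow> series" where
  "Lop q g F = zrest (zop q g (zext F))"

lemma zrest_zext [simp]: "zrest (zext F) = F"
  by (auto simp: zrest_def zext_def)

lemma zext_eqI: "zext F = zext G \<Longrightarrow> F = G"
  by (metis zrest_zext)

lemma zext_plus: "zext (F + G) a1 a2 a3 b1 b2 b3 = zext F a1 a2 a3 b1 b2 b3 + zext G a1 a2 a3 b1 b2 b3"
  by (simp add: zext_def)

lemma gen_cases [case_names Pos1 Pos2 Neg1 Neg2 Car]:
  obtains "g = Pos N1" | "g = Pos N2" | "g = Neg N1" | "g = Neg N2" | f where "g = Car f"
  by (metis gen.exhaust node.exhaust)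

context qparam begin

text \<open>The only danger is a term that reads an entry with exponent 0 while the result has
  exponent -1; such a term carries the factor [-1 + 1] = 0. Identities over the integers therefore
  restrict to series.\<close>

lemma zext_Lop: "zext (Lop q g F) = zop q g (zext F)"
proof (intro ext)
  fix a1 a2 a3 b1 b2 b3
  have "zop q g (zext F) a1 a2 a3 b1 b2 b3 = 0"
    if "\<not> (0 \<le> a1 \<and> 0 \<le> a2 \<and> 0 \<le> a3 \<and> 0 \<le> b1 \<and> 0 \<le> b2 \<and> 0 \<le> b3)"
  proof -
    have *: "qn q (n + 1) = 0 \<or> n + 1 < 0" if "n < 0" for n
      using that by auto
    show ?thesis
      using that *[of a1] *[of a2] *[of a3] *[of b1]
      by (cases g rule: gen_cases) (auto simp: zdefs zext_def)
  qed
  then show "zext (Lop q g F) a1 a2 a3 b1 b2 b3 = zop q g (zext F) a1 a2 a3 b1 b2 b3"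
    unfolding Lop_def by (subst zext_def) (auto simp: zrest_def)
qed

lemma Lop_plus: "Lop q g (F + G) = Lop q g F + Lop q g G"
proof -
  have "zop q g (zext (F + G)) a1 a2 a3 b1 b2 b3
      = zop q g (zext F) a1 a2 a3 b1 b2 b3 + zop q g (zext G) a1 a2 a3 b1 b2 b3" for a1 a2 a3 b1 b2 b3
    by (cases g rule: gen_cases) (simp_all add: zdefs zext_plus tau_add algebra_simps)
  then show ?thesis by (auto simp: Lop_def zrest_def fun_eq_iff)
qed

lemma Lop_0 [simp]: "Lop q g 0 = 0"
  using Lop_plus[of g 0 0] by simp

lemma Lop_minus: "Lop q g (- F) = - Lop q g F"
  using Lop_plus[of g F "- F"] by (simp add: eq_neg_iff_add_eq_0 add.commute)

lemma Lop_diff: "Lop q g (F - G) = Lop q g F - Lop q g G"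
  using Lop_plus[of g F "- G"] by (simp add: Lop_minus)

lemma LC_apply: "Lop q (Car g) F (a1, a2, a3, b) =
     tau q (- 2 * int a1 - int a2 + int a3) (int a1 - int a2 - 2 * int a3) g * F (a1, a2, a3, b)"
  by (cases b) (simp add: Lop_def zrest_def zLC_def zext_def)

lemma LC_add: "Lop q (Car (f + g)) F = Lop q (Car f) F + Lop q (Car g) F"
  by (rule ext, case_tac x) (simp add: LC_apply tau_add algebra_simps)

lemma LC_diff: "Lop q (Car (f - g)) F = Lop q (Car f) F - Lop q (Car g) F"
  by (rule ext, case_tac x) (simp add: LC_apply tau_diff algebra_simps)

lemma LC_mult: "Lop q (Car (f * g)) F = Lop q (Car f) (Lop q (Car g) F)"
  by (rule ext, case_tac x) (simp add: LC_apply tau_mult algebra_simps)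

lemma LC_kconst: "Lop q (Car (kconst c)) F m = kconst c * F m"
  by (cases m) (simp add: LC_apply)

lemma LC_Qp: "Lop q (Car (Qp q n)) F m = Qp q n * F m"
  by (simp add: Qp_def LC_kconst)

lemma LC_0 [simp]: "Lop q (Car 0) F = 0"
  by (rule ext, case_tac x) (simp add: LC_apply)

lemma LC_1 [simp]: "Lop q (Car 1) F = F"
  by (rule ext, case_tac x) (simp add: LC_apply)

lemma L12_L21: "Lop q (Pos N1) (Lop q (Neg N1) F) = Lop q (Neg N1) (Lop q (Pos N1) F) + Lop q (Car (qnumH q 1 0 0)) F"
  by (rule zext_eqI) (simp add: zext_Lop zext_plus zL12_zL21 fun_eq_iff)

lemma L12_L32: "Lop q (Pos N1) (Lop q (Neg N2) F) = Lop q (Neg N2) (Lop q (Pos N1) F)"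
  by (rule zext_eqI) (simp add: zext_Lop zL12_zL32)

lemma L23_L21: "Lop q (Pos N2) (Lop q (Neg N1) F) = Lop q (Neg N1) (Lop q (Pos N2) F)"
  by (rule zext_eqI) (simp add: zext_Lop zL23_zL21)

lemma L23_L32: "Lop q (Pos N2) (Lop q (Neg N2) F) = Lop q (Neg N2) (Lop q (Pos N2) F) + Lop q (Car (qnumH q 0 1 0)) F"
  by (rule zext_eqI) (simp add: zext_Lop zext_plus zL23_zL32 fun_eq_iff)

lemma L12_LC: "Lop q (Pos N1) (Lop q (Car g) F) = Lop q (Car (tau q (- 2) 1 g)) (Lop q (Pos N1) F)"
  by (rule zext_eqI) (simp add: zext_Lop fun_eq_iff zdefs tau_mult tau_add tau_diff algebra_simps)

lemma L23_LC: "Lop q (Pos N2) (Lop q (Car g) F) = Lop q (Car (tau q 1 (- 2) g)) (Lop q (Pos N2) F)"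
  by (rule zext_eqI) (simp add: zext_Lop fun_eq_iff zdefs tau_mult tau_add tau_diff algebra_simps)

lemma LC_L21: "Lop q (Car g) (Lop q (Neg N1) F) = Lop q (Neg N1) (Lop q (Car (tau q (- 2) 1 g)) F)"
  by (rule zext_eqI) (simp add: zext_Lop fun_eq_iff zdefs tau_mult tau_add tau_diff algebra_simps)

lemma LC_L32: "Lop q (Car g) (Lop q (Neg N2) F) = Lop q (Neg N2) (Lop q (Car (tau q 1 (- 2) g)) F)"
  by (rule zext_eqI) (simp add: zext_Lop fun_eq_iff zdefs tau_mult tau_add tau_diff algebra_simps)

lemma serre_neg_211: "Lop q (Neg N2) (Lop q (Neg N1) (Lop q (Neg N1) F))
   - Lop q (Car (Qp q 1 + Qp q (- 1))) (Lop q (Neg N1) (Lop q (Neg N2) (Lop q (Neg N1) F)))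
   + Lop q (Neg N1) (Lop q (Neg N1) (Lop q (Neg N2) F)) = 0"
proof -
  have "zext (Lop q (Neg N2) (Lop q (Neg N1) (Lop q (Neg N1) F))
     + Lop q (Neg N1) (Lop q (Neg N1) (Lop q (Neg N2) F)))
    = zext (Lop q (Car (Qp q 1 + Qp q (- 1))) (Lop q (Neg N1) (Lop q (Neg N2) (Lop q (Neg N1) F))))"
    using zserre_neg_211[of "zext F"]
    by (simp add: fun_eq_iff zext_plus zext_Lop zLC_def tau_add algebra_simps)
  from zext_eqI[OF this] show ?thesis by (simp add: algebra_simps)
qed

lemma serre_neg_322: "Lop q (Neg N1) (Lop q (Neg N2) (Lop q (Neg N2) F))
   - Lop q (Car (Qp q 1 + Qp q (- 1))) (Lop q (Neg N2) (Lop q (Neg N1) (Lop q (Neg N2) F)))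
   + Lop q (Neg N2) (Lop q (Neg N2) (Lop q (Neg N1) F)) = 0"
proof -
  have "zext (Lop q (Neg N1) (Lop q (Neg N2) (Lop q (Neg N2) F))
     + Lop q (Neg N2) (Lop q (Neg N2) (Lop q (Neg N1) F)))
    = zext (Lop q (Car (Qp q 1 + Qp q (- 1))) (Lop q (Neg N2) (Lop q (Neg N1) (Lop q (Neg N2) F))))"
    using zserre_neg_322[of "zext F"]
    by (simp add: fun_eq_iff zext_plus zext_Lop zLC_def tau_add algebra_simps)
  from zext_eqI[OF this] show ?thesis by (simp add: algebra_simps)
qed

subsection \<open>The Serre relations for the raising operators\<close>

definition serre_op :: "node \<Rightarrow> node \<Rightarrow> series \<Rightarrow> series" where
  "serre_op i j F = Lop q (Pos i) (Lop q (Pos j) (Lop q (Pos j) F))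
     - Lop q (Car (Qp q 1 + Qp q (- 1))) (Lop q (Pos j) (Lop q (Pos i) (Lop q (Pos j) F)))
     + Lop q (Pos j) (Lop q (Pos j) (Lop q (Pos i) F))"

lemma serre_op_plus: "serre_op i j (F + G) = serre_op i j F + serre_op i j G"
  by (simp add: serre_op_def Lop_plus algebra_simps)

lemma qnumH_three_term: "qnumH q m n (s + 1) + qnumH q m n (s - 1) = (Qp q 1 + Qp q (- 1)) * qnumH q m n s"
  using qnumH_add[of m n s 1] qnumH_add[of m n s "-1"] by (simp add: qn_minus algebra_simps)

lemma tau_Q2 [simp]: "tau q x y (Qp q 1 + Qp q (- 1)) = Qp q 1 + Qp q (- 1)"
  by (simp add: tau_add)

lemmas L_normalize = L12_L21 L12_L32 L23_L21 L23_L32 L12_LC L23_LC LC_L21 LC_L32 Lop_plus Lop_diff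
  LC_mult[symmetric] tau_qnumH

text \<open>Moving the lowering operator through leaves Cartan multiples of products of two raising
  operators. Their coefficients are all of the form [x+1] - (q + q^(-1)) [x] + [x-1] and
  vanish.\<close>

lemma serre_op_lowering:
  assumes "i \<noteq> j"
  shows "serre_op i j (Lop q (Neg k) F) = Lop q (Neg k) (serre_op i j F)"
proof -
  define c where "c = Qp q 1 + Qp q (- 1)"
  have c: "tau q x y c = c" for x y by (simp add: c_def)
  have 3: "qnumH q m n (s + 1) - c * qnumH q m n s + qnumH q m n (s - 1) = 0" for m n s
    using qnumH_three_term[of m n s] by (simp add: c_def algebra_simps)
  have 0: "X = Y" if "X - Y = 0" for X Y :: series using that by (simp only: right_minus_eq)
  have 4: "qnumH q m n 0 - c * qnumH q m n 1 + qnumH q m n 2 = 0"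
      "qnumH q m n 1 + qnumH q m n (- 1) - c * qnumH q m n 0 = 0"
      "qnumH q m n 0 + qnumH q m n (- 2) - c * qnumH q m n (- 1) = 0" for m n
    using 3[of m n 1] 3[of m n 0] 3[of m n "-1"] by (simp_all add: algebra_simps)
  consider "i = N1" "j = N2" "k = N1" | "i = N2" "j = N1" "k = N1"
    | "i = N1" "j = N2" "k = N2" | "i = N2" "j = N1" "k = N2"
    using assms by (metis node.exhaust)
  then show ?thesis
  proof cases
    case 1
    have "serre_op N1 N2 (Lop q (Neg N1) F) - Lop q (Neg N1) (serre_op N1 N2 F)
      = Lop q (Car (qnumH q 1 0 0 - c * qnumH q 1 0 1 + qnumH q 1 0 2)) (Lop q (Pos N2) (Lop q (Pos N2) F))"
      unfolding serre_op_def c_def[symmetric] LC_add LC_diff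
      by (simp add: L_normalize c algebra_simps)
    then show ?thesis unfolding 1 4 LC_0 by (rule 0)
  next
    case 2
    have "serre_op N2 N1 (Lop q (Neg N1) F) - Lop q (Neg N1) (serre_op N2 N1 F)
      = Lop q (Car (qnumH q 1 0 0 + qnumH q 1 0 (- 2) - c * qnumH q 1 0 (- 1))) (Lop q (Pos N1) (Lop q (Pos N2) F))
      + Lop q (Car (qnumH q 1 0 1 + qnumH q 1 0 (- 1) - c * qnumH q 1 0 0)) (Lop q (Pos N2) (Lop q (Pos N1) F))"
      unfolding serre_op_def c_def[symmetric] LC_add LC_diff
      by (simp add: L_normalize c algebra_simps)
    then show ?thesis unfolding 2 4 LC_0 add_0_left by (rule 0)
  next
    case 3
    have "serre_op N1 N2 (Lop q (Neg N2) F) - Lop q (Neg N2) (serre_op N1 N2 F)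
      = Lop q (Car (qnumH q 0 1 0 + qnumH q 0 1 (- 2) - c * qnumH q 0 1 (- 1))) (Lop q (Pos N2) (Lop q (Pos N1) F))
      + Lop q (Car (qnumH q 0 1 1 + qnumH q 0 1 (- 1) - c * qnumH q 0 1 0)) (Lop q (Pos N1) (Lop q (Pos N2) F))"
      unfolding serre_op_def c_def[symmetric] LC_add LC_diff
      by (simp add: L_normalize c algebra_simps)
    then show ?thesis unfolding 3 4 LC_0 add_0_left by (rule 0)
  next
    case 4
    have "serre_op N2 N1 (Lop q (Neg N2) F) - Lop q (Neg N2) (serre_op N2 N1 F)
      = Lop q (Car (qnumH q 0 1 0 - c * qnumH q 0 1 1 + qnumH q 0 1 2)) (Lop q (Pos N1) (Lop q (Pos N1) F))"
      unfolding serre_op_def c_def[symmetric] LC_add LC_diff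
      by (simp add: L_normalize c algebra_simps)
    then show ?thesis unfolding 4 \<open>\<And>n m. qnumH q m n 0 - c * qnumH q m n 1 + qnumH q m n 2 = 0\<close> LC_0 by (rule 0)
  qed
qed

lemma Neg_apply:
  "Lop q (Neg N1) F (a1, a2, a3, b) = (if a1 = 0 then 0 else F (a1 - 1, a2, a3, b))"
  "Lop q (Neg N2) F (a1, a2, a3, b) =
     (if a3 = 0 then 0 else Qp q (int a2 - int a1) * F (a1, a2, a3 - 1, b))
     + (if a2 = 0 then 0 else qn q (int a1 + 1) * F (a1 + 1, a2 - 1, a3, b))"
  by (cases b, auto simp: Lop_def zrest_def zdefs zext_def nat_diff_distrib nat_add_distrib
      intro!: arg_cong[of _ _ F])+

definition L31 :: "series \<Rightarrow> series" where
  "L31 F = Lop q (Neg N2) (Lop q (Neg N1) F) - Lop q (Car (Qp q (- 1))) (Lop q (Neg N1) (Lop q (Neg N2) F))"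

lemma L31_apply: "L31 F (a1, a2, a3, b) = (if a2 = 0 then 0 else Qp q (int a1) * F (a1, a2 - 1, a3, b))"
proof -
  have "qn q (int a1 + 1) - Qp q (- 1) * qn q (int a1) = Qp q (int a1)"
    using qn_add'[of "int a1" 1] by (simp add: Qp_minus divide_inverse)
  moreover have "L31 F (a1, a2, a3, b) = (if a2 = 0 then 0 else
    (qn q (int a1 + 1) - Qp q (- 1) * qn q (int a1)) * F (a1, a2 - 1, a3, b))"
    by (auto simp: L31_def Neg_apply LC_apply tau_inverse Qp_add Qp_diff Qp_minus algebra_simps of_nat_diff divide_inverse)
  ultimately show ?thesis by simp
qed

text \<open>The part of \<open>zL12\<close> and \<open>zL23\<close> that survives on series without
  lowering factors, with the lowering exponents as mere parameters.\<close>

definition zP :: "node \<Rightarrow> zseries \<Rightarrow> zseries" where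
  "zP i Z a1 a2 a3 b1 b2 b3 = (case i of
     N1 \<Rightarrow> tau q (- 2) 1 (Z a1 a2 a3 (b1 - 1) b2 b3)
   | N2 \<Rightarrow> Qp q (b2 - b1) * tau q 1 (- 2) (Z a1 a2 a3 b1 b2 (b3 - 1))
     - Qp q (- 1) * qn q (b1 + 1) * tau q 1 (- 2) (Z a1 a2 a3 (b1 + 1) (b2 - 1) b3))"

lemma zP_serre_12: "zP N1 (zP N2 (zP N2 F)) a1 a2 a3 b1 b2 b3
  + zP N2 (zP N2 (zP N1 F)) a1 a2 a3 b1 b2 b3
  - (Qp q 1 + Qp q (- 1)) * zP N2 (zP N1 (zP N2 F)) a1 a2 a3 b1 b2 b3 = 0" (is "?L = 0")
proof -
  define x y Q where "x = Qp q b1" and "y = Qp q b2" and "Q = Qp q 1"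
  have [simp]: "x \<noteq> 0" "y \<noteq> 0" "Q \<noteq> 0" by (simp_all add: x_def y_def Q_def)
  \<comment> \<open>Every order of the three operators shifts by 2 (1, -2) + (-2, 1) = (0, -3), so
    the shifted entries get common names.\<close>
  define G where "G i j = tau q 0 (- 3) (F a1 a2 a3 (b1 + i) (b2 - j) (b3 - 2 + j))" for i j
  have "?L = (qn q (b1 + 1) * (qn q (b1 + 1 + 1) + qn q (b1 + 1 - 1) - (Qp q 1 + Qp q (- 1)) * qn q (b1 + 1)) * G 1 2 / (Q * Q))
    + (y / x * Q * (y / x * Q) - (Q + inverse Q) * (y / x) * (y / x * Q) + y / x * (y / x)) * G (- 1) 0
    - (y / x * Q * qn q b1 + qn q b1 * (y / (x * Q)) - (Q + inverse Q) * (y / x * qn q b1 + qn q (b1 + 1) * (y / (x * Q)))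
       + (y / x * qn q (b1 + 1) + qn q (b1 + 1) * (y / (x * Q * Q)))) * G 0 1 / Q"
    unfolding x_def y_def Q_def G_def
    by (simp add: zP_def tau_mult tau_diff tau_add tau_inverse Qp_diff Qp_minus Qp_add Qp_double algebra_simps divide_inverse)
  also have "y / x * Q * qn q b1 + qn q b1 * (y / (x * Q)) - (Q + inverse Q) * (y / x * qn q b1 + qn q (b1 + 1) * (y / (x * Q)))
       + (y / x * qn q (b1 + 1) + qn q (b1 + 1) * (y / (x * Q * Q))) = 0"
    by (simp add: field_simps)
  also have "y / x * Q * (y / x * Q) - (Q + inverse Q) * (y / x) * (y / x * Q) + y / x * (y / x) = 0"
    by (simp add: field_simps)
  finally show ?thesis unfolding qn_three_term by simp
qed

lemma zP_serre_21: "zP N2 (zP N1 (zP N1 F)) a1 a2 a3 b1 b2 b3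
  + zP N1 (zP N1 (zP N2 F)) a1 a2 a3 b1 b2 b3
  - (Qp q 1 + Qp q (- 1)) * zP N1 (zP N2 (zP N1 F)) a1 a2 a3 b1 b2 b3 = 0" (is "?L = 0")
proof -
  define x y Q where "x = Qp q b1" and "y = Qp q b2" and "Q = Qp q 1"
  have [simp]: "x \<noteq> 0" "y \<noteq> 0" "Q \<noteq> 0" by (simp_all add: x_def y_def Q_def)
  define G where "G i j = tau q (- 3) 0 (F a1 a2 a3 (b1 - i) (b2 - j) (b3 - 1 + j))" for i j
  have "?L = (y / x - (Q + inverse Q) * (y / x * Q) + y / x * Q * Q) * G 2 0
    - (qn q (b1 + 1) + qn q (b1 - 1) - (Qp q 1 + Qp q (- 1)) * qn q b1) * G 1 1 / Q"
    unfolding x_def y_def Q_def G_def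
    by (simp add: zP_def tau_mult tau_diff tau_add tau_inverse Qp_diff Qp_minus Qp_add Qp_double algebra_simps divide_inverse)
  also have "y / x - (Q + inverse Q) * (y / x * Q) + y / x * Q * Q = 0"
    by (simp add: field_simps)
  finally show ?thesis unfolding qn_three_term by simp
qed

lemma serre_op_no_lowering:
  assumes "i \<noteq> j" and F: "\<And>a1 a2 a3 b. (a1, a2, a3) \<noteq> (0, 0, 0) \<Longrightarrow> F (a1, a2, a3, b) = 0"
  shows "serre_op i j F = 0"
proof -
  define P where "P Z \<longleftrightarrow> (\<forall>a1 a2 a3 b1 b2 b3. (a1, a2, a3) \<noteq> (0, 0, 0) \<longrightarrow> Z a1 a2 a3 b1 b2 b3 = 0)" for Z :: zseries
  have P0: "P (zext F)" using F by (auto simp: P_def zext_def)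
  have PP: "zop q (Pos k) Z = zP k Z \<and> P (zP k Z)" if "P Z" for Z k
  proof -
    \<comment> \<open>Terms that alter the lowering exponents disappear: at n + 1 = 0 the bracket is
      zero, otherwise the entry is zero by \<open>P\<close>.\<close>
    have *: "qn q (n + 1) * c * Z a1 a2 a3 b1 b2 b3 = 0" if "n + 1 \<in> {a1, a2, a3}" for n c a1 a2 a3 b1 b2 b3
      using that \<open>P Z\<close> by (cases "n + 1 = 0") (auto simp: P_def)
    show ?thesis
      using that by (cases k) (auto simp: zdefs zP_def fun_eq_iff * P_def)
  qed
  have e: "zext (Lop q (Pos k) G) = zP k (zext G) \<and> P (zext (Lop q (Pos k) G))" if "P (zext G)" for G k
    using PP[OF that, of k] by (simp add: zext_Lop)
  note e0 = e[OF P0] and e1 = e[OF conjunct2[OF e[OF P0]]] and e2 = e[OF conjunct2[OF e[OF conjunct2[OF e[OF P0]]]]]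
  have e3: "zext (Lop q (Pos k) (Lop q (Pos l) (Lop q (Pos n) F))) = zP k (zP l (zP n (zext F)))" for k l n
    using e0[of n] e1[of l n] e2[of k l n] by metis
  have "zext (Lop q (Pos i) (Lop q (Pos j) (Lop q (Pos j) F)) + Lop q (Pos j) (Lop q (Pos j) (Lop q (Pos i) F)))
    = zext (Lop q (Car (Qp q 1 + Qp q (- 1))) (Lop q (Pos j) (Lop q (Pos i) (Lop q (Pos j) F))))"
  proof -
    have Car: "zext (Lop q (Car (Qp q 1 + Qp q (- 1))) G) a1 a2 a3 b1 b2 b3 =
      (Qp q 1 + Qp q (- 1)) * zext G a1 a2 a3 b1 b2 b3" for G a1 a2 a3 b1 b2 b3
      by (simp add: zext_Lop zLC_def)
    have "i = N1 \<and> j = N2 \<or> i = N2 \<and> j = N1" using assms by (metis node.exhaust)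
    then show ?thesis
      unfolding fun_eq_iff zext_plus Car e3
      using zP_serre_12[of "zext F"] zP_serre_21[of "zext F"] by auto
  qed
  from zext_eqI[OF this] show ?thesis by (simp add: serre_op_def algebra_simps)
qed

text \<open>
  \<^const>\<open>serre_op\<close> commutes with the lowering operators and kills series without lowering factors.
  Splitting off leading factors thus shows that its values vanish in every lowering degree.
\<close>

lemma serre_op_eq_0:
  assumes ij: "i \<noteq> j"
  shows "serre_op i j F = 0"
proof -
  define V where "V h X \<longleftrightarrow> (\<forall>a1 a2 a3 b. a1 + 2 * a2 + a3 < h \<longrightarrow> X (a1, a2, a3, b) = 0)" for h and X :: series
  have V1: "V (Suc h) (Lop q (Neg N1) X)" "V (Suc h) (Lop q (Neg N2) X)" if "V h X" for h X
    using that by (auto simp: V_def Neg_apply)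
  have V2: "V h (X + Y)" "V h (X - Y)" if "V h X" "V h Y" for h X Y
    using that by (auto simp: V_def)
  have V3: "V h (Lop q (Car f) X)" if "V h X" for h X f
    using that by (auto simp: V_def LC_apply)
  have V4: "V h X" if "V (Suc h) X" for h X
    using that by (auto simp: V_def)
  have "\<forall>F. V h (serre_op i j F)" for h
  proof (induction h)
    case 0
    show ?case by (simp add: V_def)
  next
    case (Suc h)
    show ?case
    proof
      fix F
      \<comment> \<open>Leading factors are stripped in the order of the ordered monomials:
        \<open>e21\<close> in \<open>G1\<close>, then \<open>e31\<close> in \<open>G2\<close>, then
        \<open>e32\<close> in \<open>G3\<close>. What is left in \<open>F0\<close> has no lowering
        factor.\<close>
      define G1 :: series where "G1 = (\<lambda>(a1, a2, a3, b). F (a1 + 1, a2, a3, b))"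
      define G2 :: series where "G2 = (\<lambda>(a1, a2, a3, b). if a1 = 0 then F (0, a2 + 1, a3, b) else 0)"
      define G3 :: series where "G3 = (\<lambda>(a1, a2, a3, b). if a1 = 0 \<and> a2 = 0 then F (0, 0, a3 + 1, b) else 0)"
      define F0 where "F0 = F - Lop q (Neg N1) G1 - L31 G2 - Lop q (Neg N2) G3"
      have F: "F = F0 + (Lop q (Neg N1) G1 + L31 G2 + Lop q (Neg N2) G3)" by (simp add: F0_def)
      have "serre_op i j F0 = 0"
        by (rule serre_op_no_lowering[OF ij])
          (auto simp: F0_def G1_def G2_def G3_def Neg_apply L31_apply)
      have comm: "serre_op i j (L31 G2) = L31 (serre_op i j G2)"
      proof -
        have "L31 X = Lop q (Neg N2) (Lop q (Neg N1) X) + Lop q (Neg N1) (Lop q (Neg N2) (Lop q (Car (- Qp q (- 1))) X))" for X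
        proof -
          have "- Qp q (- 1) = 0 - Qp q (- 1)" by simp
          then show ?thesis
            by (simp only: L31_def LC_diff LC_0 Lop_diff Lop_0 LC_L21 LC_L32 tau_Qp) simp
        qed
        moreover have "serre_op i j (Lop q (Car (- Qp q (- 1))) X) = Lop q (Car (- Qp q (- 1))) (serre_op i j X)" for X
        proof -
          have "Lop q (Pos k) (Lop q (Car (- Qp q (- 1))) X) = Lop q (Car (- Qp q (- 1))) (Lop q (Pos k) X)" for k X
            by (cases k) (simp_all add: L12_LC L23_LC tau_minus)
          moreover have "Lop q (Car f) (Lop q (Car g) X) = Lop q (Car g) (Lop q (Car f) X)" for f g X
            by (simp flip: LC_mult add: mult.commute)
          ultimately show ?thesis unfolding serre_op_def by (simp add: Lop_plus Lop_diff)
        qed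
        ultimately show ?thesis by (simp add: serre_op_plus serre_op_lowering[OF ij])
      qed
      have "serre_op i j F = Lop q (Neg N1) (serre_op i j G1) + L31 (serre_op i j G2) + Lop q (Neg N2) (serre_op i j G3)"
        by (subst F) (simp only: serre_op_plus serre_op_lowering[OF ij] comm \<open>serre_op i j F0 = 0\<close> add_0_left)
      moreover have "V (Suc h) (L31 (serre_op i j G2))"
        unfolding L31_def using Suc.IH by (intro V2 V3 V1 V4[OF V1(1)] V4[OF V1(2)]) auto
      ultimately show "V (Suc h) (serre_op i j F)"
        using Suc.IH by (auto intro!: V2 V1)
    qed
  qed
  then have "serre_op i j F (a1, a2, a3, b) = 0" for a1 a2 a3 b
    unfolding V_def by (meson lessI)
  then show ?thesis by (auto simp: fun_eq_iff)
qed

end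


section \<open>The representation of the free algebra and its kernel\<close>

fun opw :: "real \<Rightarrow> gen fword \<Rightarrow> series \<Rightarrow> series" where
  "opw q (FWord gs) F = foldr (Lop q) gs F"

definition rho :: "real \<Rightarrow> falg \<Rightarrow> series \<Rightarrow> series" where
  "rho q u F m = (\<Sum>w\<in>Poly_Mapping.keys u. kconst (Poly_Mapping.lookup u w) * opw q w F m)"

context qparam begin

text \<open>A scalar is a constant Cartan element, which no shift changes; it therefore commutes
  with every generator.\<close>

lemma Lop_scale: "Lop q g (\<lambda>m. kconst c * F m) m = kconst c * Lop q g F m"
proof -
  have "(\<lambda>m. kconst c * F m) = Lop q (Car (kconst c)) F" by (simp add: fun_eq_iff LC_kconst)
  moreover have "Lop q g (Lop q (Car (kconst c)) F) = Lop q (Car (kconst c)) (Lop q g F)"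
    by (cases g rule: gen_cases) (simp_all add: L12_LC L23_LC LC_L21 LC_L32 flip: LC_mult, simp add: mult.commute)
  ultimately show ?thesis by (simp add: LC_kconst)
qed

lemma opw_plus: "opw q w (F + G) = opw q w F + opw q w G"
proof (cases w)
  case (FWord gs)
  show ?thesis unfolding FWord by (induct gs) (simp_all add: Lop_plus del: plus_fun_apply)
qed

lemma opw_scale: "opw q w (\<lambda>m. kconst c * F m) m = kconst c * opw q w F m"
proof (cases w)
  case (FWord gs)
  have "foldr (Lop q) gs (\<lambda>m. kconst c * F m) = (\<lambda>m. kconst c * foldr (Lop q) gs F m)"
  proof (induct gs)
    case (Cons g gs)
    then show ?case using Lop_scale[of g c "foldr (Lop q) gs F"] by (simp del: split_paired_All)
  qed simp
  then show ?thesis unfolding FWord by simp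
qed

lemma opw_0 [simp]: "opw q w 0 = 0"
  using opw_plus[of w 0 0] by simp

lemma opw_add_word: "opw q (v + w) F = opw q v (opw q w F)"
  by (cases v; cases w) simp

lemma rho_superset:
  assumes "finite A" "Poly_Mapping.keys u \<subseteq> A"
  shows "rho q u F m = (\<Sum>w\<in>A. kconst (Poly_Mapping.lookup u w) * opw q w F m)"
  unfolding rho_def by (rule sum.mono_neutral_left) (use assms in \<open>auto simp: in_keys_iff\<close>)

lemma rho_add: "rho q (u + v) F = rho q u F + rho q v F"
proof
  fix m
  let ?A = "Poly_Mapping.keys u \<union> Poly_Mapping.keys v"
  have "rho q (u + v) F m = (\<Sum>w\<in>?A. kconst (Poly_Mapping.lookup (u + v) w) * opw q w F m)"
    by (rule rho_superset) (auto simp: in_keys_iff lookup_add)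
  then show "rho q (u + v) F m = (rho q u F + rho q v F) m"
    by (simp add: rho_superset[of ?A u] rho_superset[of ?A v] lookup_add kconst_add
        distrib_right sum.distrib)
qed

lemma rho_0 [simp]: "rho q 0 F = 0"
  by (auto simp: rho_def fun_eq_iff)

lemma rho_single: "rho q (Poly_Mapping.single w c) F m = kconst c * opw q w F m"
  by (simp add: rho_def)

lemma rho_plus: "rho q u (F + G) = rho q u F + rho q u G"
  by (auto simp: rho_def fun_eq_iff opw_plus distrib_left sum.distrib)

lemma rho_zero [simp]: "rho q u 0 = 0"
  by (auto simp: rho_def fun_eq_iff)

lemma falg_induct [case_names zero single]:
  assumes "P 0" "\<And>u w c. P u \<Longrightarrow> P (u + Poly_Mapping.single w (c :: complex))"
  shows "P (u :: falg)"
proof (induct u rule: update_induct)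
  case const
  then show ?case using assms(1) by simp
next
  case (update f a b)
  have "Poly_Mapping.update a b f = f + Poly_Mapping.single a b"
    using update(1) by (intro poly_mapping_eqI) (auto simp: lookup_update lookup_add lookup_single in_keys_iff when_def)
  then show ?case using assms(2) update by simp
qed

lemma rho_mult: "rho q (u * v) F = rho q u (rho q v F)"
proof (induct u rule: falg_induct)
  case (single u w c)
  have "rho q (Poly_Mapping.single w c * v) F = rho q (Poly_Mapping.single w c) (rho q v F)"
  proof (induct v rule: falg_induct)
    case (single v w' c')
    have "rho q (Poly_Mapping.single w c * Poly_Mapping.single w' c') F
       = rho q (Poly_Mapping.single w c) (rho q (Poly_Mapping.single w' c') F)"
    proof
      fix m
      have "rho q (Poly_Mapping.single w' c') F = (\<lambda>m. kconst c' * opw q w' F m)"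
        by (simp add: fun_eq_iff rho_single)
      then show "rho q (Poly_Mapping.single w c * Poly_Mapping.single w' c') F m
         = rho q (Poly_Mapping.single w c) (rho q (Poly_Mapping.single w' c') F) m"
        by (simp add: mult_single rho_single opw_add_word opw_scale kconst_mult)
    qed
    then show ?case using single by (simp add: distrib_left rho_add rho_plus del: plus_fun_apply)
  next
    case zero
    show ?case by (simp del: zero_fun_apply)
  qed
  then show ?case using single by (simp add: distrib_right rho_add)
qed simp

lemma rho_gn [simp]: "rho q (gn g) F = Lop q g F"
  by (auto simp: gn_def rho_single fun_eq_iff)

lemma rho_scl: "rho q (scl c) F = Lop q (Car (kconst c)) F"
  by (auto simp: scl_def zero_fword_def rho_single fun_eq_iff LC_kconst)

lemma rho_1 [simp]: "rho q 1 F = F"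
  using rho_scl[of 1 F] by (simp add: scl_def flip: single_one)

lemma rho_minus: "rho q (- u) F = - rho q u F"
  using rho_add[of u "- u" F] by (simp add: eq_neg_iff_add_eq_0 add.commute)

lemma rho_diff: "rho q (u - v) F = rho q u F - rho q v F"
  using rho_add[of u "- v" F] by (simp add: rho_minus)

lemma kconst_q: "kconst (of_real q) = Qp q 1" "kconst (of_real (inverse q)) = Qp q (- 1)"
    "kconst (inverse (of_real q)) = Qp q (- 1)"
  by (simp_all add: Qp_def power_int_minus)

lemma scl_comm: "scl c * u = u * scl c"
proof (induct u rule: falg_induct)
  case (single u w d)
  then show ?case by (simp add: distrib_left distrib_right scl_def mult_single mult.commute)
qed simp

text \<open>The exponents -1 and 1 are the inner products of alpha_i and of alpha_i + alpha_j with
  alpha_j. With them the nested q-commutator is the Serre polynomial with middle coefficient q +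
  q^(-1), the shape of \<open>serre_op\<close>.\<close>

lemma qcomm_qcomm:
  "qcomm q 1 (qcomm q (- 1) x y) y = x * y * y - scl (of_real q) * y * x * y
    - scl (of_real (inverse q)) * y * x * y + y * y * x"
proof -
  have "scl (of_real q) * y * (scl (of_real (inverse q)) * y * x) = scl (of_real q) * scl (of_real (inverse q)) * y * y * x"
    using scl_comm[of "of_real (inverse q)" y] by (simp add: mult.assoc)
  moreover have scl_inv: "scl (of_real q) * scl (of_real (inverse q)) = 1"
    by (simp add: scl_def mult_single)
  moreover from scl_inv have "scl (of_real q) * (scl (of_real (inverse q)) * u) = u" for u
    by (simp flip: mult.assoc)
  ultimately show ?thesis
    by (simp add: qcomm_def power_int_minus algebra_simps)
qed

lemma rho_relators: "r \<in> relators q \<Longrightarrow> rho q r F = 0"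
proof (induct rule: relators.induct)
  case (car_const c)
  then show ?case by (simp add: rho_diff rho_scl)
next
  case (car_add f g)
  then show ?case by (simp add: rho_diff rho_add LC_add)
next
  case (car_mult f g)
  then show ?case by (simp add: rho_diff rho_mult LC_mult)
next
  case (car_pos i j)
  have "Lop q (Pos j) (Lop q (Car f) F) = Lop q (Car (tau q (ip N1 j * - 1) (ip N2 j * - 1) f)) (Lop q (Pos j) F)" for f
    by (cases j) (simp_all add: L12_LC L23_LC ip_def)
  moreover have "zvar i * tau q (ip N1 j * - 1) (ip N2 j * - 1) (inverse (zvar i)) = kconst (of_real (q powr (of_int (ip i j) / 2)))"
    by (cases i) (simp_all add: tau_inverse tau_zvar1 tau_zvar2 powr_minus kconst_inverse flip: kconst_inverse of_real_inverse)
  ultimately show ?case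
    by (simp add: rho_diff rho_mult rho_scl flip: LC_mult del: minus_apply)
next
  case (car_neg i j)
  have "Lop q (Car f) (Lop q (Neg j) F) = Lop q (Neg j) (Lop q (Car (tau q (ip N1 j * - 1) (ip N2 j * - 1) f)) F)" for f F
    by (cases j) (simp_all add: LC_L21 LC_L32 ip_def)
  moreover have "tau q (ip N1 j * - 1) (ip N2 j * - 1) (zvar i) * inverse (zvar i) = kconst (of_real (q powr (- of_int (ip i j) / 2)))"
    by (cases i) (simp_all add: tau_zvar1 tau_zvar2)
  moreover have "Lop q (Neg j) (Lop q (Car (kconst c)) F) = Lop q (Car (kconst c)) (Lop q (Neg j) F)" for c
    by (cases j) (simp_all add: LC_L21 LC_L32)
  ultimately show ?case
    by (simp add: rho_diff rho_mult rho_scl flip: LC_mult del: minus_apply)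
next
  case (pos_neg i j)
  then show ?case
    by (cases i; cases j) (simp_all add: rho_diff rho_mult L12_L21 L12_L32 L23_L21 L23_L32 hnum_def)
next
  case (serre_pos i j)
  then have "ip i j = - 1" "ip j j = 2" by (simp_all add: ip_def)
  then show ?case using serre_op_eq_0[OF serre_pos, of F]
    by (simp add: qcomm_qcomm rho_diff rho_add rho_mult rho_scl kconst_q serre_op_def LC_add algebra_simps)
next
  case (serre_neg i j)
  then have "ip i j = - 1" "ip j j = 2" by (simp_all add: ip_def)
  then show ?case using serre_neg_211[of F] serre_neg_322[of F] serre_neg
    by (cases i; cases j) (simp_all add: qcomm_qcomm rho_diff rho_add rho_mult rho_scl kconst_q LC_add algebra_simps)
qed

text \<open>The action factors through the quotient algebra, so it may be evaluated on any
  representative.\<close>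

lemma rho_rel_ideal: "u \<in> rel_ideal q \<Longrightarrow> rho q u F = 0"
  by (induct rule: rel_ideal.induct) (simp_all add: rho_mult rho_relators rho_add)

end


section \<open>Ordered monomials span\<close>

text \<open>The relations prescribe commutation with raising and lowering generators only for the
  two variables; this induction carries it to all rational functions.\<close>

lemma cartan_induct [case_names const var add mult inverse]:
  assumes "\<And>c. P (kconst c)" "\<And>i. P (zvar i)" "\<And>f g. P f \<Longrightarrow> P g \<Longrightarrow> P (f + g)"
    "\<And>f g. P f \<Longrightarrow> P g \<Longrightarrow> P (f * g)" "\<And>f. P f \<Longrightarrow> P (inverse f)"
  shows "P (f :: cartan)"
proof -
  have 0: "P 0" using assms(1)[of 0] by simp
  have 1: "P (Fract [:c:] 1)" for c
  proof (induct c)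
    case 0
    then show ?case using \<open>P 0\<close> by (simp add: Zero_fract_def)
  next
    case (pCons d c)
    have "Fract [:pCons d c:] 1 = kconst d + zvar N2 * Fract [:c:] 1"
      by (simp add: kconst_def zvar.simps)
    then show ?case using pCons(2) assms(1,2) by (auto intro!: assms(3,4))
  qed
  have 2: "P (Fract p 1)" for p
  proof (induct p)
    case 0
    then show ?case using \<open>P 0\<close> by (simp add: Zero_fract_def)
  next
    case (pCons c p)
    have "Fract (pCons c p) 1 = Fract [:c:] 1 + zvar N1 * Fract p 1"
      by (simp add: zvar.simps)
    then show ?case using pCons(2) 1 assms(2) by (auto intro!: assms(3,4))
  qed
  show ?thesis
  proof (cases f)
    case (Fract a b)
    then have "f = Fract a 1 * inverse (Fract b 1)" by simp
    show ?thesis unfolding \<open>f = Fract a 1 * inverse (Fract b 1)\<close> by (rule assms(4)[OF 2 assms(5)[OF 2]])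
  qed
qed

text \<open>Closure under congruence makes this the preimage of the span in the quotient
  algebra.\<close>

inductive_set pbw_span :: "real \<Rightarrow> falg set" for q where
  zero: "0 \<in> pbw_span q"
| monom: "monom_pbw q m f \<in> pbw_span q"
| add: "u \<in> pbw_span q \<Longrightarrow> v \<in> pbw_span q \<Longrightarrow> u + v \<in> pbw_span q"
| cong: "u \<in> pbw_span q \<Longrightarrow> v - u \<in> rel_ideal q \<Longrightarrow> v \<in> pbw_span q"

abbreviation kk :: "cartan \<Rightarrow> falg" where "kk f \<equiv> gn (Car f)"

section \<open>Congruence modulo the relations and commutation rules for root vectors\<close>

context qparam begin

lemma rel_ideal_mult_left: "u \<in> rel_ideal q \<Longrightarrow> x * u \<in> rel_ideal q"
proof (induct rule: rel_ideal.induct)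
  case (rel r y z)
  then show ?case using rel_ideal.rel[of r q "x * y" z] by (simp add: mult.assoc)
qed (simp_all add: rel_ideal.zero rel_ideal.add distrib_left)

lemma rel_ideal_mult_right: "u \<in> rel_ideal q \<Longrightarrow> u * x \<in> rel_ideal q"
proof (induct rule: rel_ideal.induct)
  case (rel r y z)
  then show ?case using rel_ideal.rel[of r q y "z * x"] by (simp add: mult.assoc)
qed (simp_all add: rel_ideal.zero rel_ideal.add distrib_right)

lemma rel_ideal_minus: "u \<in> rel_ideal q \<Longrightarrow> - u \<in> rel_ideal q"
  using rel_ideal_mult_left[of u "- 1"] by simp

definition cg :: "falg \<Rightarrow> falg \<Rightarrow> bool" (infix "\<approx>" 50) where
  "u \<approx> v \<longleftrightarrow> u - v \<in> rel_ideal q"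

lemma cg_refl [simp]: "u \<approx> u" by (simp add: cg_def rel_ideal.zero)

lemma cg_sym: "u \<approx> v \<Longrightarrow> v \<approx> u"
  unfolding cg_def using rel_ideal_minus[of "u - v"] by simp

lemma cg_trans [trans]: "u \<approx> v \<Longrightarrow> v \<approx> w \<Longrightarrow> u \<approx> w"
  unfolding cg_def using rel_ideal.add[of "u - v" q "v - w"] by simp

lemma cg_add: "u \<approx> v \<Longrightarrow> u' \<approx> v' \<Longrightarrow> u + u' \<approx> v + v'"
  unfolding cg_def using rel_ideal.add[of "u - v" q "u' - v'"] by (simp add: algebra_simps)

lemma cg_minus: "u \<approx> v \<Longrightarrow> - u \<approx> - v"
  unfolding cg_def using rel_ideal_minus[of "u - v"] by simp

lemma cg_diff: "u \<approx> v \<Longrightarrow> u' \<approx> v' \<Longrightarrow> u - u' \<approx> v - v'"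
  using cg_add[of u v "- u'" "- v'"] cg_minus[of u' v'] by simp

lemma cg_left: "u \<approx> v \<Longrightarrow> x * u \<approx> x * v"
  unfolding cg_def using rel_ideal_mult_left[of "u - v" x] by (simp add: algebra_simps)

lemma cg_right: "u \<approx> v \<Longrightarrow> u * x \<approx> v * x"
  unfolding cg_def using rel_ideal_mult_right[of "u - v" x] by (simp add: algebra_simps)

lemma relator_cg: "u - v \<in> relators q \<Longrightarrow> u \<approx> v"
  unfolding cg_def using rel_ideal.rel[of "u - v" q 1 1] by simp

lemma kk_const: "kk (kconst c) \<approx> scl c"
  by (rule relator_cg, rule relators.car_const)

lemma kk_add: "kk (f + g) \<approx> kk f + kk g"
  by (rule relator_cg, rule relators.car_add)

lemma kk_mult: "kk (f * g) \<approx> kk f * kk g"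
  by (rule relator_cg, rule relators.car_mult)

lemma scl_mult: "scl c * scl d = scl (c * d)"
  by (simp add: scl_def mult_single)

lemma scl_1 [simp]: "scl 1 = 1"
  by (simp add: scl_def flip: single_one)

lemma kk_1: "kk 1 \<approx> 1"
  using kk_const[of 1] by simp

lemma kk_0: "kk 0 \<approx> 0"
  using kk_const[of 0] by (simp add: scl_def)

lemma car_comm:
  assumes z: "\<And>i. kk (zvar i) * x * kk (inverse (zvar i)) \<approx> scl (of_real (c i)) * x"
    and t: "\<And>i. tau q a b (zvar i) = kconst (of_real (c i)) * zvar i"
  shows "kk f * x \<approx> x * kk (tau q a b f)"
proof (induct f rule: cartan_induct)
  case (const d)
  have "kk (kconst d) * x \<approx> scl d * x" by (intro cg_right kk_const)
  also have "scl d * x = x * scl d" by (rule scl_comm)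
  also have "x * scl d \<approx> x * kk (kconst d)" by (intro cg_left cg_sym[OF kk_const])
  finally show ?case by simp
next
  case (var i)
  have "kk (zvar i) * x = kk (zvar i) * x * 1" by simp
  also have "\<dots> \<approx> kk (zvar i) * x * kk (inverse (zvar i) * zvar i)"
    using cg_sym[OF kk_1] by (intro cg_left) simp
  also have "\<dots> \<approx> kk (zvar i) * x * (kk (inverse (zvar i)) * kk (zvar i))"
    by (intro cg_left kk_mult)
  also have "\<dots> = kk (zvar i) * x * kk (inverse (zvar i)) * kk (zvar i)" by (simp add: mult.assoc)
  also have "\<dots> \<approx> scl (of_real (c i)) * x * kk (zvar i)" by (intro cg_right z)
  also have "\<dots> = x * (scl (of_real (c i)) * kk (zvar i))" by (simp add: scl_comm mult.assoc)
  also have "\<dots> \<approx> x * (kk (kconst (of_real (c i))) * kk (zvar i))"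
    by (intro cg_left cg_right cg_sym[OF kk_const])
  also have "\<dots> \<approx> x * kk (tau q a b (zvar i))"
    unfolding t by (intro cg_left cg_sym[OF kk_mult])
  finally show ?case .
next
  case (add f g)
  have "kk (f + g) * x \<approx> kk f * x + kk g * x" using cg_right[OF kk_add] by (simp add: distrib_right)
  also have "\<dots> \<approx> x * kk (tau q a b f) + x * kk (tau q a b g)" by (intro cg_add add)
  also have "\<dots> \<approx> x * kk (tau q a b (f + g))"
    unfolding tau_add distrib_left[symmetric] by (intro cg_left cg_sym[OF kk_add])
  finally show ?case .
next
  case (mult f g)
  have "kk (f * g) * x \<approx> kk f * (kk g * x)" using cg_right[OF kk_mult] by (simp add: mult.assoc)
  also have "\<dots> \<approx> kk f * (x * kk (tau q a b g))" by (intro cg_left mult)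
  also have "\<dots> = kk f * x * kk (tau q a b g)" by (simp add: mult.assoc)
  also have "\<dots> \<approx> x * kk (tau q a b f) * kk (tau q a b g)" by (intro cg_right mult)
  also have "\<dots> \<approx> x * kk (tau q a b (f * g))"
    unfolding tau_mult mult.assoc by (intro cg_left cg_sym[OF kk_mult])
  finally show ?case .
next
  case (inverse f)
  show ?case
  proof (cases "f = 0")
    case True
    have "kk 0 * x \<approx> 0" using cg_right[OF kk_0, of x] by simp
    also have "0 \<approx> x * kk 0" using cg_sym[OF cg_left[OF kk_0, of x]] by simp
    finally have "kk 0 * x \<approx> x * kk 0" .
    then show ?thesis using True by simp
  next
    case False
    let ?g = "tau q a b f"
    \<comment> \<open>With ?g the shifted f, inserting ?g times its inverse lets the induction
      hypothesis for f be applied from right to left.\<close>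
    have "kk (inverse f) * x = kk (inverse f) * x * 1" by simp
    also have "\<dots> \<approx> kk (inverse f) * x * kk (?g * inverse ?g)"
      using False cg_sym[OF kk_1] by (intro cg_left) simp
    also have "\<dots> \<approx> kk (inverse f) * x * (kk ?g * kk (inverse ?g))" by (intro cg_left kk_mult)
    also have "\<dots> = kk (inverse f) * (x * kk ?g) * kk (inverse ?g)" by (simp add: mult.assoc)
    also have "\<dots> \<approx> kk (inverse f) * (kk f * x) * kk (inverse ?g)"
      by (intro cg_left cg_right cg_sym[OF inverse])
    also have "\<dots> = kk (inverse f) * kk f * (x * kk (inverse ?g))" by (simp add: mult.assoc)
    also have "\<dots> \<approx> kk (inverse f * f) * (x * kk (inverse ?g))" by (intro cg_right cg_sym[OF kk_mult])
    also have "\<dots> \<approx> 1 * (x * kk (inverse ?g))" using False kk_1 by (intro cg_right) simp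
    finally show ?thesis by (simp add: tau_inverse)
  qed
qed

lemma kk_e21: "kk f * e21 \<approx> e21 * kk (tau q (- 2) 1 f)"
  by (rule car_comm[where c = "\<lambda>i. q powr (- of_int (ip i N1) / 2)"], rule relator_cg, rule relators.car_neg)
    (case_tac i; simp add: tau_zvar1 tau_zvar2 ip_def)

lemma kk_e32: "kk f * e32 \<approx> e32 * kk (tau q 1 (- 2) f)"
  by (rule car_comm[where c = "\<lambda>i. q powr (- of_int (ip i N2) / 2)"], rule relator_cg, rule relators.car_neg)
    (case_tac i; simp add: tau_zvar1 tau_zvar2 ip_def)

lemma kk_e12: "kk f * e12 \<approx> e12 * kk (tau q 2 (- 1) f)"
  by (rule car_comm[where c = "\<lambda>i. q powr (of_int (ip i N1) / 2)"], rule relator_cg, rule relators.car_pos)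
    (case_tac i; simp add: tau_zvar1 tau_zvar2 ip_def)

lemma kk_e23: "kk f * e23 \<approx> e23 * kk (tau q (- 1) 2 f)"
  by (rule car_comm[where c = "\<lambda>i. q powr (of_int (ip i N2) / 2)"], rule relator_cg, rule relators.car_pos)
    (case_tac i; simp add: tau_zvar1 tau_zvar2 ip_def)

lemma e12_kk: "e12 * kk f \<approx> kk (tau q (- 2) 1 f) * e12"
  using cg_sym[OF kk_e12[of "tau q (- 2) 1 f"]] by simp

lemma e23_kk: "e23 * kk f \<approx> kk (tau q 1 (- 2) f) * e23"
  using cg_sym[OF kk_e23[of "tau q 1 (- 2) f"]] by simp

lemma e12_e21: "e12 * e21 \<approx> e21 * e12 + kk (qnumH q 1 0 0)"
  using relator_cg[of "e12 * e21 - e21 * e12" "kk (qnumH q 1 0 0)"] relators.pos_neg[of N1 N1 q]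
  by (simp add: hnum_def cg_def algebra_simps)

lemma e23_e32: "e23 * e32 \<approx> e32 * e23 + kk (qnumH q 0 1 0)"
  using relator_cg[of "e23 * e32 - e32 * e23" "kk (qnumH q 0 1 0)"] relators.pos_neg[of N2 N2 q]
  by (simp add: hnum_def cg_def algebra_simps)

lemma e12_e32: "e12 * e32 \<approx> e32 * e12"
  using relators.pos_neg[of N1 N2 q] by (intro relator_cg) simp

lemma e23_e21: "e23 * e21 \<approx> e21 * e23"
  using relators.pos_neg[of N2 N1 q] by (intro relator_cg) simp

text \<open>\<open>e31\<close> is itself the inner q-commutator of \<open>e32\<close> and
  \<open>e21\<close>, so this is a Serre relator as it stands.\<close>

lemma e31_e21: "e31 q * e21 \<approx> scl (of_real q) * (e21 * e31 q)"
  using relators.serre_neg[of N2 N1 q]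
  by (intro relator_cg) (simp add: ip_def qcomm_def e31_def power_int_minus mult.assoc)

lemma scl_inv: "scl (of_real q) * (scl (of_real (inverse q)) * u) = u"
    "scl (of_real (inverse q)) * (scl (of_real q) * u) = u"
    "scl (of_real q) * (scl (inverse (of_real q)) * u) = u"
    "scl (inverse (of_real q)) * (scl (of_real q) * u) = u"
  by (simp_all add: scl_mult flip: mult.assoc of_real_mult)

lemma scl_left: "x * (scl c * u) = scl c * (x * u)"
  by (metis scl_comm mult.assoc)

lemma serre_cg:
  assumes "i \<noteq> j" "(x, y) = (gn (Neg i), gn (Neg j)) \<or> (x, y) = (gn (Pos i), gn (Pos j))"
  shows "x * y * y - scl (of_real q) * y * x * y
    - scl (of_real (inverse q)) * y * x * y + y * y * x \<approx> 0"
proof -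
  have "ip i j = - 1" "ip j j = 2" using assms(1) by (simp_all add: ip_def)
  then have "qcomm q 1 (qcomm q (- 1) x y) y \<in> relators q"
    using relators.serre_neg[OF assms(1), of q] relators.serre_pos[OF assms(1), of q] assms(2) by auto
  then show ?thesis
    unfolding qcomm_qcomm by (intro relator_cg) simp
qed

text \<open>Here the roles of the nodes are exchanged: expanding \<open>e31\<close> turns e32 e31 -
  q e31 e32 into e21 e32^2 - (q + q^(-1)) e32 e21 e32 + e32^2 e21.\<close>

lemma e32_e31: "e32 * e31 q \<approx> scl (of_real q) * (e31 q * e32)"
proof -
  have "e21 * e32 * e32 - scl (of_real q) * e32 * e21 * e32
    - scl (of_real (inverse q)) * e32 * e21 * e32 + e32 * e32 * e21 \<approx> 0"
    by (rule serre_cg[of N1 N2]) simp_all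
  moreover have "e21 * e32 * e32 - scl (of_real q) * e32 * e21 * e32
    - scl (of_real (inverse q)) * e32 * e21 * e32 + e32 * e32 * e21
    = e32 * e31 q - scl (of_real q) * (e31 q * e32)"
    by (simp add: scl_inv scl_left[of e12] scl_left[of e21] scl_left[of e32] scl_left[of e23] e31_def mult.assoc right_diff_distrib left_diff_distrib)
  ultimately show ?thesis by (simp add: cg_def)
qed

lemma e13_e12: "e13 q * e12 \<approx> scl (of_real q) * (e12 * e13 q)" (is "?u \<approx> ?v")
proof -
  \<comment> \<open>The factor q adapts the Serre expression to the normalisation of
    \<open>e13\<close>: the multiple equals -(e13 e12 - q e12 e13).\<close>
  have "scl (of_real q) * (e23 * e12 * e12 - scl (of_real q) * e12 * e23 * e12
    - scl (of_real (inverse q)) * e12 * e23 * e12 + e12 * e12 * e23) \<approx> scl (of_real q) * 0"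
    by (intro cg_left serre_cg[of N2 N1]) simp_all
  moreover have "scl (of_real q) * (e23 * e12 * e12 - scl (of_real q) * e12 * e23 * e12
    - scl (of_real (inverse q)) * e12 * e23 * e12 + e12 * e12 * e23)
    = - (e13 q * e12 - scl (of_real q) * (e12 * e13 q))"
    by (simp add: scl_inv scl_left[of e12] scl_left[of e21] scl_left[of e32] scl_left[of e23] e13_def mult.assoc right_diff_distrib left_diff_distrib distrib_left)
  ultimately have "- (?u - ?v) \<in> rel_ideal q" by (simp add: cg_def)
  from rel_ideal_minus[OF this] show ?thesis by (simp add: cg_def)
qed

lemma e23_e13: "e23 * e13 q \<approx> scl (of_real q) * (e13 q * e23)" (is "?u \<approx> ?v")
proof -
  have "scl (of_real q) * (e12 * e23 * e23 - scl (of_real q) * e23 * e12 * e23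
    - scl (of_real (inverse q)) * e23 * e12 * e23 + e23 * e23 * e12) \<approx> scl (of_real q) * 0"
    by (intro cg_left serre_cg[of N1 N2]) simp_all
  moreover have "scl (of_real q) * (e12 * e23 * e23 - scl (of_real q) * e23 * e12 * e23
    - scl (of_real (inverse q)) * e23 * e12 * e23 + e23 * e23 * e12)
    = - (e23 * e13 q - scl (of_real q) * (e13 q * e23))"
    by (simp add: scl_inv scl_left[of e12] scl_left[of e21] scl_left[of e32] scl_left[of e23] e13_def mult.assoc right_diff_distrib left_diff_distrib distrib_left)
  ultimately have "- (?u - ?v) \<in> rel_ideal q" by (simp add: cg_def)
  from rel_ideal_minus[OF this] show ?thesis by (simp add: cg_def)
qed

lemma e32_e21: "e32 * e21 = e31 q + scl (of_real (inverse q)) * (e21 * e32)"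
  by (simp add: e31_def mult.assoc)

lemma e23_e12: "e23 * e12 = scl (of_real (inverse q)) * (e12 * e23) + scl (- of_real (inverse q)) * e13 q"
proof -
  have "scl (- of_real (inverse q)) = - scl (of_real (inverse q))"
    by (simp add: scl_def single_uminus)
  then show ?thesis
    by (simp add: scl_inv e13_def right_diff_distrib mult.assoc)
qed

lemma scl_kk: "scl c * kk f \<approx> kk (kconst c * f)"
  using cg_trans[OF cg_right[OF cg_sym[OF kk_const]] cg_sym[OF kk_mult]] .

lemma kk_diff: "kk f - kk g \<approx> kk (f - g)"
  using cg_diff[OF kk_add[of "f - g" g] cg_refl[of "kk g"]] by simp

text \<open>Spanning asks only for some Cartan coefficient in front of \<open>e32\<close>; its value
  -q^(-h1) enters through \<open>zL12\<close>.\<close>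

lemma e12_e31: "\<exists>g. e12 * e31 q \<approx> e31 q * e12 + kk g * e32"
proof -
  let ?h = "qnumH q 1 0 0" and ?r = "scl (of_real (inverse q))"
  have "e12 * e31 q = e12 * e32 * e21 - ?r * (e12 * e21 * e32)"
    by (simp add: e31_def right_diff_distrib mult.assoc scl_left[of e12] scl_left[of e23])
  also have "\<dots> \<approx> e32 * e12 * e21 - ?r * ((e21 * e12 + kk ?h) * e32)"
    by (intro cg_diff cg_right cg_left e12_e32 e12_e21)
  also have "\<dots> = e32 * (e12 * e21) - ?r * (e21 * (e12 * e32)) - ?r * kk ?h * e32"
    by (simp add: algebra_simps)
  also have "\<dots> \<approx> e32 * (e21 * e12 + kk ?h) - ?r * (e21 * (e32 * e12)) - kk (kconst (of_real (inverse q)) * ?h) * e32"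
    by (intro cg_diff cg_right cg_left e12_e32 e12_e21 scl_kk)
  also have "\<dots> = e31 q * e12 + e32 * kk ?h - kk (kconst (of_real (inverse q)) * ?h) * e32"
    by (simp add: e31_def algebra_simps)
  also have "\<dots> \<approx> e31 q * e12 + kk (tau q (- 1) 2 ?h) * e32 - kk (kconst (of_real (inverse q)) * ?h) * e32"
    using cg_sym[OF kk_e32[of "tau q (- 1) 2 ?h"]] by (intro cg_add cg_diff) simp_all
  also have "\<dots> = e31 q * e12 + (kk (tau q (- 1) 2 ?h) - kk (kconst (of_real (inverse q)) * ?h)) * e32"
    by (simp add: algebra_simps)
  also have "\<dots> \<approx> e31 q * e12 + kk (tau q (- 1) 2 ?h - kconst (of_real (inverse q)) * ?h) * e32"
    by (intro cg_add cg_right kk_diff cg_refl)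
  finally show ?thesis by blast
qed

lemma e23_e31: "\<exists>g. e23 * e31 q \<approx> e31 q * e23 + kk g * e21"
proof -
  let ?h = "qnumH q 0 1 0" and ?r = "scl (of_real (inverse q))"
  have "e23 * e31 q = e23 * e32 * e21 - ?r * (e23 * e21 * e32)"
    by (simp add: e31_def right_diff_distrib mult.assoc scl_left[of e12] scl_left[of e23])
  also have "\<dots> \<approx> (e32 * e23 + kk ?h) * e21 - ?r * (e21 * e23 * e32)"
    by (intro cg_diff cg_right cg_left e23_e32 e23_e21)
  also have "\<dots> = e32 * (e23 * e21) + kk ?h * e21 - ?r * (e21 * (e23 * e32))"
    by (simp add: algebra_simps)
  also have "\<dots> \<approx> e32 * (e21 * e23) + kk ?h * e21 - ?r * (e21 * (e32 * e23 + kk ?h))"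
    by (intro cg_diff cg_add cg_right cg_left e23_e32 e23_e21 cg_refl)
  also have "\<dots> = e31 q * e23 + kk ?h * e21 - ?r * (e21 * kk ?h)"
    by (simp add: e31_def algebra_simps)
  also have "\<dots> \<approx> e31 q * e23 + kk ?h * e21 - ?r * (kk (tau q 2 (- 1) ?h) * e21)"
    using cg_sym[OF kk_e21[of "tau q 2 (- 1) ?h"]] by (intro cg_add cg_diff cg_left) simp_all
  also have "\<dots> = e31 q * e23 + kk ?h * e21 - ?r * kk (tau q 2 (- 1) ?h) * e21"
    by (simp add: mult.assoc)
  also have "\<dots> \<approx> e31 q * e23 + kk ?h * e21 - kk (kconst (of_real (inverse q)) * tau q 2 (- 1) ?h) * e21"
    by (intro cg_diff cg_right scl_kk cg_refl)
  also have "\<dots> = e31 q * e23 + (kk ?h - kk (kconst (of_real (inverse q)) * tau q 2 (- 1) ?h)) * e21"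
    by (simp add: algebra_simps)
  also have "\<dots> \<approx> e31 q * e23 + kk (?h - kconst (of_real (inverse q)) * tau q 2 (- 1) ?h) * e21"
    by (intro cg_add cg_right kk_diff cg_refl)
  finally show ?thesis by blast
qed

end


section \<open>Ordering products: stability of the span under left multiplication\<close>

definition pos_word :: "real \<Rightarrow> nat \<Rightarrow> nat \<Rightarrow> nat \<Rightarrow> falg" where
  "pos_word q b1 b2 b3 = e12 ^ b1 * e13 q ^ b2 * e23 ^ b3"

text \<open>Raising factors reorder among themselves with scalar coefficients. This is done apart
  from the Cartan factor, which \<open>kk_pos_span\<close> puts in front afterwards.\<close>

inductive_set pos_span :: "real \<Rightarrow> falg set" for q where
  zero: "0 \<in> pos_span q"
| word: "scl c * pos_word q b1 b2 b3 \<in> pos_span q"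
| add: "u \<in> pos_span q \<Longrightarrow> v \<in> pos_span q \<Longrightarrow> u + v \<in> pos_span q"
| cong: "u \<in> pos_span q \<Longrightarrow> v - u \<in> rel_ideal q \<Longrightarrow> v \<in> pos_span q"

context qparam begin

lemma monom_pbw_eq: "monom_pbw q (a1, a2, a3, b1, b2, b3) f =
    e21 ^ a1 * (e31 q ^ a2 * (e32 ^ a3 * (kk f * pos_word q b1 b2 b3)))"
  by (simp add: pos_word_def mult.assoc)

lemma pos_span_cong: "u \<in> pos_span q \<Longrightarrow> v \<approx> u \<Longrightarrow> v \<in> pos_span q"
  unfolding cg_def by (rule pos_span.cong)

lemma pbw_span_cong: "u \<in> pbw_span q \<Longrightarrow> v \<approx> u \<Longrightarrow> v \<in> pbw_span q"
  unfolding cg_def by (rule pbw_span.cong)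

lemma pos_span_closed:
  assumes "\<And>b1 b2 b3. x * pos_word q b1 b2 b3 \<in> pos_span q"
    and scl: "\<And>c u. u \<in> pos_span q \<Longrightarrow> scl c * u \<in> pos_span q"
    and "u \<in> pos_span q"
  shows "x * u \<in> pos_span q"
  using assms(3)
proof induct
  case (word c b1 b2 b3)
  then show ?case using scl[OF assms(1)[of b1 b2 b3], of c] by (simp add: scl_left[of x])
next
  case (cong u v)
  show ?case by (rule pos_span_cong[OF cong(2) cg_left]) (use cong(3) in \<open>simp add: cg_def\<close>)
qed (simp_all add: distrib_left pos_span.zero pos_span.add)

lemma pos_span_scl: "u \<in> pos_span q \<Longrightarrow> scl c * u \<in> pos_span q"
proof (induct rule: pos_span.induct)
  case (word d b1 b2 b3)
  then show ?case using pos_span.word[of "c * d" q b1 b2 b3] by (simp add: scl_mult flip: mult.assoc)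
next
  case (cong u v)
  show ?case by (rule pos_span_cong[OF cong(2) cg_left]) (use cong(3) in \<open>simp add: cg_def\<close>)
qed (simp_all add: distrib_left pos_span.zero pos_span.add)

lemma pos_span_word: "pos_word q b1 b2 b3 \<in> pos_span q"
  using pos_span.word[of 1 q b1 b2 b3] by simp

lemma commute_power:
  assumes "x * y \<approx> scl c * (y * x)"
  shows "\<exists>d. x * y ^ n \<approx> scl d * (y ^ n * x)"
proof (induct n)
  case 0
  show ?case by (intro exI[of _ 1]) simp
next
  case (Suc n)
  then obtain d where d: "x * y ^ n \<approx> scl d * (y ^ n * x)" by blast
  have "x * y ^ Suc n = x * y * y ^ n" by (simp add: mult.assoc)
  also have "\<dots> \<approx> scl c * (y * x) * y ^ n" by (intro cg_right assms)
  also have "\<dots> = scl c * (y * (x * y ^ n))" by (simp add: mult.assoc)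
  also have "\<dots> \<approx> scl c * (y * (scl d * (y ^ n * x)))" by (intro cg_left d)
  also have "\<dots> = scl (c * d) * (y ^ Suc n * x)"
    by (simp add: scl_left[of y] mult.assoc flip: scl_mult)
  finally show ?case by blast
qed

lemma pos_span_e12: "u \<in> pos_span q \<Longrightarrow> e12 * u \<in> pos_span q"
proof (rule pos_span_closed[OF _ pos_span_scl])
  show "e12 * pos_word q b1 b2 b3 \<in> pos_span q" for b1 b2 b3
    using pos_span_word[of "Suc b1" b2 b3] by (simp add: pos_word_def mult.assoc)
qed

lemma pos_span_e13: "u \<in> pos_span q \<Longrightarrow> e13 q * u \<in> pos_span q"
proof (rule pos_span_closed[OF _ pos_span_scl])
  fix b1 b2 b3
  obtain d where "e13 q * e12 ^ b1 \<approx> scl d * (e12 ^ b1 * e13 q)"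
    using commute_power[OF e13_e12] by blast
  from cg_right[OF this, of "e13 q ^ b2 * e23 ^ b3"]
  have "e13 q * pos_word q b1 b2 b3 \<approx> scl d * pos_word q b1 (Suc b2) b3"
    by (simp add: pos_word_def mult.assoc)
  then show "e13 q * pos_word q b1 b2 b3 \<in> pos_span q"
    by (rule pos_span_cong[OF pos_span.word])
qed

text \<open>Factors \<open>e12\<close> are crossed one at a time: e23 e12 = q^(-1) e12 e23 - q^(-1)
  e13 leaves a shorter case and products already covered.\<close>

lemma pos_span_e23: "u \<in> pos_span q \<Longrightarrow> e23 * u \<in> pos_span q"
proof (rule pos_span_closed[OF _ pos_span_scl])
  fix b1 b2 b3
  show "e23 * pos_word q b1 b2 b3 \<in> pos_span q"
  proof (induct b1)
    case 0
    obtain d where "e23 * e13 q ^ b2 \<approx> scl d * (e13 q ^ b2 * e23)"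
      using commute_power[OF e23_e13] by blast
    from cg_right[OF this, of "e23 ^ b3"]
    have "e23 * pos_word q 0 b2 b3 \<approx> scl d * pos_word q 0 b2 (Suc b3)"
      by (simp add: pos_word_def mult.assoc power_commutes)
    then show ?case by (rule pos_span_cong[OF pos_span.word])
  next
    case (Suc b1)
    have "e23 * pos_word q (Suc b1) b2 b3 = e23 * e12 * pos_word q b1 b2 b3"
      by (simp add: pos_word_def mult.assoc)
    also have "\<dots> = scl (of_real (inverse q)) * (e12 * (e23 * pos_word q b1 b2 b3))
        + scl (- of_real (inverse q)) * (e13 q * pos_word q b1 b2 b3)"
      unfolding e23_e12 by (simp add: distrib_right mult.assoc)
    finally show ?case
      using Suc by (simp add: pos_span.add pos_span_scl pos_span_e12 pos_span_e13 pos_span_word)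
  qed
qed

lemma pbw_span_closed:
  assumes "\<And>a1 a2 a3 b1 b2 b3 f. x * monom_pbw q (a1, a2, a3, b1, b2, b3) f \<in> pbw_span q"
    and "u \<in> pbw_span q"
  shows "x * u \<in> pbw_span q"
  using assms(2)
proof induct
  case (monom m f)
  then show ?case using assms(1) by (cases m) simp
next
  case (cong u v)
  show ?case by (rule pbw_span_cong[OF cong(2) cg_left]) (use cong(3) in \<open>simp add: cg_def\<close>)
qed (simp_all add: distrib_left pbw_span.zero pbw_span.add)

lemma pbw_span_e21: "u \<in> pbw_span q \<Longrightarrow> e21 * u \<in> pbw_span q"
proof (rule pbw_span_closed)
  fix a1 a2 a3 b1 b2 b3 f
  have "e21 * monom_pbw q (a1, a2, a3, b1, b2, b3) f = monom_pbw q (Suc a1, a2, a3, b1, b2, b3) f"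
    by (simp add: mult.assoc)
  then show "e21 * monom_pbw q (a1, a2, a3, b1, b2, b3) f \<in> pbw_span q"
    by (simp only: pbw_span.monom)
qed

lemma kk_power:
  assumes "\<And>f. \<exists>g. kk f * x \<approx> x * kk g"
  shows "\<exists>g. kk f * x ^ n \<approx> x ^ n * kk g"
proof (induct n arbitrary: f)
  case 0
  show ?case by (intro exI[of _ f]) simp
next
  case (Suc n)
  obtain g where g: "kk f * x \<approx> x * kk g" using assms by blast
  obtain g' where g': "kk g * x ^ n \<approx> x ^ n * kk g'" using Suc by blast
  have "kk f * x ^ Suc n \<approx> x * kk g * x ^ n" using cg_right[OF g] by (simp add: mult.assoc)
  also have "x * kk g * x ^ n \<approx> x * (x ^ n * kk g')" using cg_left[OF g'] by (simp add: mult.assoc)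
  finally show ?case by (metis mult.assoc power_Suc)
qed

lemma kk_e31: "kk f * e31 q \<approx> e31 q * kk (tau q (- 1) (- 1) f)"
proof -
  have "kk f * e32 * e21 \<approx> e32 * (kk (tau q 1 (- 2) f) * e21)"
    using cg_right[OF kk_e32] by (simp add: mult.assoc)
  also have "\<dots> \<approx> e32 * (e21 * kk (tau q (- 1) (- 1) f))"
    using cg_left[OF kk_e21[of "tau q 1 (- 2) f"]] by simp
  finally have 1: "kk f * e32 * e21 \<approx> e32 * (e21 * kk (tau q (- 1) (- 1) f))" .
  have "kk f * e21 * e32 \<approx> e21 * (kk (tau q (- 2) 1 f) * e32)"
    using cg_right[OF kk_e21] by (simp add: mult.assoc)
  also have "\<dots> \<approx> e21 * (e32 * kk (tau q (- 1) (- 1) f))"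
    using cg_left[OF kk_e32[of "tau q (- 2) 1 f"]] by simp
  finally have 2: "kk f * e21 * e32 \<approx> e21 * (e32 * kk (tau q (- 1) (- 1) f))" .
  have "kk f * e31 q = kk f * e32 * e21 - scl (of_real (inverse q)) * (kk f * e21 * e32)"
    by (simp add: e31_def right_diff_distrib mult.assoc scl_left[of "kk f"])
  also have "\<dots> \<approx> e32 * (e21 * kk (tau q (- 1) (- 1) f)) - scl (of_real (inverse q)) * (e21 * (e32 * kk (tau q (- 1) (- 1) f)))"
    by (intro cg_diff cg_left 1 2)
  finally show ?thesis by (simp add: e31_def left_diff_distrib mult.assoc)
qed

lemma pbw_span_kk: "u \<in> pbw_span q \<Longrightarrow> kk f * u \<in> pbw_span q"
proof (rule pbw_span_closed)
  fix a1 a2 a3 b1 b2 b3 g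
  let ?w = "kk g * pos_word q b1 b2 b3"
  obtain f1 where 1: "kk f * e21 ^ a1 \<approx> e21 ^ a1 * kk f1"
    using kk_power[of e21] kk_e21 by blast
  obtain f2 where 2: "kk f1 * e31 q ^ a2 \<approx> e31 q ^ a2 * kk f2"
    using kk_power[of "e31 q"] kk_e31 by blast
  obtain f3 where 3: "kk f2 * e32 ^ a3 \<approx> e32 ^ a3 * kk f3"
    using kk_power[of e32] kk_e32 by blast
  have "kk f * monom_pbw q (a1, a2, a3, b1, b2, b3) g = kk f * e21 ^ a1 * (e31 q ^ a2 * (e32 ^ a3 * ?w))"
    by (simp only: monom_pbw_eq mult.assoc)
  also have "\<dots> \<approx> e21 ^ a1 * kk f1 * (e31 q ^ a2 * (e32 ^ a3 * ?w))" by (intro cg_right 1)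
  also have "\<dots> = e21 ^ a1 * (kk f1 * e31 q ^ a2 * (e32 ^ a3 * ?w))" by (simp add: mult.assoc)
  also have "\<dots> \<approx> e21 ^ a1 * (e31 q ^ a2 * kk f2 * (e32 ^ a3 * ?w))" by (intro cg_left cg_right 2)
  also have "\<dots> = e21 ^ a1 * (e31 q ^ a2 * (kk f2 * e32 ^ a3 * ?w))" by (simp add: mult.assoc)
  also have "\<dots> \<approx> e21 ^ a1 * (e31 q ^ a2 * (e32 ^ a3 * kk f3 * ?w))" by (intro cg_left cg_right 3)
  also have "\<dots> = e21 ^ a1 * (e31 q ^ a2 * (e32 ^ a3 * (kk f3 * kk g * pos_word q b1 b2 b3)))"
    by (simp add: mult.assoc)
  also have "\<dots> \<approx> monom_pbw q (a1, a2, a3, b1, b2, b3) (f3 * g)"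
    unfolding monom_pbw_eq by (intro cg_left cg_right cg_sym[OF kk_mult])
  finally show "kk f * monom_pbw q (a1, a2, a3, b1, b2, b3) g \<in> pbw_span q"
    by (rule pbw_span_cong[OF pbw_span.monom])
qed

lemma pbw_span_scl: "u \<in> pbw_span q \<Longrightarrow> scl c * u \<in> pbw_span q"
  using pbw_span_kk[of u "kconst c"] cg_right[OF cg_sym[OF kk_const]] pbw_span_cong by blast

lemma pbw_span_e31: "u \<in> pbw_span q \<Longrightarrow> e31 q * u \<in> pbw_span q"
proof (rule pbw_span_closed)
  fix a1 a2 a3 b1 b2 b3 g
  obtain d where "e31 q * e21 ^ a1 \<approx> scl d * (e21 ^ a1 * e31 q)"
    using commute_power[OF e31_e21] by blast
  from cg_right[OF this, of "e31 q ^ a2 * (e32 ^ a3 * (kk g * pos_word q b1 b2 b3))"]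
  have "e31 q * monom_pbw q (a1, a2, a3, b1, b2, b3) g \<approx> scl d * monom_pbw q (a1, Suc a2, a3, b1, b2, b3) g"
    by (simp only: monom_pbw_eq power_Suc mult.assoc)
  then show "e31 q * monom_pbw q (a1, a2, a3, b1, b2, b3) g \<in> pbw_span q"
    by (rule pbw_span_cong[OF pbw_span_scl[OF pbw_span.monom]])
qed

lemma monom_Suc: "monom_pbw q (Suc a1, a2, a3, b1, b2, b3) g = e21 * monom_pbw q (a1, a2, a3, b1, b2, b3) g"
  "monom_pbw q (0, Suc a2, a3, b1, b2, b3) g = e31 q * monom_pbw q (0, a2, a3, b1, b2, b3) g"
  "monom_pbw q (0, 0, Suc a3, b1, b2, b3) g = e32 * monom_pbw q (0, 0, a3, b1, b2, b3) g"
  by (simp_all add: mult.assoc)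

lemma pbw_span_e32: "u \<in> pbw_span q \<Longrightarrow> e32 * u \<in> pbw_span q"
proof (rule pbw_span_closed)
  fix a1 a2 a3 b1 b2 b3 g
  show "e32 * monom_pbw q (a1, a2, a3, b1, b2, b3) g \<in> pbw_span q"
  proof (induct a1)
    case 0
    obtain d where "e32 * e31 q ^ a2 \<approx> scl d * (e31 q ^ a2 * e32)"
      using commute_power[OF e32_e31] by blast
    from cg_right[OF this, of "e32 ^ a3 * (kk g * pos_word q b1 b2 b3)"]
    have "e32 * monom_pbw q (0, a2, a3, b1, b2, b3) g \<approx> scl d * monom_pbw q (0, a2, Suc a3, b1, b2, b3) g"
      by (simp only: monom_pbw_eq power_Suc power_0 mult_1_left mult.assoc)
    then show ?case by (rule pbw_span_cong[OF pbw_span_scl[OF pbw_span.monom]])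
  next
    case (Suc a1)
    have "e32 * (e21 * u) = e31 q * u + scl (of_real (inverse q)) * (e21 * (e32 * u))" for u
      unfolding mult.assoc[symmetric] e32_e21 by (simp add: distrib_right mult.assoc)
    then show ?case
      using Suc by (simp only: monom_Suc pbw_span.add pbw_span_e31 pbw_span.monom pbw_span_scl pbw_span_e21)
  qed
qed

lemma kk_pos_span: "u \<in> pos_span q \<Longrightarrow> kk f * u \<in> pbw_span q"
proof (induct rule: pos_span.induct)
  case (word c b1 b2 b3)
  have "kk f * (scl c * pos_word q b1 b2 b3) = scl c * monom_pbw q (0, 0, 0, b1, b2, b3) f"
    by (simp only: monom_pbw_eq power_0 mult_1_left scl_left[of "kk f"])
  then show ?case by (simp only: pbw_span_scl pbw_span.monom)
next
  case (cong u v)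
  show ?case by (rule pbw_span_cong[OF cong(2) cg_left]) (use cong(3) in \<open>simp add: cg_def\<close>)
qed (simp_all add: distrib_left pbw_span.zero pbw_span.add)

text \<open>The nested inductions cross powers of \<open>e32\<close>, \<open>e31\<close> and
  \<open>e21\<close>. Each commutator is zero, a Cartan element or a Cartan multiple of
  \<open>e32\<close>, and the span is already stable under these.\<close>

lemma pbw_span_e12: "u \<in> pbw_span q \<Longrightarrow> e12 * u \<in> pbw_span q"
proof (rule pbw_span_closed)
  fix a1 a2 a3 b1 b2 b3 g
  have 3: "e12 * monom_pbw q (0, 0, a3, b1, b2, b3) g \<in> pbw_span q"
  proof (induct a3)
    case 0
    have "e12 * (kk g * pos_word q b1 b2 b3) \<approx> kk (tau q (- 2) 1 g) * (e12 * pos_word q b1 b2 b3)"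
      using cg_right[OF e12_kk] by (simp add: mult.assoc)
    from pbw_span_cong[OF kk_pos_span[OF pos_span_e12[OF pos_span_word]] this]
    show ?case by (simp only: monom_pbw_eq power_0 mult_1_left)
  next
    case (Suc a3)
    have "e12 * (e32 * u) \<approx> e32 * (e12 * u)" for u
      using cg_right[OF e12_e32, of u] by (simp add: mult.assoc)
    from pbw_span_cong[OF pbw_span_e32[OF Suc] this] show ?case by (simp only: monom_Suc)
  qed
  have 2: "e12 * monom_pbw q (0, a2, a3, b1, b2, b3) g \<in> pbw_span q"
  proof (induct a2)
    case (Suc a2)
    obtain f where f: "e12 * e31 q \<approx> e31 q * e12 + kk f * e32" using e12_e31 by blast
    have "e12 * (e31 q * u) \<approx> e31 q * (e12 * u) + kk f * (e32 * u)" for u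
      using cg_right[OF f, of u] by (simp add: mult.assoc distrib_right)
    from pbw_span_cong[OF pbw_span.add[OF pbw_span_e31[OF Suc] pbw_span_kk[OF pbw_span_e32[OF pbw_span.monom]]] this]
    show ?case by (simp only: monom_Suc)
  qed (rule 3)
  show "e12 * monom_pbw q (a1, a2, a3, b1, b2, b3) g \<in> pbw_span q"
  proof (induct a1)
    case (Suc a1)
    have "e12 * (e21 * u) \<approx> e21 * (e12 * u) + kk (qnumH q 1 0 0) * u" for u
      using cg_right[OF e12_e21, of u] by (simp add: mult.assoc distrib_right)
    from pbw_span_cong[OF pbw_span.add[OF pbw_span_e21[OF Suc] pbw_span_kk[OF pbw_span.monom]] this]
    show ?case by (simp only: monom_Suc)
  qed (rule 2)
qed

lemma pbw_span_e23: "u \<in> pbw_span q \<Longrightarrow> e23 * u \<in> pbw_span q"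
proof (rule pbw_span_closed)
  fix a1 a2 a3 b1 b2 b3 g
  have 3: "e23 * monom_pbw q (0, 0, a3, b1, b2, b3) g \<in> pbw_span q"
  proof (induct a3)
    case 0
    have "e23 * (kk g * pos_word q b1 b2 b3) \<approx> kk (tau q 1 (- 2) g) * (e23 * pos_word q b1 b2 b3)"
      using cg_right[OF e23_kk] by (simp add: mult.assoc)
    from pbw_span_cong[OF kk_pos_span[OF pos_span_e23[OF pos_span_word]] this]
    show ?case by (simp only: monom_pbw_eq power_0 mult_1_left)
  next
    case (Suc a3)
    have "e23 * (e32 * u) \<approx> e32 * (e23 * u) + kk (qnumH q 0 1 0) * u" for u
      using cg_right[OF e23_e32, of u] by (simp add: mult.assoc distrib_right)
    from pbw_span_cong[OF pbw_span.add[OF pbw_span_e32[OF Suc] pbw_span_kk[OF pbw_span.monom]] this]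
    show ?case by (simp only: monom_Suc)
  qed
  have 2: "e23 * monom_pbw q (0, a2, a3, b1, b2, b3) g \<in> pbw_span q"
  proof (induct a2)
    case (Suc a2)
    obtain f where f: "e23 * e31 q \<approx> e31 q * e23 + kk f * e21" using e23_e31 by blast
    have "e23 * (e31 q * u) \<approx> e31 q * (e23 * u) + kk f * (e21 * u)" for u
      using cg_right[OF f, of u] by (simp add: mult.assoc distrib_right)
    from pbw_span_cong[OF pbw_span.add[OF pbw_span_e31[OF Suc] pbw_span_kk[OF pbw_span_e21[OF pbw_span.monom]]] this]
    show ?case by (simp only: monom_Suc)
  qed (rule 3)
  show "e23 * monom_pbw q (a1, a2, a3, b1, b2, b3) g \<in> pbw_span q"
  proof (induct a1)
    case (Suc a1)
    have "e23 * (e21 * u) \<approx> e21 * (e23 * u)" for u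
      using cg_right[OF e23_e21, of u] by (simp add: mult.assoc)
    from pbw_span_cong[OF pbw_span_e21[OF Suc] this] show ?case by (simp only: monom_Suc)
  qed (rule 2)
qed

lemma pbw_span_UNIV: "u \<in> pbw_span q"
proof (induct u rule: falg_induct)
  case zero
  show ?case by (rule pbw_span.zero)
next
  case (single u w c)
  have gen: "v \<in> pbw_span q \<Longrightarrow> gn g * v \<in> pbw_span q" for g v
    by (cases g rule: gen_cases) (simp_all add: pbw_span_e12 pbw_span_e23 pbw_span_e21 pbw_span_e32 pbw_span_kk)
  have "Poly_Mapping.single (FWord gs) 1 \<in> pbw_span q" for gs
  proof (induct gs)
    case Nil
    have "1 \<approx> monom_pbw q (0, 0, 0, 0, 0, 0) 1" using cg_sym[OF kk_1] by simp
    from pbw_span_cong[OF pbw_span.monom this]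
    show ?case by (simp flip: zero_fword_def)
  next
    case (Cons g gs)
    have "Poly_Mapping.single (FWord (g # gs)) 1 = gn g * Poly_Mapping.single (FWord gs) 1"
      by (simp add: gn_def mult_single)
    then show ?case using gen[OF Cons] by simp
  qed
  moreover have "Poly_Mapping.single w c = scl c * Poly_Mapping.single w 1"
    by (simp add: scl_def mult_single)
  ultimately have "Poly_Mapping.single w c \<in> pbw_span q"
    by (metis fword.exhaust pbw_span_scl)
  then show ?case using single pbw_span.add by blast
qed

end


section \<open>Coefficients in the basis of ordered monomials\<close>

definition sing :: "expo \<Rightarrow> cartan \<Rightarrow> series" where
  "sing m f = (\<lambda>k. if k = m then f else 0)"

text \<open>A representative of a series in the free algebra. For infinite support the sum takes the
  default value 0, so it represents the series only when the support is finite.\<close>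

definition hat :: "real \<Rightarrow> series \<Rightarrow> falg" where
  "hat q F = (\<Sum>m | F m \<noteq> 0. monom_pbw q m (F m))"

abbreviation vac :: series where "vac \<equiv> sing (0, 0, 0, 0, 0, 0) 1"

lemma sing_0 [simp]: "sing m 0 = 0"
  by (auto simp: sing_def fun_eq_iff)

lemma sing_apply: "sing m f k = (if k = m then f else 0)"
  by (simp add: sing_def)

lemma sum_fun_apply: "(\<Sum>i\<in>A. f i) x = (\<Sum>i\<in>A. f i x)" for f :: "_ \<Rightarrow> _ \<Rightarrow> 'a::comm_monoid_add"
  by (induct A rule: infinite_finite_induct) simp_all

context qparam begin

lemma monom_0: "monom_pbw q m 0 \<approx> 0"
proof (cases m)
  case (fields a1 a2 a3 b1 b2 b3)
  have "e21 ^ a1 * (e31 q ^ a2 * (e32 ^ a3 * (kk 0 * pos_word q b1 b2 b3)))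
    \<approx> e21 ^ a1 * (e31 q ^ a2 * (e32 ^ a3 * (0 * pos_word q b1 b2 b3)))"
    by (intro cg_left cg_right kk_0)
  then show ?thesis by (simp only: fields monom_pbw_eq mult_zero_left mult_zero_right)
qed

lemma monom_add: "monom_pbw q m (f + g) \<approx> monom_pbw q m f + monom_pbw q m g"
proof (cases m)
  case (fields a1 a2 a3 b1 b2 b3)
  have "e21 ^ a1 * (e31 q ^ a2 * (e32 ^ a3 * (kk (f + g) * pos_word q b1 b2 b3)))
    \<approx> e21 ^ a1 * (e31 q ^ a2 * (e32 ^ a3 * ((kk f + kk g) * pos_word q b1 b2 b3)))"
    by (intro cg_left cg_right kk_add)
  then show ?thesis by (simp only: fields monom_pbw_eq distrib_left distrib_right)
qed

lemma cg_sum: "(\<And>i. i \<in> A \<Longrightarrow> f i \<approx> g i) \<Longrightarrow> (\<Sum>i\<in>A. f i) \<approx> (\<Sum>i\<in>A. g i)"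
  by (induct A rule: infinite_finite_induct) (simp_all add: cg_add)

text \<open>Only a congruence: \<open>Car 0\<close> is a generator of the free algebra like any
  other, so a monomial with coefficient 0 is congruent to zero but not equal to it.\<close>

lemma hat_superset:
  assumes "finite A" "{m. F m \<noteq> 0} \<subseteq> A"
  shows "hat q F \<approx> (\<Sum>m\<in>A. monom_pbw q m (F m))"
proof -
  have "(\<Sum>m\<in>A. monom_pbw q m (F m)) = (\<Sum>m\<in>A - {m. F m \<noteq> 0}. monom_pbw q m (F m)) + hat q F"
    unfolding hat_def by (rule sum.subset_diff) (use assms in auto)
  moreover have "(\<Sum>m\<in>A - {m. F m \<noteq> 0}. monom_pbw q m (F m)) \<approx> (\<Sum>m\<in>A - {m. F m \<noteq> 0}. 0)"
    by (rule cg_sum) (use monom_0 in auto)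
  ultimately show ?thesis using cg_add[OF _ cg_refl[of "hat q F"]] cg_sym by fastforce
qed

lemma ex_hat: "\<exists>F. finite {m. F m \<noteq> 0} \<and> u \<approx> hat q F"
  using pbw_span_UNIV[of u]
proof induct
  case zero
  show ?case by (intro exI[of _ 0]) (simp add: hat_def)
next
  case (monom m f)
  have "hat q (sing m f) \<approx> (\<Sum>k\<in>{m}. monom_pbw q k (sing m f k))"
    by (rule hat_superset) (auto simp: sing_apply)
  then have "monom_pbw q m f \<approx> hat q (sing m f)" by (simp add: sing_apply cg_sym)
  moreover have "finite {k. sing m f k \<noteq> 0}" by (rule finite_subset[of _ "{m}"]) (auto simp: sing_apply)
  ultimately show ?case by blast
next
  case (add u v)
  then obtain F G where *: "finite {m. F m \<noteq> 0}" "u \<approx> hat q F" "finite {m. G m \<noteq> 0}" "v \<approx> hat q G"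
    by blast
  let ?A = "{m. F m \<noteq> 0} \<union> {m. G m \<noteq> 0}"
  have fin: "finite ?A" using * by simp
  have "hat q (F + G) \<approx> (\<Sum>m\<in>?A. monom_pbw q m ((F + G) m))"
    by (rule hat_superset[OF fin]) auto
  also have "\<dots> \<approx> (\<Sum>m\<in>?A. monom_pbw q m (F m) + monom_pbw q m (G m))"
    by (rule cg_sum) (simp add: monom_add)
  also have "\<dots> = (\<Sum>m\<in>?A. monom_pbw q m (F m)) + (\<Sum>m\<in>?A. monom_pbw q m (G m))"
    by (rule sum.distrib)
  also have "\<dots> \<approx> hat q F + hat q G"
    by (intro cg_add cg_sym[OF hat_superset[OF fin]]) auto
  also have "\<dots> \<approx> u + v" using * by (intro cg_add cg_sym[of u] cg_sym[of v])
  finally have "u + v \<approx> hat q (F + G)" by (rule cg_sym)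
  moreover have "finite {m. (F + G) m \<noteq> 0}" by (rule finite_subset[OF _ fin]) auto
  ultimately show ?case by blast
next
  case (cong u v)
  then obtain F where "finite {m. F m \<noteq> 0}" "u \<approx> hat q F" by blast
  moreover have "v \<approx> u" using cong by (simp add: cg_def)
  ultimately show ?case using cg_trans by blast
qed

lemma rho_cg: "u \<approx> v \<Longrightarrow> rho q u F = rho q v F"
proof -
  assume "u \<approx> v"
  then have "rho q (u - v) F = 0" unfolding cg_def by (rule rho_rel_ideal)
  then have "rho q u F - rho q v F = 0" by (simp only: rho_diff)
  then show ?thesis by (simp only: right_minus_eq)
qed

lemma rho_sum: "rho q (\<Sum>i\<in>A. f i) F = (\<Sum>i\<in>A. rho q (f i) F)"
  by (induct A rule: infinite_finite_induct) (simp_all add: rho_add del: plus_fun_apply zero_fun_apply)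

lemma Pos_apply:
  "Lop q (Pos N1) F (a1, a2, a3, b1, b2, b3) =
     qn q (int a1 + 1) * qnumH q 1 0 (int a3 - int a1 - int a2) * F (a1 + 1, a2, a3, b1, b2, b3)
     - (if a3 = 0 then 0 else qn q (int a2 + 1) * Qp q (int a2 - int a3) * qH (- 2) 0 * F (a1, a2 + 1, a3 - 1, b1, b2, b3))
     + (if b1 = 0 then 0 else tau q (- 2) 1 (F (a1, a2, a3, b1 - 1, b2, b3)))"
  "Lop q (Pos N2) F (a1, a2, a3, b1, b2, b3) =
     (if a1 = 0 then 0 else qn q (int a2 + 1) * Qp q (- 2 * int a3) * qH 0 2 * F (a1 - 1, a2 + 1, a3, b1, b2, b3))
     + qn q (int a3 + 1) * qnumH q 0 1 (- int a3) * F (a1, a2, a3 + 1, b1, b2, b3)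
     + (if b3 = 0 then 0 else Qp q (int b2 - int b1) * tau q 1 (- 2) (F (a1, a2, a3, b1, b2, b3 - 1)))
     - (if b2 = 0 then 0 else Qp q (- 1) * qn q (int b1 + 1) * tau q 1 (- 2) (F (a1, a2, a3, b1 + 1, b2 - 1, b3)))"
  by (auto simp: Lop_def zrest_def zdefs zext_def nat_diff_distrib nat_add_distrib)

lemma Pos_sing:
  "Lop q (Pos N1) (sing (0, 0, 0, b1, b2, b3) f) = sing (0, 0, 0, b1 + 1, b2, b3) (tau q (- 2) 1 f)"
  "Lop q (Pos N2) (sing (0, 0, 0, b1, b2, b3) f) = sing (0, 0, 0, b1, b2, b3 + 1) (Qp q (int b2 - int b1) * tau q 1 (- 2) f)
     - sing (0, 0, 0, b1 - 1, b2 + 1, b3) (Qp q (- 1) * qn q (int b1) * tau q 1 (- 2) f)"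
  by (auto simp: fun_eq_iff Pos_apply sing_apply)

lemma Neg_sing:
  "Lop q (Neg N1) (sing (a1, a2, a3, b) f) = sing (a1 + 1, a2, a3, b) f"
  "L31 (sing (0, a2, a3, b) f) = sing (0, a2 + 1, a3, b) f"
  "Lop q (Neg N2) (sing (0, 0, a3, b) f) = sing (0, 0, a3 + 1, b) f"
  by (auto simp: fun_eq_iff Neg_apply L31_apply sing_apply)

lemma rho_e31: "rho q (e31 q) F = L31 F"
  by (simp add: e31_def rho_diff rho_mult rho_scl kconst_q L31_def)

lemma rho_e13: "rho q (e13 q) F = Lop q (Pos N1) (Lop q (Pos N2) F) - Lop q (Car (Qp q 1)) (Lop q (Pos N2) (Lop q (Pos N1) F))"
  by (simp add: e13_def rho_diff rho_mult rho_scl kconst_q)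

lemma e13_sing: "rho q (e13 q) (sing (0, 0, 0, 0, b2, b3) 1) = sing (0, 0, 0, 0, b2 + 1, b3) 1"
  by (auto simp: fun_eq_iff rho_e13 Pos_sing Lop_diff LC_Qp sing_apply Qp_diff Qp_minus)

lemma rho_power_sing:
  assumes "\<And>i. rho q x (sing (s i) f) = sing (s (Suc i)) f"
  shows "rho q (x ^ n) (sing (s 0) f) = sing (s n) f"
  by (induct n) (simp_all add: rho_mult assms)

text \<open>In the chosen order each factor acts on a one-monomial series by increasing its own
  exponent, with coefficient 1. This is the independence half of the Poincare-Birkhoff-Witt
  theorem.\<close>

lemma rho_monom: "rho q (monom_pbw q m f) vac = sing m f"
proof (cases m)
  case (fields a1 a2 a3 b1 b2 b3)
  have 1: "rho q (e23 ^ b3) vac = sing (0, 0, 0, 0, 0, b3) 1"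
    by (rule rho_power_sing[where s = "\<lambda>i. (0, 0, 0, 0, 0, i)"]) (simp add: Pos_sing)
  have 2: "rho q (e13 q ^ b2) (sing (0, 0, 0, 0, 0, b3) 1) = sing (0, 0, 0, 0, b2, b3) 1"
    by (rule rho_power_sing[where s = "\<lambda>i. (0, 0, 0, 0, i, b3)"]) (simp add: e13_sing)
  have 3: "rho q (e12 ^ b1) (sing (0, 0, 0, 0, b2, b3) 1) = sing (0, 0, 0, b1, b2, b3) 1"
    by (rule rho_power_sing[where s = "\<lambda>i. (0, 0, 0, i, b2, b3)"]) (simp add: Pos_sing)
  have 4: "Lop q (Car f) (sing (0, 0, 0, b1, b2, b3) 1) = sing (0, 0, 0, b1, b2, b3) f"
    by (auto simp: fun_eq_iff LC_apply sing_apply)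
  have 5: "rho q (e32 ^ a3) (sing (0, 0, 0, b1, b2, b3) f) = sing (0, 0, a3, b1, b2, b3) f"
    by (rule rho_power_sing[where s = "\<lambda>i. (0, 0, i, b1, b2, b3)"]) (simp add: Neg_sing)
  have 6: "rho q (e31 q ^ a2) (sing (0, 0, a3, b1, b2, b3) f) = sing (0, a2, a3, b1, b2, b3) f"
    by (rule rho_power_sing[where s = "\<lambda>i. (0, i, a3, b1, b2, b3)"]) (simp add: Neg_sing rho_e31)
  have 7: "rho q (e21 ^ a1) (sing (0, a2, a3, b1, b2, b3) f) = sing (a1, a2, a3, b1, b2, b3) f"
    by (rule rho_power_sing[where s = "\<lambda>i. (i, a2, a3, b1, b2, b3)"]) (simp add: Neg_sing)
  show ?thesis by (simp add: fields rho_mult 1 2 3 4 5 6 7)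
qed

lemma sum_sing:
  assumes "finite A"
  shows "(\<Sum>k\<in>A. sing k (F k)) = (\<lambda>m. if m \<in> A then F m else 0)"
  using assms by (auto simp: fun_eq_iff sum_fun_apply sing_apply)

lemma rho_hat: "finite {m. F m \<noteq> 0} \<Longrightarrow> rho q (hat q F) vac = F"
  by (auto simp: hat_def rho_sum rho_monom sum_sing fun_eq_iff)

lemma hat_unique:
  assumes "finite {m. F m \<noteq> 0}" "u \<approx> hat q F"
  shows "rho q u vac = F"
  using rho_cg[OF assms(2), of vac] rho_hat[OF assms(1)] by simp

lemma finite_rho_vac: "finite {m. rho q u vac m \<noteq> 0}"
proof -
  obtain F where "finite {m. F m \<noteq> 0}" "u \<approx> hat q F" using ex_hat by blast
  then show ?thesis using hat_unique by simp
qed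

lemma hat_rho_vac: "hat q (rho q u vac) \<approx> u"
proof -
  obtain F where "finite {m. F m \<noteq> 0}" "u \<approx> hat q F" using ex_hat by blast
  then show ?thesis using hat_unique cg_sym by simp
qed

text \<open>Turns the definite description into a computation: spanning gives existence, and
  uniqueness holds because the action on the unit depends only on the residue class.\<close>

lemma to_taylor_eq: "to_taylor q u = rho q u vac"
  unfolding to_taylor_def hat_def[symmetric] cg_def[symmetric]
proof (rule the_equality)
  show "finite {m. rho q u vac m \<noteq> 0} \<and> u \<approx> hat q (rho q u vac)"
    by (intro conjI finite_rho_vac cg_sym[OF hat_rho_vac])
  show "F = rho q u vac" if "finite {m. F m \<noteq> 0} \<and> u \<approx> hat q F" for F
    using hat_unique[of F u] that by simp
qed

end


section \<open>Multiplication of series\<close>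

declare split_paired_All [simp del] split_paired_Ex [simp del]

text \<open>Heights of the lowering and raising parts; the composite root vectors count twice, so
  that the difference \<open>ht\<close> is additive under multiplication.\<close>

fun hm :: "expo \<Rightarrow> nat" where "hm (a1, a2, a3, b1, b2, b3) = a1 + 2 * a2 + a3"
fun hp :: "expo \<Rightarrow> nat" where "hp (a1, a2, a3, b1, b2, b3) = b1 + 2 * b2 + b3"

definition ht :: "expo \<Rightarrow> int" where "ht m = int (hp m) - int (hm m)"

fun dg :: "gen \<Rightarrow> int" where
  "dg (Pos _) = 1" | "dg (Neg _) = - 1" | "dg (Car _) = 0"

definition box :: "nat \<Rightarrow> expo set" where "box N = {m. hm m \<le> N \<and> hp m \<le> N}"

definition cut :: "nat \<Rightarrow> series \<Rightarrow> series" where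
  "cut N F = (\<lambda>m. if m \<in> box N then F m else 0)"

text \<open>Weaker than membership in \<open>taylor\<close>, but enough to make products finite, and
  stable under products, truncation and the reduction with explicit bounds.\<close>

definition bdd :: "nat \<Rightarrow> series \<Rightarrow> bool" where
  "bdd w F \<longleftrightarrow> (\<forall>m. F m \<noteq> 0 \<longrightarrow> \<bar>ht m\<bar> \<le> int w)"

lemma finite_box: "finite (box N)"
proof (rule finite_subset)
  show "box N \<subseteq> {..N} \<times> {..N} \<times> {..N} \<times> {..N} \<times> {..N} \<times> {..N}"
    by (auto simp: box_def)
qed auto

lemma box_mono: "N \<le> N' \<Longrightarrow> box N \<subseteq> box N'"
  by (auto simp: box_def)

lemma finite_cut: "finite {m. cut N F m \<noteq> 0}"
  by (rule finite_subset[OF _ finite_box[of N]]) (auto simp: cut_def)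

lemma cut_cut: "N \<le> N' \<Longrightarrow> cut N (cut N' F) = cut N F"
  using box_mono by (auto simp: cut_def fun_eq_iff)

lemma bdd_mono: "bdd w F \<Longrightarrow> w \<le> w' \<Longrightarrow> bdd w' F"
  unfolding bdd_def by (meson of_nat_mono order_trans)

lemma bdd_cut: "bdd w F \<Longrightarrow> bdd w (cut N F)"
  by (auto simp: bdd_def cut_def)

lemma bdd_finite:
  assumes "finite {m. F m \<noteq> 0}"
  shows "\<exists>w. bdd w F"
proof -
  have "finite ((\<lambda>m. nat \<bar>ht m\<bar>) ` {m. F m \<noteq> 0})" using assms by simp
  then obtain w where "\<forall>x \<in> (\<lambda>m. nat \<bar>ht m\<bar>) ` {m. F m \<noteq> 0}. x \<le> w"
    using finite_nat_set_iff_bounded_le by blast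
  then have "bdd w F" by (auto simp: bdd_def nat_le_iff)
  then show ?thesis ..
qed

lemma ht_weight: "ht m = fst (weight m) + snd (weight m)"
  by (cases m) (simp add: ht_def)

lemma taylor_bdd: "F \<in> taylor \<Longrightarrow> \<exists>w. bdd w F"
proof -
  assume "F \<in> taylor"
  then have "finite ((\<lambda>x. nat \<bar>fst x + snd x\<bar>) ` weight ` {m. F m \<noteq> 0})" by (simp add: taylor_def)
  then obtain w where "\<forall>x \<in> (\<lambda>x. nat \<bar>fst x + snd x\<bar>) ` weight ` {m. F m \<noteq> 0}. x \<le> w"
    using finite_nat_set_iff_bounded_le by blast
  then have "bdd w F" by (auto simp: bdd_def ht_weight nat_le_iff)
  then show ?thesis ..
qed

lemma finite_cut_eq: "finite {m. F m \<noteq> 0} \<Longrightarrow> \<exists>N. \<forall>N'\<ge>N. cut N' F = F"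
proof -
  assume "finite {m. F m \<noteq> 0}"
  then have "finite ((\<lambda>m. hm m + hp m) ` {m. F m \<noteq> 0})" by simp
  then obtain N where N: "\<forall>x \<in> (\<lambda>m. hm m + hp m) ` {m. F m \<noteq> 0}. x \<le> N"
    using finite_nat_set_iff_bounded_le by blast
  have "m \<in> box N'" if "F m \<noteq> 0" "N' \<ge> N" for m N'
  proof -
    have "hm m + hp m \<le> N" using N that by auto
    then show ?thesis using that by (auto simp: box_def)
  qed
  then have "\<forall>N'\<ge>N. cut N' F = F"
  proof (intro allI impI ext)
    fix N' m assume "N' \<ge> N"
    show "cut N' F m = F m"
      using \<open>\<And>N' m. F m \<noteq> 0 \<Longrightarrow> N \<le> N' \<Longrightarrow> m \<in> box N'\<close>[of m N'] \<open>N' \<ge> N\<close> by (cases "F m = 0") (simp_all add: cut_def)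
  qed
  then show ?thesis ..
qed

section \<open>Height estimates and the completed product\<close>

context qparam begin

lemma Lop_support:
  assumes "Lop q g F m \<noteq> 0"
  shows "\<exists>k. F k \<noteq> 0 \<and> hm k \<le> hm m + 1 \<and> hp k \<le> hp m \<and> ht m = ht k + dg g"
proof -
  obtain a1 a2 a3 b1 b2 b3 where m: "m = (a1, a2, a3, b1, b2, b3)" by (metis prod_cases6)
  note * = assms[unfolded m]
  show ?thesis
  proof (cases g rule: gen_cases)
    case Pos1
    have "F (a1 + 1, a2, a3, b1, b2, b3) \<noteq> 0 \<or> a3 > 0 \<and> F (a1, a2 + 1, a3 - 1, b1, b2, b3) \<noteq> 0 \<or> b1 > 0 \<and> F (a1, a2, a3, b1 - 1, b2, b3) \<noteq> 0"
      using * by (auto simp: Pos1 Pos_apply split: if_splits)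
    then consider "F (a1 + 1, a2, a3, b1, b2, b3) \<noteq> 0" | "a3 > 0 " "F (a1, a2 + 1, a3 - 1, b1, b2, b3) \<noteq> 0" | "b1 > 0 " "F (a1, a2, a3, b1 - 1, b2, b3) \<noteq> 0"
      by blast
    then show ?thesis
    proof cases
      case 1
      then show ?thesis by (intro exI[of _ "(a1 + 1, a2, a3, b1, b2, b3)"]) (simp add: m Pos1 ht_def)
    next
      case 2
      then show ?thesis by (intro exI[of _ "(a1, a2 + 1, a3 - 1, b1, b2, b3)"]) (simp add: m Pos1 ht_def)
    next
      case 3
      then show ?thesis by (intro exI[of _ "(a1, a2, a3, b1 - 1, b2, b3)"]) (simp add: m Pos1 ht_def)
    qed
  next
    case Pos2
    have "a1 > 0 \<and> F (a1 - 1, a2 + 1, a3, b1, b2, b3) \<noteq> 0 \<or> F (a1, a2, a3 + 1, b1, b2, b3) \<noteq> 0 \<or> b3 > 0 \<and> F (a1, a2, a3, b1, b2, b3 - 1) \<noteq> 0 \<or> b2 > 0 \<and> F (a1, a2, a3, b1 + 1, b2 - 1, b3) \<noteq> 0"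
      using * by (auto simp: Pos2 Pos_apply split: if_splits)
    then consider "a1 > 0 " "F (a1 - 1, a2 + 1, a3, b1, b2, b3) \<noteq> 0" | "F (a1, a2, a3 + 1, b1, b2, b3) \<noteq> 0" | "b3 > 0 " "F (a1, a2, a3, b1, b2, b3 - 1) \<noteq> 0" | "b2 > 0 " "F (a1, a2, a3, b1 + 1, b2 - 1, b3) \<noteq> 0"
      by blast
    then show ?thesis
    proof cases
      case 1
      then show ?thesis by (intro exI[of _ "(a1 - 1, a2 + 1, a3, b1, b2, b3)"]) (simp add: m Pos2 ht_def)
    next
      case 2
      then show ?thesis by (intro exI[of _ "(a1, a2, a3 + 1, b1, b2, b3)"]) (simp add: m Pos2 ht_def)
    next
      case 3
      then show ?thesis by (intro exI[of _ "(a1, a2, a3, b1, b2, b3 - 1)"]) (simp add: m Pos2 ht_def)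
    next
      case 4
      then show ?thesis by (intro exI[of _ "(a1, a2, a3, b1 + 1, b2 - 1, b3)"]) (simp add: m Pos2 ht_def)
    qed
  next
    case Neg1
    have "a1 > 0 \<and> F (a1 - 1, a2, a3, b1, b2, b3) \<noteq> 0"
      using * by (auto simp: Neg1 Neg_apply split: if_splits)
    then consider "a1 > 0 " "F (a1 - 1, a2, a3, b1, b2, b3) \<noteq> 0"
      by blast
    then show ?thesis
    proof cases
      case 1
      then show ?thesis by (intro exI[of _ "(a1 - 1, a2, a3, b1, b2, b3)"]) (simp add: m Neg1 ht_def)
    qed
  next
    case Neg2
    have "a3 > 0 \<and> F (a1, a2, a3 - 1, b1, b2, b3) \<noteq> 0 \<or> a2 > 0 \<and> F (a1 + 1, a2 - 1, a3, b1, b2, b3) \<noteq> 0"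
      using * by (auto simp: Neg2 Neg_apply split: if_splits)
    then consider "a3 > 0 " "F (a1, a2, a3 - 1, b1, b2, b3) \<noteq> 0" | "a2 > 0 " "F (a1 + 1, a2 - 1, a3, b1, b2, b3) \<noteq> 0"
      by blast
    then show ?thesis
    proof cases
      case 1
      then show ?thesis by (intro exI[of _ "(a1, a2, a3 - 1, b1, b2, b3)"]) (simp add: m Neg2 ht_def)
    next
      case 2
      then show ?thesis by (intro exI[of _ "(a1 + 1, a2 - 1, a3, b1, b2, b3)"]) (simp add: m Neg2 ht_def)
    qed
  next
    case (Car f)
    have "F m \<noteq> 0" using * by (auto simp: Car LC_apply m)
    then show ?thesis by (intro exI[of _ m]) (simp add: Car)
  qed
qed

text \<open>Stated for the action on arbitrary series, so that it composes. Left multiplication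
  cannot shorten the rightmost, raising part of a monomial, whence the inequality for
  \<open>hp\<close>.\<close>

definition homog :: "int \<Rightarrow> falg \<Rightarrow> bool" where
  "homog d u \<longleftrightarrow> (\<forall>F m. rho q u F m \<noteq> 0 \<longrightarrow> (\<exists>k. F k \<noteq> 0 \<and> hp k \<le> hp m \<and> ht m = ht k + d))"

definition lowering :: "nat \<Rightarrow> falg \<Rightarrow> bool" where
  "lowering h u \<longleftrightarrow> (\<forall>F m. rho q u F m \<noteq> 0 \<longrightarrow> (\<exists>k. F k \<noteq> 0 \<and> hp m = hp k \<and> hm m = hm k + h))"

lemma homog_gn: "homog (dg g) (gn g)"
  unfolding homog_def
proof (intro allI impI)
  fix F m assume "rho q (gn g) F m \<noteq> 0"
  then show "\<exists>k. F k \<noteq> 0 \<and> hp k \<le> hp m \<and> ht m = ht k + dg g"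
    using Lop_support[of g F m] by auto
qed

lemma homog_mult: "homog d u \<Longrightarrow> homog e v \<Longrightarrow> homog (d + e) (u * v)"
  unfolding homog_def rho_mult
proof (intro allI impI)
  fix F m
  assume u: "\<forall>F m. rho q u F m \<noteq> 0 \<longrightarrow> (\<exists>k. F k \<noteq> 0 \<and> hp k \<le> hp m \<and> ht m = ht k + d)"
    and v: "\<forall>F m. rho q v F m \<noteq> 0 \<longrightarrow> (\<exists>k. F k \<noteq> 0 \<and> hp k \<le> hp m \<and> ht m = ht k + e)"
    and "rho q u (rho q v F) m \<noteq> 0"
  then obtain k where k: "rho q v F k \<noteq> 0" "hp k \<le> hp m" "ht m = ht k + d" by blast
  then obtain l where "F l \<noteq> 0" "hp l \<le> hp k" "ht k = ht l + e" using v by blast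
  then show "\<exists>k. F k \<noteq> 0 \<and> hp k \<le> hp m \<and> ht m = ht k + (d + e)"
    using k by (intro exI[of _ l]) simp
qed

lemma homog_diff: "homog d u \<Longrightarrow> homog d v \<Longrightarrow> homog d (u - v)"
  unfolding homog_def rho_diff
proof (intro allI impI)
  fix F m
  assume u: "\<forall>F m. rho q u F m \<noteq> 0 \<longrightarrow> (\<exists>k. F k \<noteq> 0 \<and> hp k \<le> hp m \<and> ht m = ht k + d)"
    and v: "\<forall>F m. rho q v F m \<noteq> 0 \<longrightarrow> (\<exists>k. F k \<noteq> 0 \<and> hp k \<le> hp m \<and> ht m = ht k + d)"
    and "(rho q u F - rho q v F) m \<noteq> 0"
  then have "rho q u F m \<noteq> 0 \<or> rho q v F m \<noteq> 0" by auto
  then show "\<exists>k. F k \<noteq> 0 \<and> hp k \<le> hp m \<and> ht m = ht k + d" using u v by blast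
qed

lemma homog_1: "homog 0 1"
  unfolding homog_def by auto

lemma homog_scl: "homog 0 (scl c)"
  unfolding homog_def rho_scl by (auto simp: LC_kconst)

lemma homog_power: "homog d u \<Longrightarrow> homog (int n * d) (u ^ n)"
proof (induct n)
  case (Suc n)
  then show ?case using homog_mult[of d u "int n * d" "u ^ n"] by (simp add: algebra_simps)
qed (simp add: homog_1)

lemma lowering_mult: "lowering d u \<Longrightarrow> lowering e v \<Longrightarrow> lowering (d + e) (u * v)"
  unfolding lowering_def rho_mult
proof (intro allI impI)
  fix F m
  assume u: "\<forall>F m. rho q u F m \<noteq> 0 \<longrightarrow> (\<exists>k. F k \<noteq> 0 \<and> hp m = hp k \<and> hm m = hm k + d)"
    and v: "\<forall>F m. rho q v F m \<noteq> 0 \<longrightarrow> (\<exists>k. F k \<noteq> 0 \<and> hp m = hp k \<and> hm m = hm k + e)"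
    and "rho q u (rho q v F) m \<noteq> 0"
  then obtain k where k: "rho q v F k \<noteq> 0" "hp m = hp k" "hm m = hm k + d" by blast
  then obtain l where "F l \<noteq> 0" "hp k = hp l" "hm k = hm l + e" using v by blast
  then show "\<exists>k. F k \<noteq> 0 \<and> hp m = hp k \<and> hm m = hm k + (d + e)"
    using k by (intro exI[of _ l]) simp
qed

lemma lowering_diff: "lowering d u \<Longrightarrow> lowering d v \<Longrightarrow> lowering d (u - v)"
  unfolding lowering_def rho_diff
proof (intro allI impI)
  fix F m
  assume u: "\<forall>F m. rho q u F m \<noteq> 0 \<longrightarrow> (\<exists>k. F k \<noteq> 0 \<and> hp m = hp k \<and> hm m = hm k + d)"
    and v: "\<forall>F m. rho q v F m \<noteq> 0 \<longrightarrow> (\<exists>k. F k \<noteq> 0 \<and> hp m = hp k \<and> hm m = hm k + d)"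
    and "(rho q u F - rho q v F) m \<noteq> 0"
  then have "rho q u F m \<noteq> 0 \<or> rho q v F m \<noteq> 0" by auto
  then show "\<exists>k. F k \<noteq> 0 \<and> hp m = hp k \<and> hm m = hm k + d" using u v by blast
qed

lemma lowering_1: "lowering 0 1"
  unfolding lowering_def by auto

lemma lowering_scl: "lowering 0 (scl c)"
  unfolding lowering_def rho_scl by (auto simp: LC_kconst)

lemma lowering_power: "lowering d u \<Longrightarrow> lowering (n * d) (u ^ n)"
proof (induct n)
  case (Suc n)
  then show ?case using lowering_mult[of d u "n * d" "u ^ n"] by (simp add: algebra_simps)
qed (simp add: lowering_1)

lemma lowering_Neg: "lowering 1 (gn (Neg i))"
  unfolding lowering_def
proof (intro allI impI)
  fix F m assume "rho q (gn (Neg i)) F m \<noteq> 0"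
  then have *: "Lop q (Neg i) F m \<noteq> 0" by simp
  obtain a1 a2 a3 b1 b2 b3 where m: "m = (a1, a2, a3, b1, b2, b3)" by (metis prod_cases6)
  have "a1 > 0 \<and> F (a1 - 1, a2, a3, b1, b2, b3) \<noteq> 0 \<or> a3 > 0 \<and> F (a1, a2, a3 - 1, b1, b2, b3) \<noteq> 0 \<or> a2 > 0 \<and> F (a1 + 1, a2 - 1, a3, b1, b2, b3) \<noteq> 0"
      using * by (cases i) (auto simp: m Neg_apply split: if_splits)
    then consider "a1 > 0" "F (a1 - 1, a2, a3, b1, b2, b3) \<noteq> 0" | "a3 > 0" "F (a1, a2, a3 - 1, b1, b2, b3) \<noteq> 0"
    | "a2 > 0" "F (a1 + 1, a2 - 1, a3, b1, b2, b3) \<noteq> 0"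
      by blast
    then show "\<exists>k. F k \<noteq> 0 \<and> hp m = hp k \<and> hm m = hm k + 1"
  proof cases
    case 1
    then show ?thesis by (intro exI[of _ "(a1 - 1, a2, a3, b1, b2, b3)"]) (simp add: m)
  next
    case 2
    then show ?thesis by (intro exI[of _ "(a1, a2, a3 - 1, b1, b2, b3)"]) (simp add: m)
  next
    case 3
    then show ?thesis by (intro exI[of _ "(a1 + 1, a2 - 1, a3, b1, b2, b3)"]) (simp add: m)
  qed
qed

lemma lowering_e31: "lowering 2 (e31 q)"
  using lowering_mult[OF lowering_Neg[of N2] lowering_Neg[of N1]]
    lowering_mult[OF lowering_mult[OF lowering_scl[of "of_real (inverse q)"] lowering_Neg[of N1]] lowering_Neg[of N2]]
  unfolding e31_def by (intro lowering_diff) (simp_all add: numeral_2_eq_2)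

lemma homog_e31: "homog (- 2) (e31 q)"
  using homog_mult[OF homog_gn[of "Neg N2"] homog_gn[of "Neg N1"]]
    homog_mult[OF homog_mult[OF homog_scl[of "of_real (inverse q)"] homog_gn[of "Neg N1"]] homog_gn[of "Neg N2"]]
  unfolding e31_def by (intro homog_diff) simp_all

lemma homog_e13: "homog 2 (e13 q)"
  using homog_mult[OF homog_gn[of "Pos N1"] homog_gn[of "Pos N2"]]
    homog_mult[OF homog_mult[OF homog_scl[of "of_real q"] homog_gn[of "Pos N2"]] homog_gn[of "Pos N1"]]
  unfolding e13_def by (intro homog_diff) simp_all

text \<open>Lowering factors of the left monomial stay in front and raising factors of the right one
  stay at the end. These one-sided bounds are what makes product coefficients finite sums.\<close>

lemma monom_support:
  assumes "rho q (monom_pbw q k f) F m \<noteq> 0"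
  shows "hm k \<le> hm m" "\<exists>l. F l \<noteq> 0 \<and> hp l \<le> hp m \<and> ht m = ht k + ht l"
proof -
  obtain a1 a2 a3 b1 b2 b3 where k: "k = (a1, a2, a3, b1, b2, b3)" by (metis prod_cases6)
  have 1: "lowering (a1 * 1 + (a2 * 2 + a3 * 1)) (e21 ^ a1 * (e31 q ^ a2 * e32 ^ a3))"
    by (intro lowering_mult lowering_power lowering_Neg lowering_e31)
  have "rho q (e21 ^ a1 * (e31 q ^ a2 * e32 ^ a3)) (rho q (kk f * pos_word q b1 b2 b3) F) m \<noteq> 0"
    using assms unfolding k monom_pbw_eq by (simp add: rho_mult mult.assoc)
  then obtain l where "hm m = hm l + (a1 * 1 + (a2 * 2 + a3 * 1))"
    using 1 unfolding lowering_def by blast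
  then show "hm k \<le> hm m" by (simp add: k)
  have gens: "homog (- 1) e21" "homog (- 1) e32" "homog 1 e12" "homog 1 e23" "homog 0 (kk f)"
    using homog_gn[of "Neg N1"] homog_gn[of "Neg N2"] homog_gn[of "Pos N1"] homog_gn[of "Pos N2"] homog_gn[of "Car f"]
    by simp_all
  have "homog (int a1 * - 1 + (int a2 * - 2 + (int a3 * - 1 + (0 + (int b1 * 1 + (int b2 * 2 + int b3 * 1))))))
     (e21 ^ a1 * (e31 q ^ a2 * (e32 ^ a3 * (kk f * (e12 ^ b1 * (e13 q ^ b2 * e23 ^ b3))))))"
    by (intro homog_mult homog_power homog_e31 homog_e13 gens)
  moreover have "int a1 * - 1 + (int a2 * - 2 + (int a3 * - 1 + (0 + (int b1 * 1 + (int b2 * 2 + int b3 * 1))))) = ht k"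
    by (simp add: ht_def k)
  ultimately have "homog (ht k) (monom_pbw q k f)"
    by (simp add: k mult.assoc)
  then obtain l where "F l \<noteq> 0" "hp l \<le> hp m" "ht m = ht l + ht k"
    using assms unfolding homog_def by blast
  then show "\<exists>l. F l \<noteq> 0 \<and> hp l \<le> hp m \<and> ht m = ht k + ht l" by (intro exI[of _ l]) simp
qed

text \<open>A word reads entries whose lowering height exceeds that of m by at most its length and
  whose raising height is at most that of m: finitely many.\<close>

lemma rho_local: "\<exists>N. \<forall>F. (\<forall>k \<in> box N. F k = 0) \<longrightarrow> rho q u F m = 0"
proof (induct u rule: falg_induct)
  case zero
  show ?case by simp
next
  case (single u w c)
  then obtain N where N: "\<forall>F. (\<forall>k \<in> box N. F k = 0) \<longrightarrow> rho q u F m = 0" by blast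
  obtain gs where gs: "w = FWord gs" by (cases w)
  have supp: "\<exists>k. F k \<noteq> 0 \<and> hm k \<le> hm m + length gs \<and> hp k \<le> hp m"
    if "foldr (Lop q) gs F m \<noteq> 0" for F m
    using that
  proof (induct gs arbitrary: m)
    case (Cons g gs)
    obtain k where k: "foldr (Lop q) gs F k \<noteq> 0" "hm k \<le> hm m + 1" "hp k \<le> hp m"
      using Lop_support[of g "foldr (Lop q) gs F" m] Cons(2) by auto
    obtain l where "F l \<noteq> 0" "hm l \<le> hm k + length gs" "hp l \<le> hp k" using Cons(1)[OF k(1)] by blast
    then show ?case using k by (intro exI[of _ l]) auto
  qed auto
  have "foldr (Lop q) gs F m = 0" if "\<forall>k \<in> box (hm m + length gs + hp m). F k = 0" for F
  proof (rule ccontr)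
    assume "foldr (Lop q) gs F m \<noteq> 0"
    then obtain k where "F k \<noteq> 0" "hm k \<le> hm m + length gs" "hp k \<le> hp m"
      using supp by blast
    then show False using that by (auto simp: box_def)
  qed
  then have foldr_0: "foldr (Lop q) gs F m = 0" if "\<forall>k \<in> box (hm m + length gs + hp m). F k = 0" for F
    using that by blast
  have "rho q (u + Poly_Mapping.single w c) F m = 0"
    if F: "\<forall>k \<in> box (max N (hm m + length gs + hp m)). F k = 0" for F
  proof -
    have "\<forall>k \<in> box N. F k = 0"
      using F box_mono[of N "max N (hm m + length gs + hp m)"] by auto
    then have "rho q u F m = 0" using N by blast
    moreover have "foldr (Lop q) gs F m = 0"
      by (rule foldr_0) (use F box_mono[of "hm m + length gs + hp m" "max N (hm m + length gs + hp m)"] in auto)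
    ultimately show ?thesis by (simp add: rho_add rho_single gs)
  qed
  then show ?case by blast
qed

lemma cut_sum: "cut N F = (\<Sum>k\<in>box N. sing k (F k))"
  by (simp add: sum_sing[OF finite_box] cut_def)

lemma rho_sum_right: "rho q u (\<Sum>i\<in>A. f i) = (\<Sum>i\<in>A. rho q u (f i))"
  by (induct A rule: infinite_finite_induct) (simp_all add: rho_plus del: plus_fun_apply zero_fun_apply)

lemma rho_hat_cut: "rho q (hat q (cut N F)) G = (\<Sum>k\<in>box N. rho q (monom_pbw q k (F k)) G)"
proof -
  have "hat q (cut N F) \<approx> (\<Sum>k\<in>box N. monom_pbw q k (cut N F k))"
    by (rule hat_superset[OF finite_box]) (auto simp: cut_def)
  also have "\<dots> = (\<Sum>k\<in>box N. monom_pbw q k (F k))"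
    by (rule sum.cong) (auto simp: cut_def)
  finally show ?thesis using rho_cg rho_sum by metis
qed

lemma tmul_term: "to_taylor q (monom_pbw q k f * monom_pbw q l g) m = rho q (monom_pbw q k f) (sing l g) m"
  by (simp add: to_taylor_eq rho_mult rho_monom)

lemma tmul_superset:
  assumes "finite A" "\<And>k l. rho q (monom_pbw q k (F k)) (sing l (G l)) m \<noteq> 0 \<Longrightarrow> (k, l) \<in> A"
  shows "tmul q F G m = (\<Sum>(k, l)\<in>A. rho q (monom_pbw q k (F k)) (sing l (G l)) m)"
  unfolding tmul_def tmul_term
  by (rule Sum_any.expand_superset) (use assms in auto)

lemma rho_monom_zero: "rho q (monom_pbw q k 0) G = 0"
  using rho_cg[OF monom_0] by simp

lemma term_support:
  assumes "rho q (monom_pbw q k (F k)) (sing l (G l)) m \<noteq> 0"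
  shows "F k \<noteq> 0" "G l \<noteq> 0" "hm k \<le> hm m" "hp l \<le> hp m" "ht m = ht k + ht l"
proof -
  show "F k \<noteq> 0" using assms rho_monom_zero[of k] by (metis zero_fun_apply)
  obtain l' where l': "sing l (G l) l' \<noteq> 0" "hp l' \<le> hp m" "ht m = ht k + ht l'"
    using monom_support(2)[OF assms] by blast
  then have "l' = l" by (simp add: sing_apply split: if_splits)
  with l' show "G l \<noteq> 0" "hp l \<le> hp m" "ht m = ht k + ht l" by (simp_all add: sing_apply)
  show "hm k \<le> hm m" using monom_support(1)[OF assms] .
qed

text \<open>For a contributing pair, hm k <= hm m and |ht k| <= w bound hp k, while hp l <= hp m and
  |ht l| <= v bound hm l; so both indices lie in the boxes.\<close>

lemma tmul_cut:
  assumes "bdd w F" "bdd v G" and N: "hm m + hp m + w + v \<le> N" "hm m + hp m + w + v \<le> N'"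
  shows "tmul q F G m = rho q (hat q (cut N F)) (cut N' G) m"
proof -
  have "(k, l) \<in> box N \<times> box N'" if "rho q (monom_pbw q k (F k)) (sing l (G l)) m \<noteq> 0" for k l
    using term_support[where F = F and G = G, OF that] assms unfolding bdd_def box_def ht_def by fastforce
  then have "tmul q F G m = (\<Sum>(k, l)\<in>box N \<times> box N'. rho q (monom_pbw q k (F k)) (sing l (G l)) m)"
    by (intro tmul_superset) (auto simp: finite_box)
  also have "\<dots> = (\<Sum>k\<in>box N. \<Sum>l\<in>box N'. rho q (monom_pbw q k (F k)) (sing l (G l)) m)"
    by (simp add: sum.cartesian_product)
  also have "\<dots> = rho q (hat q (cut N F)) (cut N' G) m"
    unfolding rho_hat_cut cut_sum[of N' G] rho_sum_right sum_fun_apply by (rule sum.swap)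
  finally show ?thesis .
qed

lemma bdd_tmul:
  assumes "bdd w F" "bdd v G"
  shows "bdd (w + v) (tmul q F G)"
  unfolding bdd_def
proof (intro allI impI)
  fix m assume "tmul q F G m \<noteq> 0"
  then obtain k l where "rho q (monom_pbw q k (F k)) (sing l (G l)) m \<noteq> 0"
    unfolding tmul_def tmul_term using Sum_any.not_neutral_obtains_not_neutral by fastforce
  from term_support[where F = F and G = G, OF this] show "\<bar>ht m\<bar> \<le> int (w + v)"
    using assms unfolding bdd_def by fastforce
qed

lemma tmul_rho:
  assumes "bdd w F" "bdd v G" and N: "hm m + hp m + w + v \<le> N"
  shows "tmul q F G m = rho q (hat q (cut N F)) G m"
proof -
  obtain M where M: "\<forall>F'. (\<forall>k \<in> box M. F' k = 0) \<longrightarrow> rho q (hat q (cut N F)) F' m = 0"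
    using rho_local by blast
  define N' where "N' = max N M"
  have "rho q (hat q (cut N F)) (G - cut N' G) m = 0"
    by (rule M[rule_format]) (use box_mono[of M N'] in \<open>auto simp: cut_def N'_def\<close>)
  moreover have "rho q (hat q (cut N F)) G = rho q (hat q (cut N F)) (cut N' G) + rho q (hat q (cut N F)) (G - cut N' G)"
    by (simp flip: rho_plus del: plus_fun_apply)
  moreover have "tmul q F G m = rho q (hat q (cut N F)) (cut N' G) m"
    by (rule tmul_cut[OF assms(1,2)]) (use N in \<open>auto simp: N'_def\<close>)
  ultimately show ?thesis by simp
qed

lemma tmul_finite:
  assumes "finite {m. F m \<noteq> 0}" "bdd v G"
  shows "tmul q F G = rho q (hat q F) G"
proof
  fix m
  obtain w where w: "bdd w F" using bdd_finite[OF assms(1)] by blast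
  obtain M where M: "\<forall>N\<ge>M. cut N F = F" using finite_cut_eq[OF assms(1)] by blast
  show "tmul q F G m = rho q (hat q F) G m"
    using tmul_rho[OF w assms(2), of m "max M (hm m + hp m + w + v)"] M by simp
qed

lemma tmul_to_taylor:
  assumes "bdd v G"
  shows "tmul q (to_taylor q u) G = rho q u G"
  unfolding to_taylor_eq using tmul_finite[OF finite_rho_vac assms] rho_cg[OF hat_rho_vac] by simp

text \<open>A coefficient of a triple product depends only on truncations of the factors, and for
  finite series associativity is the homomorphism property of \<open>rho\<close>.\<close>

lemma tmul_assoc:
  assumes F: "bdd w F" and G: "bdd v G" and H: "bdd x H"
  shows "tmul q (tmul q F G) H = tmul q F (tmul q G H)"
proof
  fix m
  define N where "N = hm m + hp m + w + v + x"
  \<comment> \<open>An index in \<open>box N\<close> has hm + hp <= 2 N, so this cutoff determines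
    the inner products throughout \<open>box N\<close>.\<close>
  define N' where "N' = 2 * N + w + v + x"
  define F' where "F' = cut N' F"
  define G' where "G' = cut N' G"
  define H' where "H' = cut N' H"
  have "N \<le> N'" by (simp add: N'_def)
  have fin: "finite {m. F' m \<noteq> 0}" "finite {m. G' m \<noteq> 0}" "finite {m. H' m \<noteq> 0}"
    by (simp_all add: F'_def G'_def H'_def finite_cut)
  have bdd': "bdd w F'" "bdd v G'" "bdd x H'"
    using assms by (simp_all add: F'_def G'_def H'_def bdd_cut)
  have FG: "cut N (tmul q F G) = cut N (tmul q F' G')"
  proof
    fix k
    have "tmul q F G k = tmul q F' G' k" if "k \<in> box N"
    proof -
      have k: "hm k + hp k + w + v \<le> N'" using that by (auto simp: box_def N'_def)
      show ?thesis
        using tmul_cut[OF F G k k] tmul_cut[OF bdd'(1,2) k k] by (simp add: F'_def G'_def cut_cut)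
    qed
    then show "cut N (tmul q F G) k = cut N (tmul q F' G') k" by (simp add: cut_def)
  qed
  have GH: "cut N (tmul q G H) = cut N (tmul q G' H')"
  proof
    fix k
    have "tmul q G H k = tmul q G' H' k" if "k \<in> box N"
    proof -
      have k: "hm k + hp k + v + x \<le> N'" using that by (auto simp: box_def N'_def)
      show ?thesis
        using tmul_cut[OF G H k k] tmul_cut[OF bdd'(2,3) k k] by (simp add: G'_def H'_def cut_cut)
    qed
    then show "cut N (tmul q G H) k = cut N (tmul q G' H') k" by (simp add: cut_def)
  qed
  have m: "hm m + hp m + (w + v) + x \<le> N" "hm m + hp m + w + (v + x) \<le> N"
    by (simp_all add: N_def)
  have "tmul q (tmul q F G) H m = tmul q (tmul q F' G') H' m"
    using tmul_cut[OF bdd_tmul[OF F G] H m(1) m(1)] tmul_cut[OF bdd_tmul[OF bdd'(1,2)] bdd'(3) m(1) m(1)]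
    by (simp add: FG H'_def cut_cut \<open>N \<le> N'\<close>)
  also have "\<dots> = rho q (hat q F' * hat q G') H' m"
  proof -
    have "tmul q F' G' = rho q (hat q F' * hat q G') vac"
      using tmul_finite[OF fin(1) bdd'(2)] rho_hat[OF fin(2)] by (simp add: rho_mult)
    then show ?thesis
      using tmul_to_taylor[OF bdd'(3), of "hat q F' * hat q G'"] by (simp add: to_taylor_eq)
  qed
  also have "\<dots> = tmul q F' (tmul q G' H') m"
    using tmul_finite[OF fin(1) bdd_tmul[OF bdd'(2,3)]] tmul_finite[OF fin(2) bdd'(3)]
    by (simp add: rho_mult)
  also have "\<dots> = tmul q F (tmul q G H) m"
    using tmul_cut[OF F bdd_tmul[OF G H] m(2) m(2)] tmul_cut[OF bdd'(1) bdd_tmul[OF bdd'(2,3)] m(2) m(2)]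
    by (simp add: GH F'_def cut_cut \<open>N \<le> N'\<close>)
  finally show "tmul q (tmul q F G) H m = tmul q F (tmul q G H) m" .
qed

lemma bdd_plus: "bdd w F \<Longrightarrow> bdd w G \<Longrightarrow> bdd w (F + G)"
  unfolding bdd_def by (metis add.right_neutral plus_fun_apply)

lemma bdd_restrict: "bdd w F \<Longrightarrow> bdd w (\<lambda>m. if P m then F m else 0)"
  unfolding bdd_def by auto

lemma bdd_sing: "bdd w F \<Longrightarrow> bdd w (sing l (F l))"
  unfolding bdd_def sing_def by auto

lemma tmul_0_left [simp]: "tmul q 0 G = 0"
proof -
  have "tmul q 0 G m = 0" for m
    by (subst tmul_superset[where A = "{}"]) (simp_all add: rho_monom_zero)
  then show ?thesis by (simp add: fun_eq_iff)
qed

lemma tmul_0_right [simp]: "tmul q F 0 = 0"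
proof -
  have "tmul q F 0 m = 0" for m
    by (subst tmul_superset[where A = "{}"]) simp_all
  then show ?thesis by (simp add: fun_eq_iff)
qed

lemma tmul_plus_right:
  assumes "bdd w F" "bdd v G" "bdd v H"
  shows "tmul q F (G + H) = tmul q F G + tmul q F H"
proof
  fix m
  show "tmul q F (G + H) m = (tmul q F G + tmul q F H) m"
    using tmul_rho[OF assms(1) bdd_plus[OF assms(2,3)] order_refl] tmul_rho[OF assms(1,2) order_refl, of m]
      tmul_rho[OF assms(1,3) order_refl, of m]
    by (simp add: rho_plus)
qed

lemma tmul_sum_left:
  assumes "bdd w F" "bdd v G" "hm m + hp m + w + v \<le> N"
  shows "tmul q F G m = (\<Sum>k\<in>box N. rho q (monom_pbw q k (F k)) G m)"
  using tmul_rho[OF assms] by (simp add: rho_hat_cut sum_fun_apply)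

lemma tmul_plus_left:
  assumes "bdd w F" "bdd w G" "bdd v H"
  shows "tmul q (F + G) H = tmul q F H + tmul q G H"
proof
  fix m
  have "rho q (monom_pbw q k (F k + G k)) H m = rho q (monom_pbw q k (F k)) H m + rho q (monom_pbw q k (G k)) H m" for k
    using rho_cg[OF monom_add] rho_add by simp
  then show "tmul q (F + G) H m = (tmul q F H + tmul q G H) m"
    by (simp add: tmul_sum_left[OF bdd_plus[OF assms(1,2)] assms(3) order_refl]
        tmul_sum_left[OF assms(1,3) order_refl] tmul_sum_left[OF assms(2,3) order_refl] sum.distrib)
qed

lemma cut_sing: "cut N (sing l f) = (if l \<in> box N then sing l f else 0)"
  by (auto simp: cut_def sing_def fun_eq_iff)

lemma tmul_sum_right:
  assumes "bdd w F" "bdd v G" and N: "hm m + hp m + w + v \<le> N"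
  shows "tmul q F G m = (\<Sum>l\<in>box N. tmul q F (sing l (G l)) m)"
proof -
  have "tmul q F (sing l (G l)) m = rho q (hat q (cut N F)) (sing l (G l)) m" if "l \<in> box N" for l
    using tmul_cut[OF assms(1) bdd_sing[OF assms(2)] N N] that by (simp add: cut_sing)
  then show ?thesis
    using tmul_cut[OF assms(1,2) N N] by (simp add: cut_sum[of N G] rho_sum_right sum_fun_apply)
qed

lemma bdd_vac: "bdd w vac"
  by (auto simp: bdd_def sing_apply ht_def)

lemma tmul_vac:
  assumes "bdd w F"
  shows "tmul q F vac = F"
proof
  fix m
  define N where "N = hm m + hp m + w"
  have "m \<in> box N" by (simp add: box_def N_def)
  then show "tmul q F vac m = F m"
    using tmul_rho[OF assms bdd_vac[of 0], of m N] rho_hat[OF finite_cut[of N F]] by (simp add: N_def cut_def)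
qed

section \<open>Idempotents annihilated by raising operators\<close>

text \<open>On purely lowering or purely raising series the total height is additive. The constant
  term is an idempotent of a field, hence 0 or 1, and a nonzero entry of least positive height would
  satisfy x = 0 or x = x + x.\<close>

lemma idempotent_triangular:
  assumes bdd: "bdd w X"
    and P: "P = hp \<or> P = hm"
    and supp: "\<And>m. X m \<noteq> 0 \<Longrightarrow> P m = 0"
    and idem: "\<And>m. P m = 0 \<Longrightarrow> tmul q X X m = X m"
  shows "X = 0 \<or> X = vac"
proof -
  let ?o = "(0, 0, 0, 0, 0, 0) :: expo"
  let ?s = "\<lambda>m. hm m + hp m"
  have s_0: "k = ?o" if "?s k = 0" for k
    using that by (cases k) simp
  have o: "?s ?o = 0" "P ?o = 0" using P by auto
  have pair: "?s m = ?s k + ?s l" if "rho q (monom_pbw q k (X k)) (sing l (X l)) m \<noteq> 0" "P m = 0" for k l m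
    using term_support(1,2,5)[where F = X and G = X, OF that(1)] supp[of k] supp[of l] P that(2)
    by (auto simp: ht_def)
  have left: "rho q (monom_pbw q ?o f) G = Lop q (Car f) G" for f G
    by (simp add: rho_mult)
  have oo: "X ?o = 0 \<or> X ?o = 1"
  proof -
    have "tmul q X X ?o = (\<Sum>(k, l)\<in>{(?o, ?o)}. rho q (monom_pbw q k (X k)) (sing l (X l)) ?o)"
    proof (rule tmul_superset)
      fix k l assume "rho q (monom_pbw q k (X k)) (sing l (X l)) ?o \<noteq> 0"
      from pair[OF this o(2)] show "(k, l) \<in> {(?o, ?o)}" using s_0[of k] s_0[of l] by simp
    qed simp
    then have "X ?o * X ?o = X ?o"
      using idem[OF o(2)] by (simp add: left LC_apply sing_apply del: monom_pbw.simps)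
    then show ?thesis by (simp add: mult_cancel_right1)
  qed
  have rest: "X m = 0" if "m \<noteq> ?o" for m
    using that
  proof (induct "?s m" arbitrary: m rule: less_induct)
    case less
    show ?case
    proof (rule ccontr)
      assume Xm: "X m \<noteq> 0"
      then have Pm: "P m = 0" by (rule supp)
      have sub: "(k, l) \<in> {(?o, m), (m, ?o)}" if t: "rho q (monom_pbw q k (X k)) (sing l (X l)) m \<noteq> 0" for k l
      proof -
        note ts = term_support(1,2)[where F = X and G = X, OF t]
        have s: "?s m = ?s k + ?s l" by (rule pair[OF t Pm])
        have "k = ?o \<or> l = ?o"
          using less(1)[of k] less(1)[of l] ts s s_0[of k] s_0[of l] by fastforce
        then show ?thesis
        proof
          assume k: "k = ?o"
          then have "Lop q (Car (X ?o)) (sing l (X l)) m \<noteq> 0" using t by (simp only: left) simp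
          then have "l = m" by (cases m) (auto simp: LC_apply sing_apply split: if_splits)
          then show ?thesis using k by simp
        next
          assume l: "l = ?o"
          then have "X ?o = 1" using ts oo by auto
          then have "sing k (X k) m \<noteq> 0" using t l by (simp add: rho_monom)
          then have "k = m" by (auto simp: sing_apply split: if_splits)
          then show ?thesis using l by simp
        qed
      qed
      have "tmul q X X m = (\<Sum>(k, l)\<in>{(?o, m), (m, ?o)}. rho q (monom_pbw q k (X k)) (sing l (X l)) m)"
        by (rule tmul_superset) (use sub in auto)
      also have "\<dots> = rho q (monom_pbw q ?o (X ?o)) (sing m (X m)) m + rho q (monom_pbw q m (X m)) (sing ?o (X ?o)) m"
        using less(2) by simp
      also have "\<dots> = (if X ?o = 1 then X m + X m else 0)"
        using oo by (auto simp: left rho_monom sing_apply simp del: monom_pbw.simps)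
      finally have "X m = (if X ?o = 1 then X m + X m else 0)" using idem[OF Pm] by simp
      then have "X m = X m + X m" using Xm by (metis (full_types))
      then show False using Xm by (metis add_cancel_right_right)
    qed
  qed
  show ?thesis
  proof (cases "X ?o = 0")
    case True
    then have "X m = 0" for m using rest by (cases "m = ?o") auto
    then show ?thesis by (simp add: fun_eq_iff)
  next
    case False
    then have "X m = vac m" for m using oo rest by (cases "m = ?o") (auto simp: sing_apply)
    then show ?thesis by (simp add: fun_eq_iff)
  qed
qed

text \<open>Terms of the left factor containing raising factors annihilate F, so its lowering part y
  satisfies y F = F. At indices without raising factors y F agrees with y y, so y is a nonzero
  triangular idempotent and equals 1. The raising part x is treated symmetrically through F x =
  F.\<close>

lemma idempotent_form:
  assumes bdd: "bdd w F" and idem: "tmul q F F = F" and ne: "F \<noteq> 0"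
    and left: "\<And>k. F k \<noteq> 0 \<Longrightarrow> hp k \<noteq> 0 \<Longrightarrow> rho q (monom_pbw q k (F k)) F = 0"
    and right: "\<And>l. F l \<noteq> 0 \<Longrightarrow> hm l \<noteq> 0 \<Longrightarrow> tmul q F (sing l (F l)) = 0"
    and m: "hp m = 0 \<or> hm m = 0"
  shows "F m = vac m"
proof -
  define y where "y = (\<lambda>m. if hp m = 0 then F m else 0)"
  define x where "x = (\<lambda>m. if hm m = 0 then F m else 0)"
  have bxy: "bdd w x" "bdd w y" unfolding x_def y_def by (intro bdd_restrict bdd)+
  have y: "tmul q y F = F"
  proof
    fix m
    have "rho q (monom_pbw q k (y k)) F = rho q (monom_pbw q k (F k)) F" for k
      using left[of k] by (cases "F k = 0") (auto simp: y_def rho_monom_zero)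
    then have "tmul q y F m = tmul q F F m"
      by (simp add: tmul_sum_left[OF bdd bdd order_refl] tmul_sum_left[OF bxy(2) bdd order_refl])
    then show "tmul q y F m = F m" by (simp add: idem)
  qed
  have x: "tmul q F x = F"
  proof
    fix m
    have "tmul q F (sing k (x k)) = tmul q F (sing k (F k))" for k
      using right[of k] by (cases "F k = 0") (auto simp: x_def)
    then have "tmul q F x m = tmul q F F m"
      by (simp add: tmul_sum_right[OF bdd bdd order_refl] tmul_sum_right[OF bdd bxy(1) order_refl])
    then show "tmul q F x m = F m" by (simp add: idem)
  qed
  have "y = 0 \<or> y = vac"
  proof (rule idempotent_triangular[OF bxy(2), of hp])
    fix m assume "hp m = 0"
    have "rho q (monom_pbw q k (y k)) (sing l (y l)) m = rho q (monom_pbw q k (y k)) (sing l (F l)) m" for k l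
    proof (cases "hp l = 0")
      case False
      then have "rho q (monom_pbw q k (y k)) (sing l (F l)) m = 0"
        using term_support(4)[where F = y and G = F and m = m and k = k and l = l] \<open>hp m = 0\<close> by fastforce
      then show ?thesis using False by (simp add: y_def)
    qed (simp add: y_def)
    then have "tmul q y y m = tmul q y F m" unfolding tmul_def tmul_term by simp
    then show "tmul q y y m = y m" using y \<open>hp m = 0\<close> by (simp add: y_def)
  qed (auto simp: y_def split: if_splits)
  moreover have "y \<noteq> 0" using y ne by auto
  ultimately have "y = vac" by blast
  have "x = 0 \<or> x = vac"
  proof (rule idempotent_triangular[OF bxy(1), of hm])
    fix m assume "hm m = 0"
    have "rho q (monom_pbw q k (x k)) (sing l (x l)) m = rho q (monom_pbw q k (F k)) (sing l (x l)) m" for k l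
    proof (cases "hm k = 0")
      case False
      then have "rho q (monom_pbw q k (F k)) (sing l (x l)) m = 0"
        using term_support(3)[where F = F and G = x and m = m and k = k and l = l] \<open>hm m = 0\<close> by fastforce
      then show ?thesis using False by (simp add: x_def rho_monom_zero)
    qed (simp add: x_def)
    then have "tmul q x x m = tmul q F x m" unfolding tmul_def tmul_term by simp
    then show "tmul q x x m = x m" using x \<open>hm m = 0\<close> by (simp add: x_def)
  qed (auto simp: x_def split: if_splits)
  moreover have "x \<noteq> 0" using x ne by auto
  ultimately have "x = vac" by blast
  show ?thesis
    using m fun_cong[OF \<open>x = vac\<close>, of m] fun_cong[OF \<open>y = vac\<close>, of m] by (auto simp: x_def y_def)
qed

lemma rho_power_0: "rho q u F = 0 \<Longrightarrow> n > 0 \<Longrightarrow> rho q (u ^ n) F = 0"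
  by (cases n) (simp_all add: power_Suc2 rho_mult del: power_Suc zero_fun_apply)

text \<open>The rightmost nontrivial raising factor is the one that meets F.\<close>

lemma monom_annihilates:
  assumes "b3 > 0 \<and> rho q e23 F = 0 \<or> b2 > 0 \<and> b3 = 0 \<and> rho q (e13 q) F = 0
    \<or> b1 > 0 \<and> b2 = 0 \<and> b3 = 0 \<and> rho q e12 F = 0"
  shows "rho q (monom_pbw q (a1, a2, a3, b1, b2, b3) f) F = 0"
  using assms by (auto simp: rho_mult rho_power_0 simp del: rho_gn)

lemma finite_sing: "finite {k. sing m f k \<noteq> 0}"
  by (rule finite_subset[of _ "{m}"]) (auto simp: sing_apply)

text \<open>The monomial has u as its leftmost factor, so associativity brings u next to F.\<close>

lemma tmul_annihilates:
  assumes "bdd w F" "tmul q F (to_taylor q u) = 0" "sing l f = rho q u (sing l' f)"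
  shows "tmul q F (sing l f) = 0"
proof -
  obtain v where v: "bdd v (sing l' f)" using bdd_finite[OF finite_sing] by blast
  obtain x where x: "bdd x (to_taylor q u)" using bdd_finite[OF finite_rho_vac] by (metis to_taylor_eq)
  have "tmul q F (sing l f) = tmul q F (tmul q (to_taylor q u) (sing l' f))"
    using assms(3) tmul_to_taylor[OF v] by simp
  then show ?thesis using tmul_assoc[OF assms(1) x v] assms(2) by simp
qed

lemma zero_series: "(\<lambda>_. 0) = (0 :: series)"
  by (simp add: fun_eq_iff)

lemma projector_form:
  assumes p: "extremal_projector q p" and m: "hp m = 0 \<or> hm m = 0"
  shows "p m = vac m"
proof -
  obtain w where w: "bdd w p" using p taylor_bdd by (auto simp: extremal_projector_def)
  have ann: "rho q e12 p = 0" "rho q e23 p = 0" "rho q (e13 q) p = 0"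
    using p tmul_to_taylor[OF w] by (auto simp: extremal_projector_def zero_series simp del: rho_gn)
  have ann': "tmul q p (to_taylor q e21) = 0" "tmul q p (to_taylor q e32) = 0" "tmul q p (to_taylor q (e31 q)) = 0"
    using p by (auto simp: extremal_projector_def zero_series)
  show ?thesis
  proof (rule idempotent_form[OF w _ _ _ _ m])
    show "tmul q p p = p" "p \<noteq> 0" using p by (auto simp: extremal_projector_def zero_series)
    show "rho q (monom_pbw q k (p k)) p = 0" if k: "hp k \<noteq> 0" for k
    proof (cases k)
      case (fields a1 a2 a3 b1 b2 b3)
      show ?thesis unfolding fields using k[unfolded fields] ann by (intro monom_annihilates) auto
    qed
    show "tmul q p (sing l (p l)) = 0" if l: "hm l \<noteq> 0" for l
    proof (cases l)
      case (fields a1 a2 a3 b1 b2 b3)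
      consider "a1 > 0" | "a1 = 0" "a2 > 0" | "a1 = 0" "a2 = 0" "a3 > 0" using l fields by fastforce
      then show ?thesis
      proof cases
        case 1
        then show ?thesis
          by (intro tmul_annihilates[OF w ann'(1), of _ _ "(a1 - 1, a2, a3, b1, b2, b3)"]) (simp add: fields Neg_sing)
      next
        case 2
        then show ?thesis
          by (intro tmul_annihilates[OF w ann'(3), of _ _ "(0, a2 - 1, a3, b1, b2, b3)"]) (simp add: fields Neg_sing rho_e31)
      next
        case 3
        then show ?thesis
          by (intro tmul_annihilates[OF w ann'(2), of _ _ "(0, 0, a3 - 1, b1, b2, b3)"]) (simp add: fields Neg_sing)
      qed
    qed
  qed
qed

lemma projector_T_form:
  assumes p: "extremal_projector_T q p" and m: "hp m = 0 \<or> hm m = 0"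
  shows "p m = vac m"
proof -
  have supp: "\<exists>a b. m = (0, 0, a, 0, 0, b)" if "p m \<noteq> 0" for m
    using p that by (auto simp: extremal_projector_T_def taylor_T_def)
  have "p \<in> taylor" using p by (simp add: extremal_projector_T_def taylor_T_def)
  then obtain w where w: "bdd w p" using taylor_bdd by blast
  have ann: "rho q e23 p = 0"
    using p tmul_to_taylor[OF w] by (auto simp: extremal_projector_T_def zero_series simp del: rho_gn)
  have ann': "tmul q p (to_taylor q e32) = 0"
    using p by (auto simp: extremal_projector_T_def zero_series)
  show ?thesis
  proof (rule idempotent_form[OF w _ _ _ _ m])
    show "tmul q p p = p" "p \<noteq> 0" using p by (auto simp: extremal_projector_T_def zero_series)
    show "rho q (monom_pbw q k (p k)) p = 0" if k: "p k \<noteq> 0" "hp k \<noteq> 0" for k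
    proof -
      obtain a b where "k = (0, 0, a, 0, 0, b)" using supp[OF k(1)] by blast
      then show ?thesis using monom_annihilates[of b p 0 0 0 0 a "p k"] k ann by (simp del: monom_pbw.simps)
    qed
    show "tmul q p (sing l (p l)) = 0" if l: "p l \<noteq> 0" "hm l \<noteq> 0" for l
    proof -
      obtain a b where "l = (0, 0, a, 0, 0, b)" using supp[OF l(1)] by blast
      then show ?thesis using l
        by (intro tmul_annihilates[OF w ann', of _ _ "(0, 0, a - 1, 0, 0, b)"]) (simp add: Neg_sing)
    qed
  qed
qed

end


section \<open>The projector of the subalgebra acting as a unit\<close>

context qparam begin

text \<open>Apart from the constant term 1, every term starts with \<open>e32\<close> and ends in
  \<open>e23\<close>. Hence \<open>pT\<close> fixes, on the appropriate side, whatever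
  \<open>e23\<close> or \<open>e32\<close> annihilates.\<close>

lemma projector_T_support:
  assumes "extremal_projector_T q pT" "pT k \<noteq> 0" "k \<noteq> (0, 0, 0, 0, 0, 0)"
  shows "\<exists>a b. k = (0, 0, a, 0, 0, b) \<and> a > 0 \<and> b > 0"
proof -
  obtain a b where k: "k = (0, 0, a, 0, 0, b)"
    using assms(1,2) by (auto simp: extremal_projector_T_def taylor_T_def)
  have "vac k \<noteq> pT k" using assms(2,3) by (simp add: sing_apply)
  then have "\<not> (hp k = 0 \<or> hm k = 0)" using projector_T_form[OF assms(1), of k] by metis
  then show ?thesis using k by auto
qed

lemma projector_T_0: "extremal_projector_T q pT \<Longrightarrow> pT (0, 0, 0, 0, 0, 0) = 1"
  using projector_T_form[of pT "(0, 0, 0, 0, 0, 0)"] by (simp add: sing_apply)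

lemma bdd_projector_T: "extremal_projector_T q pT \<Longrightarrow> \<exists>w. bdd w pT"
  using taylor_bdd by (simp add: extremal_projector_T_def taylor_T_def)

lemma projector_T_absorb_left:
  assumes pT: "extremal_projector_T q pT" and G: "bdd w G" "Lop q (Pos N2) G = 0"
  shows "tmul q pT G = G"
proof
  fix m
  let ?o = "(0, 0, 0, 0, 0, 0) :: expo"
  obtain v where v: "bdd v pT" using bdd_projector_T[OF pT] by blast
  define N where "N = hm m + hp m + v + w"
  have other: "rho q (monom_pbw q k (pT k)) G m = 0" if k_ne: "k \<noteq> ?o" for k
  proof (cases "pT k = 0")
    case False
    obtain a b where "k = (0, 0, a, 0, 0, b)" "b > 0"
      using projector_T_support[OF pT False k_ne] by blast
    then show ?thesis using monom_annihilates[of b G 0 0 0 0 a "pT k"] G(2) by (simp del: monom_pbw.simps)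
  qed (simp add: rho_monom_zero)
  have "tmul q pT G m = (\<Sum>k\<in>box N. rho q (monom_pbw q k (pT k)) G m)"
    using tmul_sum_left[OF v G(1)] by (simp add: N_def)
  also have "\<dots> = (\<Sum>k\<in>{?o}. rho q (monom_pbw q k (pT k)) G m)"
    by (rule sum.mono_neutral_right) (use other finite_box in \<open>auto simp: box_def\<close>)
  also have "\<dots> = G m" using projector_T_0[OF pT] by simp
  finally show "tmul q pT G m = G m" .
qed

lemma projector_T_absorb_right:
  assumes pT: "extremal_projector_T q pT" and G: "bdd w G" "tmul q G (to_taylor q e32) = 0"
  shows "tmul q G pT = G"
proof
  fix m
  let ?o = "(0, 0, 0, 0, 0, 0) :: expo"
  obtain v where v: "bdd v pT" using bdd_projector_T[OF pT] by blast
  define N where "N = hm m + hp m + w + v"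
  have other: "tmul q G (sing l (pT l)) m = 0" if k_ne: "l \<noteq> ?o" for l
  proof (cases "pT l = 0")
    case False
    obtain a b where l: "l = (0, 0, a, 0, 0, b)" "a > 0"
      using projector_T_support[OF pT False k_ne] by blast
    have "tmul q G (sing l (pT l)) = 0"
      by (rule tmul_annihilates[OF G, of _ _ "(0, 0, a - 1, 0, 0, b)"]) (use l in \<open>simp add: Neg_sing\<close>)
    then show ?thesis by simp
  qed simp
  have "tmul q G pT m = (\<Sum>l\<in>box N. tmul q G (sing l (pT l)) m)"
    using tmul_sum_right[OF G(1) v] by (simp add: N_def)
  also have "\<dots> = (\<Sum>l\<in>{?o}. tmul q G (sing l (pT l)) m)"
    by (rule sum.mono_neutral_right) (use other finite_box in \<open>auto simp: box_def\<close>)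
  also have "\<dots> = G m" using projector_T_0[OF pT] tmul_vac[OF G(1)] by simp
  finally show "tmul q G pT m = G m" .
qed

section \<open>Reduction modulo left multiples of \<open>e\<^sub>3\<^sub>2\<close> and right multiples of \<open>e\<^sub>2\<^sub>3\<close>\<close>

text \<open>
  \<open>redG F\<close> is the solution \<open>G\<close> of the triangular system expressing that \<open>F - e\<^sub>3\<^sub>2 G\<close> has no monomials
  with \<open>a\<^sub>3 > 0\<close> and \<open>b\<^sub>3 = 0\<close>.
\<close>

fun redg :: "series \<Rightarrow> nat \<Rightarrow> nat \<Rightarrow> nat \<Rightarrow> nat \<times> nat \<times> nat \<Rightarrow> cartan" where
  "redg F 0 a c B = Qp q (int a) * F (a, 0, Suc c, B)"
| "redg F (Suc b) a c B = Qp q (int a - int b - 1) * (F (a, Suc b, Suc c, B) - qn q (int a + 1) * redg F b (Suc a) (Suc c) B)"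

definition redG :: "series \<Rightarrow> series" where
  "redG F = (\<lambda>(a, b, c, b1, b2, b3). if b3 = 0 then redg F b a c (b1, b2, 0) else 0)"

definition Phi :: "series \<Rightarrow> series" where
  "Phi F = (\<lambda>(a, b, c, b1, b2, b3).
     if c = 0 \<and> b3 = 0 then (F - Lop q (Neg N2) (redG F)) (a, b, c, b1, b2, b3) else 0)"

definition right_part :: "series \<Rightarrow> series" where
  "right_part F = (\<lambda>(a, b, c, b1, b2, b3). if b3 = 0 then 0 else F (a, b, c, b1, b2, b3))"

text \<open>At c > 0 and b3 = 0 the required equation reads F(a,b,c) = q^(b-a) G(a,b,c-1) + [a+1]
  G(a+1,b-1,c); the second unknown has smaller b, and \<open>redg\<close> solves for the
  first.\<close>

lemma decompose: "F = Phi F + Lop q (Neg N2) (redG F) + right_part F"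
proof
  fix m :: expo
  obtain a b c b1 b2 b3 where m: "m = (a, b, c, b1, b2, b3)" by (metis prod_cases6)
  show "F m = (Phi F + Lop q (Neg N2) (redG F) + right_part F) m"
  proof (cases "b3 = 0 \<and> c > 0")
    case True
    then obtain c' where c': "c = Suc c'" by (cases c) auto
    have 1: "Qp q (int x - int y) * (Qp q (int y - int x) * z) = z" for x y z
      by (simp add: Qp_diff)
    have 2: "Qp q (1 + int x - int y) * (Qp q (int y - int x - 1) * z) = z" for x y z
      by (simp add: Qp_diff Qp_add)
    show ?thesis using True
      by (cases b) (auto simp: m c' Phi_def right_part_def redG_def Neg_apply 1 2 Qp_minus)
  qed (auto simp: m Phi_def right_part_def redG_def Neg_apply)
qed

lemma redg_plus: "redg (F + G) b a c B = redg F b a c B + redg G b a c B"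
  by (induct b arbitrary: a c) (simp_all add: algebra_simps)

lemma Phi_plus: "Phi (F + G) = Phi F + Phi G"
proof -
  have *: "redG (F + G) = redG F + redG G" by (auto simp: redG_def redg_plus fun_eq_iff)
  show ?thesis unfolding Phi_def * Lop_plus by (auto simp: fun_eq_iff)
qed

lemma Phi_L32: "Phi (Lop q (Neg N2) G) = 0"
proof -
  have "redg (Lop q (Neg N2) G) b a c B = G (a, b, c, B)" for b a c B
  proof (induct b arbitrary: a c)
    case 0
    show ?case by (simp add: Neg_apply Qp_minus)
  next
    case (Suc b)
    then show ?case by (simp add: Neg_apply Qp_diff Qp_add algebra_simps)
  qed
  then have "redG (Lop q (Neg N2) G) (a, b, c, b1, b2, 0) = G (a, b, c, b1, b2, 0)" for a b c b1 b2
    by (simp add: redG_def)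
  then show ?thesis by (auto simp: Phi_def Neg_apply fun_eq_iff)
qed

lemma Phi_right:
  assumes "\<And>a b c b1 b2. H (a, b, c, b1, b2, 0) = 0"
  shows "Phi H = 0"
proof -
  have "redg H b a c (b1, b2, 0) = 0" for b a c b1 b2
    by (induct b arbitrary: a c) (simp_all add: assms)
  then show ?thesis using assms by (auto simp: Phi_def Neg_apply fun_eq_iff redG_def)
qed

text \<open>When no entry has third exponent above 1, the recursion for \<open>redg\<close> stops
  after one step. The operators applied to reduced series below produce such series.\<close>

lemma Phi_low:
  assumes "\<And>a b c B. F (a, b, Suc (Suc c), B) = 0"
  shows "Phi F (a, b, 0, b1, b2, 0) = F (a, b, 0, b1, b2, 0)
    - (if b = 0 then 0 else qn q (int a + 1) * Qp q (int a + 2 - int b) * F (Suc a, b - 1, 1, b1, b2, 0))"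
proof -
  have 0: "redg F b a (Suc c) B = 0" for b a c B
    by (induct b arbitrary: a c) (simp_all add: assms)
  show ?thesis
  proof (cases b)
    case (Suc b')
    then show ?thesis by (cases b') (simp_all add: Phi_def Neg_apply redG_def 0 algebra_simps)
  qed (simp add: Phi_def Neg_apply redG_def)
qed

lemma Phi_eqI:
  assumes "\<And>a b b1 b2. F (a, b, 0, b1, b2, 0) = s (a, b, b1, b2)" "\<And>a b c b1 b2. F (a, b, Suc c, b1, b2, 0) = 0"
  shows "Phi F = (\<lambda>(a, b, c, b1, b2, b3). if c = 0 \<and> b3 = 0 then s (a, b, b1, b2) else 0)"
proof -
  have "redg F b a c (b1, b2, 0) = 0" for b a c b1 b2
    by (induct b arbitrary: a c) (simp_all add: assms)
  then show ?thesis using assms by (auto simp: Phi_def Neg_apply fun_eq_iff redG_def)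
qed

lemma bdd_redG: "bdd w F \<Longrightarrow> bdd (Suc w) (redG F)"
proof -
  assume F: "bdd w F"
  have "\<exists>k. F k \<noteq> 0 \<and> ht k = ht (a, b, c, B) - 1" if "redg F b a c B \<noteq> 0" for a b c B
    using that
  proof (induct b arbitrary: a c)
    case 0
    then show ?case by (intro exI[of _ "(a, 0, Suc c, B)"]) (cases B, simp add: ht_def)
  next
    case (Suc b)
    then have "F (a, Suc b, Suc c, B) \<noteq> 0 \<or> redg F b (Suc a) (Suc c) B \<noteq> 0" by auto
    then show ?case
    proof
      assume "F (a, Suc b, Suc c, B) \<noteq> 0"
      then show ?thesis by (intro exI[of _ "(a, Suc b, Suc c, B)"]) (cases B, simp add: ht_def)
    next
      assume "redg F b (Suc a) (Suc c) B \<noteq> 0"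
      from Suc(1)[OF this] show ?thesis by (cases B) (simp add: ht_def)
    qed
  qed
  then have *: "\<exists>k. F k \<noteq> 0 \<and> ht k = ht m - 1" if "redG F m \<noteq> 0" for m
    using that by (cases m) (auto simp: redG_def split: if_splits)
  show ?thesis unfolding bdd_def
  proof (intro allI impI)
    fix m assume "redG F m \<noteq> 0"
    then obtain k where "F k \<noteq> 0" "ht k = ht m - 1" using * by blast
    then show "\<bar>ht m\<bar> \<le> int (Suc w)" using F unfolding bdd_def by fastforce
  qed
qed

lemma bdd_Lop: "bdd w F \<Longrightarrow> bdd (Suc w) (Lop q g F)"
  unfolding bdd_def
proof (intro allI impI)
  fix m assume F: "\<forall>m. F m \<noteq> 0 \<longrightarrow> \<bar>ht m\<bar> \<le> int w" and "Lop q g F m \<noteq> 0"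
  then obtain k where "F k \<noteq> 0" "ht m = ht k + dg g" using Lop_support by blast
  moreover have "\<bar>dg g\<bar> \<le> 1" by (cases g) simp_all
  ultimately show "\<bar>ht m\<bar> \<le> int (Suc w)" using F by fastforce
qed

lemma monom_mult_e23: "rho q (monom_pbw q (a, b, c, b1, b2, b3) f) (Lop q (Pos N2) vac) = sing (a, b, c, b1, b2, Suc b3) f"
proof -
  have "rho q (monom_pbw q (a, b, c, b1, b2, b3) f) (Lop q (Pos N2) vac) = rho q (monom_pbw q (a, b, c, b1, b2, Suc b3) f) vac"
    by (simp add: rho_mult power_Suc2 del: power_Suc)
  then show ?thesis by (simp only: rho_monom)
qed

text \<open>\<open>H\<close> strips the last \<open>e23\<close> from each monomial, which changes
  the height by one.\<close>

lemma right_part_factor: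
  assumes "bdd w F"
  shows "\<exists>w' H. bdd w' H \<and> right_part F = tmul q H (to_taylor q e23)"
proof -
  define H :: series where "H = (\<lambda>(a, b, c, b1, b2, b3). F (a, b, c, b1, b2, Suc b3))"
  have H: "bdd (Suc w) H"
    unfolding bdd_def
  proof (intro allI impI)
    fix m assume "H m \<noteq> 0"
    then obtain a b c b1 b2 b3 where m: "m = (a, b, c, b1, b2, b3)" "F (a, b, c, b1, b2, Suc b3) \<noteq> 0"
      by (cases m) (auto simp: H_def)
    then have "\<bar>ht (a, b, c, b1, b2, Suc b3)\<bar> \<le> int w" using assms unfolding bdd_def by blast
    then show "\<bar>ht m\<bar> \<le> int (Suc w)" by (simp add: m ht_def)
  qed
  define up :: "expo \<Rightarrow> expo" where "up = (\<lambda>(a, b, c, b1, b2, b3). (a, b, c, b1, b2, Suc b3))"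
  have v: "bdd 1 (Lop q (Pos N2) vac)" using bdd_Lop[OF bdd_vac[of 0]] by simp
  have "right_part F m = tmul q H (Lop q (Pos N2) vac) m" for m
  proof -
    obtain a b c b1 b2 b3 where m: "m = (a, b, c, b1, b2, b3)" by (metis prod_cases6)
    define N where "N = hm m + hp m + Suc w + 1"
    have "rho q (monom_pbw q k (H k)) (Lop q (Pos N2) vac) = sing (up k) (H k)" for k
      by (cases k) (simp add: up_def monom_mult_e23 del: monom_pbw.simps)
    then have "tmul q H (Lop q (Pos N2) vac) m = (\<Sum>k\<in>box N. sing (up k) (H k) m)"
      using tmul_sum_left[OF H v, of m N] by (simp add: N_def)
    also have "\<dots> = right_part F m"
    proof (cases b3)
      case 0
      have "up k \<noteq> m" for k by (cases k) (simp add: m up_def 0)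
      then have "sing (up k) (H k) m = 0" for k using not_sym by (fastforce simp: sing_apply)
      then have "(\<Sum>k\<in>box N. sing (up k) (H k) m) = 0" by (simp only: sum.neutral_const)
      then show ?thesis by (simp add: m right_part_def 0)
    next
      case (Suc d)
      let ?k = "(a, b, c, b1, b2, d)"
      have "(\<Sum>k\<in>box N. sing (up k) (H k) m) = (\<Sum>k\<in>{?k}. sing (up k) (H k) m)"
        by (rule sum.mono_neutral_right[OF finite_box]) (auto simp: box_def N_def m Suc sing_apply up_def)
      then show ?thesis by (simp add: m right_part_def Suc sing_apply up_def H_def)
    qed
    finally show ?thesis by simp
  qed
  then have "right_part F = tmul q H (to_taylor q e23)" by (simp add: fun_eq_iff to_taylor_eq)
  then show ?thesis using H by blast
qed

lemma bdd_right_part: "bdd w F \<Longrightarrow> bdd w (right_part F)"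
  by (auto simp: bdd_def right_part_def split: if_splits)

lemma bdd_uminus: "bdd w F \<Longrightarrow> bdd w (- F)"
  by (simp add: bdd_def)

lemma bdd_Phi: "bdd w F \<Longrightarrow> bdd (Suc (Suc w)) (Phi F)"
proof -
  assume F: "bdd w F"
  have Phi: "Phi F = F + - Lop q (Neg N2) (redG F) + - right_part F"
    using decompose[of F] by (simp add: algebra_simps del: plus_fun_apply minus_apply uminus_apply)
  show ?thesis unfolding Phi
    by (intro bdd_plus bdd_mono[OF F] bdd_mono[OF bdd_uminus[OF bdd_right_part[OF F]]]
        bdd_uminus[OF bdd_Lop[OF bdd_redG[OF F]]]) simp_all
qed

lemma sandwich_Phi:
  assumes pT: "extremal_projector_T q pT" and F: "bdd w F"
  shows "tmul q (tmul q pT F) pT = tmul q (tmul q pT (Phi F)) pT"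
proof -
  obtain v where v: "bdd v pT" using bdd_projector_T[OF pT] by blast
  have e32: "tmul q pT (to_taylor q e32) = 0"
    using pT by (simp add: extremal_projector_T_def zero_series)
  have e23: "tmul q (to_taylor q e23) pT = 0"
    using pT by (simp add: extremal_projector_T_def zero_series)
  obtain x where x: "bdd x (to_taylor q e32)" using bdd_finite[OF finite_rho_vac] by (metis to_taylor_eq)
  obtain y where y: "bdd y (to_taylor q e23)" using bdd_finite[OF finite_rho_vac] by (metis to_taylor_eq)
  note G = bdd_redG[OF F]
  have "tmul q pT (Lop q (Neg N2) (redG F)) = tmul q pT (tmul q (to_taylor q e32) (redG F))"
    using tmul_to_taylor[OF G, of e32] by simp
  then have 1: "tmul q pT (Lop q (Neg N2) (redG F)) = 0"
    using tmul_assoc[OF v x G] e32 by simp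
  obtain w' H where H: "bdd w' H" "right_part F = tmul q H (to_taylor q e23)"
    using right_part_factor[OF F] by blast
  have "tmul q (tmul q pT (right_part F)) pT = tmul q (tmul q pT H) (tmul q (to_taylor q e23) pT)"
    unfolding H(2) using tmul_assoc[OF v H(1) y] tmul_assoc[OF bdd_tmul[OF v H(1)] y v] by simp
  then have 2: "tmul q (tmul q pT (right_part F)) pT = 0" by (simp add: e23)
  let ?w = "Suc (Suc w)"
  have b: "bdd ?w (Phi F)" "bdd ?w (Lop q (Neg N2) (redG F))" "bdd ?w (right_part F)"
    using bdd_Phi[OF F] bdd_Lop[OF G] bdd_mono[OF bdd_right_part[OF F]] by simp_all
  have "tmul q pT F = tmul q pT (Phi F) + tmul q pT (Lop q (Neg N2) (redG F)) + tmul q pT (right_part F)"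
    by (subst decompose) (simp only: tmul_plus_right[OF v bdd_plus[OF b(1,2)] b(3)] tmul_plus_right[OF v b(1,2)])
  also have "\<dots> = tmul q pT (Phi F) + tmul q pT (right_part F)" by (simp only: 1 add_0_right)
  finally show ?thesis
    by (simp only: tmul_plus_left[OF bdd_tmul[OF v b(1)] bdd_tmul[OF v b(3)] v] 2 add_0_right)
qed

end


section \<open>The recursion for the reduced projector\<close>

context qparam begin

definition reduced :: "series \<Rightarrow> bool" where
  "reduced s \<longleftrightarrow> (\<forall>a b c b1 b2 b3. c \<noteq> 0 \<or> b3 \<noteq> 0 \<longrightarrow> s (a, b, c, b1, b2, b3) = 0)"

definition ends_in_e23 :: "series \<Rightarrow> bool" where
  "ends_in_e23 H \<longleftrightarrow> (\<forall>a b c b1 b2. H (a, b, c, b1, b2, 0) = 0)"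

lemma reduced_Phi: "reduced (Phi F)"
  by (auto simp: reduced_def Phi_def)

text \<open>Such a T descends to classes modulo both kinds of multiples. As F and its reduced series
  lie in one class, T F = 0 passes to the latter.\<close>

lemma Phi_stable:
  assumes T_plus: "\<And>F G. T (F + G) = T F + T G"
    and T_L32: "\<And>G. \<exists>G'. T (Lop q (Neg N2) G) = Lop q (Neg N2) G'"
    and T_right: "\<And>H. ends_in_e23 H \<Longrightarrow> ends_in_e23 (T H)"
    and T_F: "T F = 0"
  shows "Phi (T (Phi F)) = 0"
proof -
  have r: "ends_in_e23 (right_part F)" by (simp add: ends_in_e23_def right_part_def)
  obtain G' where G': "T (Lop q (Neg N2) (redG F)) = Lop q (Neg N2) G'" using T_L32 by blast
  have "T F = T (Phi F) + Lop q (Neg N2) G' + T (right_part F)"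
    by (subst decompose) (simp only: T_plus G')
  then have "Phi (T F) = Phi (T (Phi F)) + Phi (Lop q (Neg N2) G') + Phi (T (right_part F))"
    by (simp only: Phi_plus)
  moreover have "Phi (T (right_part F)) = 0"
    by (rule Phi_right) (use T_right[OF r] in \<open>simp add: ends_in_e23_def\<close>)
  moreover have "Phi (T F) = 0" unfolding T_F by (rule Phi_right) simp
  ultimately show ?thesis by (simp only: Phi_L32 add_0_right)
qed

lemma ends_in_e23_Lop: "ends_in_e23 H \<Longrightarrow> ends_in_e23 (Lop q g H)"
  by (cases g rule: gen_cases) (auto simp: ends_in_e23_def Pos_apply Neg_apply LC_apply)

lemma ends_in_e23_diff: "ends_in_e23 H \<Longrightarrow> ends_in_e23 H' \<Longrightarrow> ends_in_e23 (H - H')"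
  by (simp add: ends_in_e23_def)

text \<open>Multiplication by \<open>e12\<close> descends to classes because \<open>e12\<close>
  commutes with \<open>e32\<close>.\<close>

lemma e12_recursion:
  assumes "Lop q (Pos N1) F = 0"
  shows "qn q (int a + 1) * Qp q (- int b) * qnumH q 1 0 (- int a) * Phi F (Suc a, b, 0, b1, b2, 0)
    + (if b1 = 0 then 0 else tau q (- 2) 1 (Phi F (a, b, 0, b1 - 1, b2, 0))) = 0"
proof -
  define s where "s = Phi F"
  have s: "s (x, y, Suc z, B) = 0" for x y z B using reduced_Phi[of F] by (cases B) (simp add: s_def reduced_def)
  have "Phi (Lop q (Pos N1) s) = 0" unfolding s_def
    by (rule Phi_stable[where T = "Lop q (Pos N1)"])
      (auto simp: assms Lop_plus L12_L32 ends_in_e23_Lop simp del: plus_fun_apply)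
  then have "0 = Phi (Lop q (Pos N1) s) (a, b, 0, b1, b2, 0)" by simp
  also have "\<dots> = Lop q (Pos N1) s (a, b, 0, b1, b2, 0)
    - (if b = 0 then 0 else qn q (int a + 1) * Qp q (int a + 2 - int b) * Lop q (Pos N1) s (Suc a, b - 1, 1, b1, b2, 0))"
    by (rule Phi_low) (auto simp: Pos_apply s prod_eq_iff split_paired_all)
  also have "\<dots> = qn q (int a + 1) * (qnumH q 1 0 (- int a - int b) + Qp q (int a + 2 - int b) * Qp q (int b - 2) * qn q (int b) * qH (- 2) 0) * s (Suc a, b, 0, b1, b2, 0)
    + (if b1 = 0 then 0 else tau q (- 2) 1 (s (a, b, 0, b1 - 1, b2, 0)))"
    using s[where z = 0] by (cases b) (simp_all add: Pos_apply algebra_simps)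
  also have "Qp q (int a + 2 - int b) * Qp q (int b - 2) = Qp q (int a)"
    by (simp flip: Qp_add)
  \<comment> \<open>The correction from the reduction merges with the direct term into a single
    bracket; the factor q^(-b) originates here.\<close>
  also have "qnumH q 1 0 (- int a - int b) + Qp q (int a) * qn q (int b) * qH (- 2) 0 = Qp q (- int b) * qnumH q 1 0 (- int a)"
    using qnumH_add[of 1 0 "- int a - int b" "int b"] by (simp add: Qp_minus Qp_diff qH2_expand field_simps)
  finally have "0 = qn q (int a + 1) * (Qp q (- int b) * qnumH q 1 0 (- int a)) * s (Suc a, b, 0, b1, b2, 0)
    + (if b1 = 0 then 0 else tau q (- 2) 1 (s (a, b, 0, b1 - 1, b2, 0)))" .
  from this[symmetric] show ?thesis unfolding s_def by (simp only: mult.assoc)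
qed

text \<open>
  Left multiplication by \<open>[h\<^sub>2 + 1] e\<^sub>1\<^sub>3 - e\<^sub>1\<^sub>2 q\<^bsup>1 - h\<^sub>2\<^esup> e\<^sub>2\<^sub>3\<close>, which annihilates \<open>p\<close>. Unlike \<open>e\<^sub>1\<^sub>3\<close> it maps
  left multiples of \<open>e\<^sub>3\<^sub>2\<close> to left multiples of \<open>e\<^sub>3\<^sub>2\<close>.
\<close>

definition Zop :: "series \<Rightarrow> series" where
  "Zop F = Lop q (Car (qnumH q 0 1 1)) (rho q (e13 q) F)
    - Lop q (Pos N1) (Lop q (Car (Qp q 1 * qH 0 (- 2))) (Lop q (Pos N2) F))"

lemma Zop_plus: "Zop (F + G) = Zop F + Zop G"
  by (simp add: Zop_def rho_plus Lop_plus algebra_simps del: plus_fun_apply minus_apply)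

text \<open>Past \<open>e32\<close>, the \<open>e13\<close> part leaves [h2+1] ([h2+1] - q [h2]) e12
  and the correction leaves q^(-h2) [h2+1] e12. They agree since [h2+1] - q [h2] = q^(-h2), and
  cancel in the difference.\<close>

lemma Zop_L32: "\<exists>G'. Zop (Lop q (Neg N2) G) = Lop q (Neg N2) G'"
proof -
  let ?L12 = "Lop q (Pos N1)" and ?L23 = "Lop q (Pos N2)" and ?L32 = "Lop q (Neg N2)"
  define A where "A = ?L12 (?L23 G) - Lop q (Car (Qp q 1)) (?L23 (?L12 G))"
  define g where "g = Qp q 1 * qH 0 (- 2)"
  have 1: "rho q (e13 q) (?L32 G) = ?L32 A + Lop q (Car (qnumH q 0 1 1 - Qp q 1 * qnumH q 0 1 0)) (?L12 G)"
    by (simp add: A_def rho_e13 L_normalize LC_diff algebra_simps del: plus_fun_apply minus_apply)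
  have 2: "?L12 (Lop q (Car g) (?L23 (?L32 G)))
     = ?L32 (?L12 (Lop q (Car (tau q 1 (- 2) g)) (?L23 G))) + Lop q (Car (tau q (- 2) 1 g * qnumH q 0 1 1)) (?L12 G)"
    by (simp add: L_normalize tau_mult algebra_simps del: plus_fun_apply minus_apply)
  have "tau q (- 2) 1 g = 1 / qH 0 2"
    by (simp add: g_def tau_mult tau_inverse qH2_expand tau_qH_expand divide_inverse)
  moreover have "qnumH q 0 1 1 - Qp q 1 * qnumH q 0 1 0 = 1 / qH 0 2"
    using qnumH_add[of 0 1 0 1] by simp
  ultimately have "qnumH q 0 1 1 * (qnumH q 0 1 1 - Qp q 1 * qnumH q 0 1 0) = tau q (- 2) 1 g * qnumH q 0 1 1"
    by (simp only: mult.commute)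
  then have 3: "Lop q (Car (qnumH q 0 1 1)) (rho q (e13 q) (?L32 G)) = ?L32 (Lop q (Car (tau q 1 (- 2) (qnumH q 0 1 1))) A)
     + Lop q (Car (tau q (- 2) 1 g * qnumH q 0 1 1)) (?L12 G)"
    unfolding 1 Lop_plus LC_L32 by (simp only: LC_mult[symmetric])
  show ?thesis
    unfolding Zop_def g_def[symmetric] 2 3
    by (intro exI[of _ "Lop q (Car (tau q 1 (- 2) (qnumH q 0 1 1))) A - ?L12 (Lop q (Car (tau q 1 (- 2) g)) (?L23 G))"])
      (simp add: Lop_diff algebra_simps del: plus_fun_apply minus_apply)
qed

lemma Zop_right: "ends_in_e23 H \<Longrightarrow> ends_in_e23 (Zop H)"
  unfolding Zop_def rho_e13 by (intro ends_in_e23_diff ends_in_e23_Lop)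

lemma qnumH_11: "qnumH q 1 1 s = Qp q s * qH 0 2 * qnumH q 1 0 0 + qnumH q 0 1 s / qH 2 0"
  using br_mult[of "qH 2 0" "Qp q s * qH 0 2"] by (simp add: qnumH_br qH2_expand mult_ac)

lemma qnumH_11': "qnumH q 1 1 s = qH 2 0 * qnumH q 0 1 s + qnumH q 1 0 0 / (Qp q s * qH 0 2)"
  using br_mult[of "Qp q s * qH 0 2" "qH 2 0"] by (simp add: qnumH_br qH2_expand mult_ac)

lemma qnumH_11_exchange:
  "qnumH q 0 1 (s + 1) * qnumH q 1 1 s = qnumH q 0 1 s * qnumH q 1 1 (s + 1) + qnumH q 1 0 0"
proof -
  have "br (Qp q s * qH 0 2 * Qp q 1) * br (Qp q s * (qH 2 0 * qH 0 2))
    = br (Qp q s * qH 0 2) * br (Qp q s * (qH 2 0 * qH 0 2) * Qp q 1) + br (qH 2 0)"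
    using br_exchange[of "Qp q s * qH 0 2" "Qp q s * (qH 2 0 * qH 0 2)"] by simp
  moreover have "Qp q s * (qH 2 0 * qH 0 2) * Qp q 1 = Qp q (s + 1) * (qH 2 0 * qH 0 2)"
    "Qp q s * qH 0 2 * Qp q 1 = Qp q (s + 1) * qH 0 2"
    by (simp_all add: Qp_add)
  ultimately show ?thesis by (simp only: qnumH_br qH2_expand) (simp add: qH2_expand)
qed

text \<open>The left side is the reduced entry of Z s at a = 0, in the form given by
  \<open>Phi_low\<close>. Only three entries of s contribute, named \<open>S1\<close>,
  \<open>S2\<close> and \<open>S3\<close> in the proof.\<close>

lemma Zop_reduced:
  assumes s: "reduced s"
  shows "Zop s (0, b, 0, b1, b2, 0) - (if b = 0 then 0 else Qp q (2 - int b) * Zop s (1, b - 1, 1, b1, b2, 0))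
    = qn q (int b + 1) * qnumH q 0 1 (- int b) * qnumH q 1 1 (1 - int b) * s (0, Suc b, 0, b1, b2, 0)
    + (if b2 = 0 then 0 else qn q (int b1 + 1) * Qp q (- int b) * qnumH q 1 1 (1 - int b) * tau q 1 (- 2) (s (1, b, 0, b1 + 1, b2 - 1, 0))
       + qnumH q 0 1 (1 - int b + int b1) * tau q (- 1) (- 1) (s (0, b, 0, b1, b2 - 1, 0)))"
proof -
  have s0: "s (x, y, Suc z, B) = 0" "s (x, y, z, u, v, Suc w) = 0" for x y z u v w B
    using s by (cases B, simp_all add: reduced_def)
  \<comment> \<open>Brackets and powers become atoms, so that field arithmetic can normalise the
    long expressions below.\<close>
  define h2 H1 k1 k2 x Q where "h2 = qnumH q 0 1 (1 - int b)" and "H1 = qnumH q 1 0 0"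
    and "k1 = qH 2 0" and "k2 = qH 0 2" and "x = Qp q (int b)" and "Q = Qp q 1"
  have ne [simp]: "k1 \<noteq> 0" "k2 \<noteq> 0" "x \<noteq> 0" "Q \<noteq> 0" by (simp_all add: k1_def k2_def x_def Q_def)
  have Qx: "Qp q (int b - 1) = x / Q" "Qp q (int b - 2) = x / (Q * Q)" "Qp q (2 - int b) = Q * Q / x"
    "Qp q (- 2) = 1 / (Q * Q)" "Qp q (- 1) = 1 / Q" "Qp q (- int b) = 1 / x" "Qp q 2 = Q * Q" "Qp q (1 - int b) = Q / x"
    by (simp_all add: x_def Q_def Qp_diff Qp_minus Qp_double divide_inverse)
  define X where "X = Lop q (Pos N2) s"
  define Y where "Y = Lop q (Pos N1) s"
  define g where "g = Qp q 1 * qH 0 (- 2)"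
  define V where "V = Lop q (Car g) X"
  define S1 where "S1 = s (0, Suc b, 0, b1, b2, 0)"
  define S2 where "S2 = (if b2 = 0 then 0 else tau q 1 (- 2) (s (1, b, 0, b1 + 1, b2 - 1, 0)))"
  define S3 where "S3 = (if b2 = 0 then 0 else tau q (- 1) (- 1) (s (0, b, 0, b1, b2 - 1, 0)))"
  define X1 where "X1 = qn q (int b + 1) * k2 * S1 - qn q (int b1 + 1) * S2 / Q"
  have X1: "X (1, b, 0, b1, b2, 0) = X1"
    by (simp add: X_def X1_def Pos_apply s0[where z = 0, simplified] s0 S1_def S2_def k2_def Qx)
  have X0: "(if b1 = 0 then 0 else tau q (- 2) 1 (X (0, b, 0, b1 - 1, b2, 0))) = - qn q (int b1) / Q * S3"
    by (cases b1) (simp_all add: X_def Pos_apply s0[where z = 0, simplified] S3_def tau_minus tau_mult tau_divide Qx Q_def add.commute)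
  have X_Suc: "X (y, z, Suc u, B) = 0" for y z u B
    by (cases B) (simp add: X_def Pos_apply s0)
  have X_1: "X (y, z, 1, B) = 0" for y z B using X_Suc[of y z 0 B] by simp
  have V_Suc: "V (y, z, Suc u, B) = 0" for y z u B by (simp only: V_def LC_apply X_Suc mult_zero_right)
  have V_1: "V (y, z, 1, B) = 0" for y z B by (simp only: V_def LC_apply X_1 mult_zero_right)
  have tau_g: "tau q y z g = Q * Qp q (- z) / k2" for y z
    by (simp add: g_def tau_mult tau_inverse qH2_expand tau_qH_expand k2_def Q_def Qp_minus divide_inverse)
  have V1: "V (1, b, 0, b1, b2, 0) = x / k2 * X1"
    by (simp add: V_def LC_apply X1[simplified] tau_g Qx)
  have V0: "(if b1 = 0 then 0 else tau q (- 2) 1 (V (0, b, 0, b1 - 1, b2, 0))) = x / k2 * (- qn q (int b1) / Q * S3)"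
  proof -
    have "tau q (- 2) 1 k2 = Q * k2" "tau q (- 2) 1 x = x" "tau q (- 2) 1 Q = Q"
      by (simp_all add: k2_def Q_def x_def tau_qH_expand)
    then have "tau q (- 2) 1 (V (0, b, 0, b1 - 1, b2, 0)) = x / k2 * tau q (- 2) 1 (X (0, b, 0, b1 - 1, b2, 0))"
      by (simp add: V_def LC_apply tau_mult tau_divide tau_g flip: x_def)
    then show ?thesis unfolding X0[symmetric] by simp
  qed
  have LX0: "Lop q (Pos N1) X (0, b, 0, b1, b2, 0) = qnumH q 1 0 (- int b) * X1 - qn q (int b1) / Q * S3"
    using X0 by (simp add: Pos_apply X1[simplified])
  have LV0: "Lop q (Pos N1) V (0, b, 0, b1, b2, 0) = x / k2 * (qnumH q 1 0 (- int b) * X1 - qn q (int b1) / Q * S3)"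
    using V0 by (simp add: Pos_apply V1[simplified] algebra_simps)
  have LX1: "(if b = 0 then 0 else Lop q (Pos N1) X (1, b - 1, 1, b1, b2, 0)) = - qn q (int b) * x / (Q * Q * k1) * X1"
    using X1 Qx(2)
    by (cases b) (simp_all add: Pos_apply X_Suc X_1[simplified] k1_def qH2_expand divide_inverse add.commute)
  have LV1: "(if b = 0 then 0 else Lop q (Pos N1) V (1, b - 1, 1, b1, b2, 0)) = x / k2 * (- qn q (int b) * x / (Q * Q * k1) * X1)"
    using V1 Qx(2) V_Suc
    by (cases b) (simp_all add: Pos_apply V_1[simplified] k1_def qH2_expand divide_inverse add.commute)
  have LY0: "Lop q (Pos N2) Y (0, b, 0, b1, b2, 0) = - qnumH q 0 1 0 * qn q (int b + 1) * x / (Q * k1) * S1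
      - qn q (int b1 + 1) / Q * (qnumH q 1 0 (1 - int b) * S2 + S3)"
  proof -
    have "Y (0, b, 1, b1, b2, 0) = - qn q (int b + 1) * x / (Q * k1) * S1"
      by (simp add: Y_def Pos_apply s0 S1_def Qx k1_def qH2_expand divide_inverse)
    moreover have "(if b2 = 0 then 0 else tau q 1 (- 2) (Y (0, b, 0, Suc b1, b2 - 1, 0))) = qnumH q 1 0 (1 - int b) * S2 + S3"
      by (simp add: Y_def Pos_apply s0 S2_def S3_def tau_add tau_mult tau_qnumH algebra_simps)
    ultimately show ?thesis
      by (cases b2) (simp_all add: Pos_apply[of Y] Qx algebra_simps)
  qed
  have LY1: "(if b = 0 then 0 else Lop q (Pos N2) Y (1, b - 1, 1, b1, b2, 0)) =
      - qn q (int b) * qn q (int b + 1) * k2 * x / (Q * Q * Q * k1) * S1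
      + qn q (int b1 + 1) * qn q (int b) * x / (Q * Q * Q * Q * k1) * S2"
  proof (cases b)
    case (Suc d)
    have y2: "Y (1, d, Suc (Suc 0), u, v, 0) = 0" for u v
      by (simp add: Y_def Pos_apply s0)
    have y1: "Y (0, b, 1, b1, b2, 0) = - qn q (int b + 1) * x / (Q * k1) * S1"
      by (simp add: Y_def Pos_apply s0 S1_def Qx k1_def qH2_expand divide_inverse)
    have y0: "Y (1, d, 1, Suc b1, v, 0) = - qn q (int b) * (x / (Q * Q)) / k1 * s (1, b, 0, Suc b1, v, 0)" for v
      using Qx(2) by (simp add: Y_def Pos_apply s0 k1_def qH2_expand divide_inverse Suc add.commute)
    have y0': "(if b2 = 0 then 0 else tau q 1 (- 2) (Y (1, d, 1, Suc b1, b2 - 1, 0))) = - qn q (int b) * (x / (Q * Q)) / (Q * k1) * S2"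
    proof -
      have "tau q 1 (- 2) k1 = Q * k1" "tau q 1 (- 2) x = x" "tau q 1 (- 2) Q = Q"
        by (simp_all add: k1_def Q_def x_def tau_qH_expand)
      then show ?thesis
        by (simp add: y0[simplified] S2_def tau_mult tau_divide tau_minus)
    qed
    have "Lop q (Pos N2) Y (1, d, 1, b1, b2, 0) = qn q (int b) * (1 / (Q * Q)) * k2 * Y (0, b, 1, b1, b2, 0)
      - 1 / Q * qn q (int b1 + 1) * (if b2 = 0 then 0 else tau q 1 (- 2) (Y (1, d, 1, Suc b1, b2 - 1, 0)))"
      using y2 by (cases b2) (simp_all add: Pos_apply[of Y] Qx k2_def Suc add.commute)
    then show ?thesis unfolding y1 y0' using Suc by (simp add: field_simps)
  qed simp
  have Z0: "Zop s (0, b, 0, b1, b2, 0) = h2 * (Lop q (Pos N1) X (0, b, 0, b1, b2, 0) - Q * Lop q (Pos N2) Y (0, b, 0, b1, b2, 0))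
      - Lop q (Pos N1) V (0, b, 0, b1, b2, 0)"
    by (simp add: Zop_def X_def Y_def V_def g_def rho_e13 LC_apply tau_qnumH h2_def Q_def)
  have Z1: "(if b = 0 then 0 else Zop s (1, b - 1, 1, b1, b2, 0)) =
      h2 * ((if b = 0 then 0 else Lop q (Pos N1) X (1, b - 1, 1, b1, b2, 0)) - Q * (if b = 0 then 0 else Lop q (Pos N2) Y (1, b - 1, 1, b1, b2, 0)))
      - (if b = 0 then 0 else Lop q (Pos N1) V (1, b - 1, 1, b1, b2, 0))"
    by (cases b) (simp_all add: Zop_def X_def Y_def V_def g_def rho_e13 LC_apply tau_qnumH h2_def Q_def)
  \<comment> \<open>The facts \<open>a\<close> to \<open>h\<close> relate the shifted brackets to
    these atoms; afterwards the coefficients of \<open>S1\<close>, \<open>S2\<close> and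
    \<open>S3\<close> are compared separately.\<close>
  have a: "qnumH q 1 0 (- int b) = H1 / x - qn q (int b) / k1"
    using qnumH_add[of 1 0 "- int b" "int b"] by (simp add: H1_def k1_def x_def Qp_minus field_simps)
  have b: "qnumH q 0 1 0 = (qnumH q 0 1 (- int b) + qn q (int b) * k2) / x"
    using qnumH_add'[of 0 1 0 "- int b"] by (simp add: k2_def x_def Qp_minus qn_minus field_simps)
  have c: "qnumH q 1 0 (1 - int b) = qnumH q 1 0 1 / x - qn q (int b) / (Q * k1)"
    using qnumH_add[of 1 0 "1 - int b" "int b"] by (simp add: k1_def x_def Q_def Qp_diff field_simps)
  have d: "qnumH q 1 0 1 = H1 / Q + k1"
    using qnumH_add'[of 1 0 0 1] by (simp add: H1_def k1_def Q_def)
  have e: "qnumH q 0 1 (1 - int b + int b1) = h2 * Qp q (int b1) + qn q (int b1) * x / (Q * k2)"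
    using qnumH_add[of 0 1 "1 - int b" "int b1"] by (simp add: h2_def k2_def Q_def x_def Qp_diff)
  have f: "qn q (int b1 + 1) = qn q (int b1) / Q + Qp q (int b1)"
    using qn_add'[of "int b1" 1] by (simp add: Q_def)
  have g: "qnumH q 1 1 (1 - int b) = k1 * h2 + H1 * x / (Q * k2)"
    using qnumH_11'[of "1 - int b"] by (simp add: k1_def k2_def h2_def H1_def x_def Q_def Qp_diff)
  have h: "qnumH q 0 1 (- int b) * qnumH q 1 1 (1 - int b) = h2 * (k2 * H1 / x + qnumH q 0 1 (- int b) / k1) - H1"
    using qnumH_11_exchange[of "- int b"] qnumH_11[of "- int b"]
    by (simp add: k1_def k2_def h2_def H1_def x_def Qp_minus divide_inverse algebra_simps)
  have "Zop s (0, b, 0, b1, b2, 0) - (if b = 0 then 0 else Qp q (2 - int b) * Zop s (1, b - 1, 1, b1, b2, 0))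
    = Zop s (0, b, 0, b1, b2, 0) - Q * Q / x * (if b = 0 then 0 else Zop s (1, b - 1, 1, b1, b2, 0))"
    by (simp add: Qx)
  also have "\<dots> = h2 * (H1 / x * X1 - qn q (int b1) / Q * S3 + qn q (int b + 1) * qnumH q 0 1 (- int b) / k1 * S1
       + qn q (int b1 + 1) * qnumH q 1 0 1 / x * S2 + qn q (int b1 + 1) * S3)
     - x / k2 * (H1 / x * X1 - qn q (int b1) / Q * S3)"
    unfolding Z0 Z1 LX0 LX1 LV0 LV1 LY0 LY1 a b c by (simp add: field_simps)
  also have "\<dots> = qn q (int b + 1) * (h2 * (k2 * H1 / x + qnumH q 0 1 (- int b) / k1) - H1) * S1
     + qn q (int b1 + 1) / x * (h2 * (qnumH q 1 0 1 - H1 / Q) + H1 * x / (Q * k2)) * S2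
     + (h2 * (qn q (int b1 + 1) - qn q (int b1) / Q) + qn q (int b1) * x / (Q * k2)) * S3"
    unfolding X1_def by (simp add: field_simps)
  also have "\<dots> = qn q (int b + 1) * (qnumH q 0 1 (- int b) * qnumH q 1 1 (1 - int b)) * S1
     + qn q (int b1 + 1) / x * qnumH q 1 1 (1 - int b) * S2 + qnumH q 0 1 (1 - int b + int b1) * S3"
    unfolding h unfolding e g unfolding d f by (simp add: mult.commute)
  finally show ?thesis
    by (simp add: S1_def S2_def S3_def Qx mult.assoc)
qed

text \<open>Complements the recursion from \<open>e12\<close>: this one raises b along a = 0, the
  other raises a.\<close>

lemma e13_recursion:
  assumes "Lop q (Pos N1) F = 0" "Lop q (Pos N2) F = 0"
  shows "qn q (int b + 1) * qnumH q 0 1 (- int b) * qnumH q 1 1 (1 - int b) * Phi F (0, Suc b, 0, b1, b2, 0)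
    + (if b2 = 0 then 0 else qn q (int b1 + 1) * Qp q (- int b) * qnumH q 1 1 (1 - int b) * tau q 1 (- 2) (Phi F (1, b, 0, b1 + 1, b2 - 1, 0))
       + qnumH q 0 1 (1 - int b + int b1) * tau q (- 1) (- 1) (Phi F (0, b, 0, b1, b2 - 1, 0))) = 0"
proof -
  define s where "s = Phi F"
  have s: "reduced s" unfolding s_def by (rule reduced_Phi)
  have s0: "s (x, y, Suc z, B) = 0" for x y z B
    using s by (cases B, simp add: reduced_def)
  have "Phi (Zop s) = 0" unfolding s_def
  proof (rule Phi_stable)
    show "Zop F = 0" by (simp add: Zop_def rho_e13 assms)
  qed (fact Zop_plus Zop_L32 Zop_right)+
  then have "0 = Phi (Zop s) (0, b, 0, b1, b2, 0)" by simp
  also have "\<dots> = Zop s (0, b, 0, b1, b2, 0)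
    - (if b = 0 then 0 else qn q (int 0 + 1) * Qp q (int 0 + 2 - int b) * Zop s (Suc 0, b - 1, 1, b1, b2, 0))"
  proof (rule Phi_low)
    fix x y z B
    have X: "Lop q (Pos N2) s (x, y, Suc z, B) = 0" for x y z B
      by (cases B) (simp add: Pos_apply s0)
    have Y: "Lop q (Pos N1) s (x, y, Suc (Suc z), B) = 0" for x y z B
      by (cases B) (simp add: Pos_apply s0)
    show "Zop s (x, y, Suc (Suc z), B) = 0"
      by (cases B) (simp add: Zop_def rho_e13 LC_apply Pos_apply[of "Lop _ _ _"] X Y)
  qed
  also have "\<dots> = Zop s (0, b, 0, b1, b2, 0) - (if b = 0 then 0 else Qp q (2 - int b) * Zop s (1, b - 1, 1, b1, b2, 0))"
    by simp
  finally have 0: "0 = Zop s (0, b, 0, b1, b2, 0) - (if b = 0 then 0 else Qp q (2 - int b) * Zop s (1, b - 1, 1, b1, b2, 0))" .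
  show ?thesis
    unfolding s_def[symmetric] by (rule trans[OF sym[OF Zop_reduced[OF s]] sym[OF 0]])
qed

text \<open>With n = a + b and k = b, this is \<open>Acoef\<close> after moving past e21^a e31^b,
  which shifts by (-2a-b, a-b). The scalars of both tensor operators are absorbed; together they
  collapse to (-1)^(a+b) q^(ab) / ([a]! [b]!).\<close>

definition Ccoef :: "nat \<Rightarrow> nat \<Rightarrow> cartan" where
  "Ccoef a b = (- 1) ^ (a + b) * Qp q (int a * int b) / kconst (of_real (qfact q a * qfact q b))
     * (qnumH q 1 0 (1 - 2 * int a - int b) * (\<Prod>s = b..a + b. inverse (qnumH q 1 0 (1 + int s - 2 * int a - int b))))
     * (\<Prod>s = 1..b. inverse (qnumH q 1 1 (2 + int s - int a - 2 * int b)))"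

lemma qn_qnum: "qn q (int n) = kconst (of_real (qnum q n))"
  by (simp add: qn_def qnum_def Qp_def kconst_diff kconst_divide power_int_minus power_inverse)

lemma qfact_Suc: "kconst (of_real (qfact q (Suc n))) = kconst (of_real (qfact q n)) * qn q (int n + 1)"
  using qn_qnum[of "Suc n"] by (simp add: qfact_def kconst_mult add.commute)

lemma tau_prod: "tau q x y (\<Prod>s\<in>A. f s) = (\<Prod>s\<in>A. tau q x y (f s))"
  by (induct A rule: infinite_finite_induct) (simp_all add: tau_mult)

lemma tau_sign: "tau q x y ((- 1) ^ n) = (- 1) ^ n"
  by (induct n) (simp_all add: tau_mult tau_minus)

lemma Ccoef_0_0: "Ccoef 0 0 = 1"
  by (simp add: Ccoef_def qfact_def qnumH_ne_0)

text \<open>Once the shift (-2, 1) is applied, raising a changes the Cartan part only by the new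
  denominator [h1 - a].\<close>

lemma Ccoef_Suc: "qn q (int a + 1) * Qp q (- int b) * qnumH q 1 0 (- int a) * Ccoef (Suc a) b + tau q (- 2) 1 (Ccoef a b) = 0"
proof -
  have 1: "(\<Prod>s = b..Suc a + b. inverse (qnumH q 1 0 (1 + int s - 2 * int (Suc a) - int b)))
    = (\<Prod>s = b..a + b. inverse (qnumH q 1 0 (int s - 1 - 2 * int a - int b))) * inverse (qnumH q 1 0 (- int a))"
    by (simp add: algebra_simps)
  have 2: "Qp q (int (Suc a) * int b) = Qp q (int a * int b) * Qp q (int b)"
  proof -
    have "int (Suc a) * int b = int a * int b + int b" by (simp add: algebra_simps)
    then show ?thesis by (simp only: Qp_add)
  qed
  have 3: "qn q (int a + 1) \<noteq> 0" by simp
  have "Ccoef (Suc a) b = - (tau q (- 2) 1 (Ccoef a b)) * (Qp q (int b) / (qn q (int a + 1) * qnumH q 1 0 (- int a)))"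
    unfolding Ccoef_def 1 2 qfact_Suc of_real_mult kconst_mult
    by (simp add: tau_mult tau_divide tau_prod tau_inverse tau_sign tau_qnumH tau_minus algebra_simps divide_inverse)
  then show ?thesis using 3 by (simp add: qnumH_ne_0 Qp_minus)
qed

text \<open>The recursion in b along a = 0 after the entry at a = 1 has been eliminated and the
  common factor [h2 - b] cancelled; the elimination is the source of [h1 + 1] and [h1].\<close>

lemma Ccoef_0_Suc: "qn q (int b + 1) * qnumH q 1 0 1 * qnumH q 1 1 (1 - int b) * Ccoef 0 (Suc b)
    = - qnumH q 1 0 0 * tau q (- 1) (- 1) (Ccoef 0 b)"
proof -
  have 1: "(\<Prod>s = 1..Suc b. inverse (qnumH q 1 1 (2 + int s - int 0 - 2 * int (Suc b))))
    = (\<Prod>s = 1..b. inverse (qnumH q 1 1 (int s - 2 * int b))) * inverse (qnumH q 1 1 (1 - int b))"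
    by (simp add: algebra_simps)
  have 2: "(\<Prod>s = b..0 + b. inverse (qnumH q 1 0 (1 + int s - 2 * int 0 - int b))) = inverse (qnumH q 1 0 1)" for b
    by simp
  have 3: "qn q (int b + 1) \<noteq> 0" by simp
  have "Ccoef 0 (Suc b) = - (tau q (- 1) (- 1) (Ccoef 0 b)) * qnumH q 1 0 0 / (qn q (int b + 1) * qnumH q 1 0 1 * qnumH q 1 1 (1 - int b))"
    unfolding Ccoef_def 1 2 qfact_Suc of_real_mult kconst_mult
    by (simp add: tau_mult tau_divide tau_prod tau_inverse tau_sign tau_qnumH tau_minus qfact_def qnumH_ne_0 field_simps)
  then show ?thesis using 3 by (simp add: qnumH_ne_0)
qed

text \<open>The \<open>e13\<close> recursion moves along a = 0, its a = 1 entry being expressed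
  through the \<open>e12\<close> recursion, which then also moves in a. All leading brackets are
  nonzero, so every entry is forced.\<close>

lemma Phi_projector:
  assumes p: "extremal_projector q p"
  shows "Phi p = (\<lambda>(a, b, c, b1, b2, b3). if c = 0 \<and> b3 = 0 then if b1 = a \<and> b2 = b then Ccoef a b else 0 else 0)"
proof -
  obtain w where w: "bdd w p" using p taylor_bdd by (auto simp: extremal_projector_def)
  have ann: "Lop q (Pos N1) p = 0" "Lop q (Pos N2) p = 0"
    using p tmul_to_taylor[OF w, of e12] tmul_to_taylor[OF w, of e23] by (auto simp: extremal_projector_def zero_series)
  define s where "s a b b1 b2 = Phi p (a, b, 0, b1, b2, 0)" for a b b1 b2
  note rec1 = e12_recursion[OF ann(1), folded s_def]
  note rec2 = e13_recursion[OF ann, folded s_def]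
  have rec1_0: "s (Suc a) b 0 b2 = 0" for a b b2
  proof -
    have "qn q (int a + 1) \<noteq> 0" by simp
    then show ?thesis using rec1[of a b 0 b2] qnumH_ne_0[of 1 0] by simp
  qed
  have rec1_Suc: "qn q (int a + 1) * Qp q (- int b) * qnumH q 1 0 (- int a) * s (Suc a) b (Suc b1) b2 = - tau q (- 2) 1 (s a b b1 b2)" for a b b1 b2
    using rec1[of a b "Suc b1" b2] by (simp add: eq_neg_iff_add_eq_0)
  have base: "s 0 b b1 b2 = (if b1 = 0 \<and> b2 = b then Ccoef 0 b else 0)" for b b1 b2
  proof (induct b arbitrary: b1 b2)
    case 0
    \<comment> \<open>At a = b = c = 0 no multiple of \<open>e32\<close> is subtracted, and the
      purely raising coefficients of \<open>p\<close> are those of 1.\<close>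
    have "s 0 0 b1 b2 = p (0, 0, 0, b1, b2, 0)" by (simp add: s_def Phi_def Neg_apply)
    also have "\<dots> = vac (0, 0, 0, b1, b2, 0)" by (rule projector_form[OF p]) simp
    finally show ?case by (auto simp: sing_apply Ccoef_0_0)
  next
    case (Suc b)
    have ne: "qn q (int b + 1) \<noteq> 0" "qnumH q 0 1 (- int b) \<noteq> 0" "qnumH q 1 1 (1 - int b) \<noteq> 0"
      "qnumH q 1 0 0 \<noteq> 0" "qnumH q 1 0 1 \<noteq> 0"
      by (simp_all add: qnumH_ne_0)
    show ?case
    proof (cases b2)
      case 0
      then show ?thesis using rec2[of b b1 0] ne by simp
    next
      case (Suc c)
      let ?t = "tau q (- 1) (- 1) (s 0 b b1 c)"
      have "Qp q (- int b) * qnumH q 1 0 0 * s 1 b (b1 + 1) c = - tau q (- 2) 1 (s 0 b b1 c)"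
        using rec1_Suc[of 0 b b1 c] by simp
      then have "s 1 b (b1 + 1) c = - tau q (- 2) 1 (s 0 b b1 c) * Qp q (int b) / qnumH q 1 0 0"
        using ne by (simp add: Qp_minus field_simps)
      then have "tau q 1 (- 2) (s 1 b (b1 + 1) c) = - ?t * Qp q (int b) / qnumH q 1 0 1"
        by (simp add: tau_mult tau_divide tau_minus tau_qnumH)
      then have *: "qn q (int b + 1) * qnumH q 0 1 (- int b) * qnumH q 1 1 (1 - int b) * s 0 (Suc b) b1 b2
        = (qn q (int b1 + 1) * qnumH q 1 1 (1 - int b) / qnumH q 1 0 1 - qnumH q 0 1 (1 - int b + int b1)) * ?t"
      proof -
        assume T: "tau q 1 (- 2) (s 1 b (b1 + 1) c) = - ?t * Qp q (int b) / qnumH q 1 0 1"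
        have "qn q (int b + 1) * qnumH q 0 1 (- int b) * qnumH q 1 1 (1 - int b) * s 0 (Suc b) b1 b2
          = - (qn q (int b1 + 1) * Qp q (- int b) * qnumH q 1 1 (1 - int b) * tau q 1 (- 2) (s 1 b (b1 + 1) c)
              + qnumH q 0 1 (1 - int b + int b1) * ?t)"
          unfolding eq_neg_iff_add_eq_0 using rec2[of b b1 "Suc c"] Suc by simp
        then show ?thesis unfolding T using ne by (simp add: Qp_minus field_simps)
      qed
      show ?thesis
      proof (cases "b1 = 0 \<and> c = b")
        case False
        then have "?t = 0" using Suc.hyps[of b1 c] by auto
        then show ?thesis using * ne False Suc by auto
      next
        case True
        \<comment> \<open>An instance of the exchange identity with x inverted. It exposes the
          factor [h2 - b], so that this bracket cancels from both sides and leaves the recursion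
          satisfied by \<open>Ccoef\<close>.\<close>
        have ex: "qnumH q 0 1 (1 - int b) * qnumH q 1 0 1 = qnumH q 1 1 (1 - int b) + qnumH q 0 1 (- int b) * qnumH q 1 0 0"
        proof -
          have inv: "br (inverse y) = - br y" for y by (simp add: br_def minus_divide_left)
          define x where "x = Qp q (- int b) * qH 0 2"
          have x: "x \<noteq> 0" by (simp add: x_def)
          have "br (inverse (x * Qp q 1) * Qp q 1) * br (qH 2 0) = br (inverse (x * Qp q 1)) * br (qH 2 0 * Qp q 1)
            + br (qH 2 0 / inverse (x * Qp q 1))"
            by (rule br_exchange) (use x in auto)
          moreover have "inverse (x * Qp q 1) * Qp q 1 = inverse x" using x by simp
          moreover have "br (qH 2 0 / inverse (x * Qp q 1)) = qnumH q 1 1 (1 - int b)"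
            by (simp add: x_def qnumH_br qH2_expand Qp_diff Qp_minus divide_inverse mult_ac)
          moreover have "br (x * Qp q 1) = qnumH q 0 1 (1 - int b)"
            by (simp add: x_def qnumH_br Qp_diff Qp_minus divide_inverse mult_ac)
          moreover have "br x = qnumH q 0 1 (- int b)" "br (qH 2 0) = qnumH q 1 0 0" "br (qH 2 0 * Qp q 1) = qnumH q 1 0 1"
            by (simp_all add: x_def qnumH_br mult.commute)
          ultimately show ?thesis
            by (simp only: inv) (simp add: algebra_simps)
        qed
        have "qn q (int b + 1) * qnumH q 0 1 (- int b) * qnumH q 1 1 (1 - int b) * s 0 (Suc b) b1 b2
          = - (qnumH q 0 1 (- int b) * qnumH q 1 0 0 / qnumH q 1 0 1) * ?t"
        proof -
          have "qn q (int b1 + 1) * qnumH q 1 1 (1 - int b) / qnumH q 1 0 1 - qnumH q 0 1 (1 - int b + int b1)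
            = - (qnumH q 0 1 (- int b) * qnumH q 1 0 0 / qnumH q 1 0 1)"
            using True ne ex by (simp add: field_simps)
          then show ?thesis using * by simp
        qed
        then have "qnumH q 0 1 (- int b) * (qn q (int b + 1) * qnumH q 1 0 1 * qnumH q 1 1 (1 - int b) * s 0 (Suc b) b1 b2)
          = qnumH q 0 1 (- int b) * (- qnumH q 1 0 0 * ?t)"
          using ne by (simp add: field_simps)
        then have "qn q (int b + 1) * qnumH q 1 0 1 * qnumH q 1 1 (1 - int b) * s 0 (Suc b) b1 b2 = - qnumH q 1 0 0 * ?t"
          using ne(2) by (simp only: mult_cancel_left) simp
        moreover have "?t = tau q (- 1) (- 1) (Ccoef 0 b)" using Suc.hyps[of b1 c] True by simp
        ultimately have "qn q (int b + 1) * qnumH q 1 0 1 * qnumH q 1 1 (1 - int b) * s 0 (Suc b) b1 b2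
          = qn q (int b + 1) * qnumH q 1 0 1 * qnumH q 1 1 (1 - int b) * Ccoef 0 (Suc b)"
          using Ccoef_0_Suc[of b] by simp
        then have "s 0 (Suc b) b1 b2 = Ccoef 0 (Suc b)" using ne by simp
        then show ?thesis using True Suc by simp
      qed
    qed
  qed
  have all: "s a b b1 b2 = (if b1 = a \<and> b2 = b then Ccoef a b else 0)" for a b b1 b2
  proof (induct a arbitrary: b1 b2)
    case 0
    show ?case by (rule base)
  next
    case (Suc a)
    have ne: "qn q (int a + 1) * Qp q (- int b) * qnumH q 1 0 (- int a) \<noteq> 0"
      using qnumH_ne_0[of 1 0 "- int a"] by simp
    show ?case
    proof (cases b1)
      case 0
      then show ?thesis using rec1_0 by simp
    next
      case (Suc d)
      have "qn q (int a + 1) * Qp q (- int b) * qnumH q 1 0 (- int a) * s (Suc a) b (Suc d) b2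
        = - tau q (- 2) 1 (if d = a \<and> b2 = b then Ccoef a b else 0)"
        using rec1_Suc[of a b d b2] Suc.hyps[of d b2] by simp
      also have "\<dots> = qn q (int a + 1) * Qp q (- int b) * qnumH q 1 0 (- int a) * (if d = a \<and> b2 = b then Ccoef (Suc a) b else 0)"
      proof -
        have "qn q (int a + 1) * Qp q (- int b) * qnumH q 1 0 (- int a) * Ccoef (Suc a) b = - tau q (- 2) 1 (Ccoef a b)"
          unfolding eq_neg_iff_add_eq_0 by (rule Ccoef_Suc)
        then show ?thesis by (cases "d = a \<and> b2 = b") (simp_all only: if_True if_False tau_0 mult_zero_right minus_zero simp_thms)
      qed
      finally have "s (Suc a) b (Suc d) b2 = (if d = a \<and> b2 = b then Ccoef (Suc a) b else 0)"
        using ne by (simp only: mult_cancel_left) simp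
      then show ?thesis using Suc by (simp only: nat.inject)
    qed
  qed
  show ?thesis
  proof
    fix m :: expo
    obtain a b c b1 b2 b3 where m: "m = (a, b, c, b1, b2, b3)" by (metis prod_cases6)
    show "Phi p m = (case m of (a, b, c, b1, b2, b3) \<Rightarrow> if c = 0 \<and> b3 = 0 then if b1 = a \<and> b2 = b then Ccoef a b else 0 else 0)"
      using all[of a b b1 b2] reduced_Phi[of p] by (auto simp: m s_def reduced_def)
  qed
qed

end


section \<open>The tensor operators\<close>

lemma mone_pow_add: "mone_pow (x + y) = mone_pow x * mone_pow y"
  by (simp add: mone_pow_def algebra_simps exp_add)

lemma mone_pow_nat: "mone_pow (real n) = (- 1) ^ n"
proof (induct n)
  case (Suc n)
  have "mone_pow 1 = - 1" by (simp add: mone_pow_def mult.commute)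
  then show ?case using Suc by (simp add: mone_pow_add add.commute)
qed (simp add: mone_pow_def)

context qparam begin

text \<open>Support in raising monomials of weight i alpha_1 + j alpha_2. Among these, b3 = 0 leaves
  at most e12^(i-j) e13^j.\<close>

definition bisupp :: "nat \<Rightarrow> nat \<Rightarrow> series \<Rightarrow> bool" where
  "bisupp i j Y \<longleftrightarrow> (\<forall>m. Y m \<noteq> 0 \<longrightarrow> (\<exists>b1 b2 b3. m = (0, 0, 0, b1, b2, b3) \<and> b1 + b2 = i \<and> b2 + b3 = j))"

lemma bisupp_A: "bisupp i j Y \<Longrightarrow> (a1, a2, a3) \<noteq> (0, 0, 0) \<Longrightarrow> Y (a1, a2, a3, B) = 0"
  unfolding bisupp_def by fastforce

lemma bisupp_0: "bisupp i j Y \<Longrightarrow> b1 + b2 \<noteq> i \<or> b2 + b3 \<noteq> j \<Longrightarrow> Y (a1, a2, a3, b1, b2, b3) = 0"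
  unfolding bisupp_def by fastforce

lemma Pos1_bisupp:
  assumes "bisupp i j Y"
  shows "Lop q (Pos N1) Y (a1, a2, a3, b1, b2, b3) = (if b1 = 0 then 0 else tau q (- 2) 1 (Y (a1, a2, a3, b1 - 1, b2, b3)))"
  using bisupp_A[OF assms] by (simp add: Pos_apply)

lemma Pos2_bisupp:
  assumes "bisupp i j Y"
  shows "Lop q (Pos N2) Y (a1, a2, a3, b1, b2, b3) =
     (if b3 = 0 then 0 else Qp q (int b2 - int b1) * tau q 1 (- 2) (Y (a1, a2, a3, b1, b2, b3 - 1)))
     - (if b2 = 0 then 0 else Qp q (- 1) * qn q (int b1 + 1) * tau q 1 (- 2) (Y (a1, a2, a3, b1 + 1, b2 - 1, b3)))"
  using bisupp_A[OF assms] by (simp add: Pos_apply)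

lemma bisuppI:
  assumes "\<And>a1 a2 a3 b1 b2 b3. F (a1, a2, a3, b1, b2, b3) \<noteq> 0 \<Longrightarrow> a1 = 0 \<and> a2 = 0 \<and> a3 = 0 \<and> b1 + b2 = i \<and> b2 + b3 = j"
  shows "bisupp i j F"
  unfolding bisupp_def using assms by fastforce

lemma bisuppD:
  "bisupp i j F \<Longrightarrow> F (a1, a2, a3, b1, b2, b3) \<noteq> 0 \<Longrightarrow> a1 = 0 \<and> a2 = 0 \<and> a3 = 0 \<and> b1 + b2 = i \<and> b2 + b3 = j"
  unfolding bisupp_def by fastforce

lemma bisupp_Pos1: "bisupp i j Y \<Longrightarrow> bisupp (Suc i) j (Lop q (Pos N1) Y)"
  by (rule bisuppI) (auto simp: Pos1_bisupp dest!: bisuppD split: if_splits)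

lemma bisupp_Pos2:
  assumes Y: "bisupp i j Y"
  shows "bisupp i (Suc j) (Lop q (Pos N2) Y)"
proof (rule bisuppI)
  fix a1 a2 a3 b1 b2 b3
  assume "Lop q (Pos N2) Y (a1, a2, a3, b1, b2, b3) \<noteq> 0"
  then have "b3 > 0 \<and> Y (a1, a2, a3, b1, b2, b3 - 1) \<noteq> 0 \<or> b2 > 0 \<and> Y (a1, a2, a3, b1 + 1, b2 - 1, b3) \<noteq> 0"
    by (auto simp: Pos2_bisupp[OF Y] split: if_splits)
  then show "a1 = 0 \<and> a2 = 0 \<and> a3 = 0 \<and> b1 + b2 = i \<and> b2 + b3 = Suc j"
    using bisuppD[OF Y, of a1 a2 a3 b1 b2 "b3 - 1"] bisuppD[OF Y, of a1 a2 a3 "b1 + 1" "b2 - 1" b3] by auto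
qed

lemma bisupp_diff: "bisupp i j Y \<Longrightarrow> bisupp i j Z \<Longrightarrow> bisupp i j (Y - Z)"
proof (rule bisuppI)
  fix a1 a2 a3 b1 b2 b3
  assume "bisupp i j Y" "bisupp i j Z" "(Y - Z) (a1, a2, a3, b1, b2, b3) \<noteq> 0"
  moreover from this(3) have "Y (a1, a2, a3, b1, b2, b3) \<noteq> 0 \<or> Z (a1, a2, a3, b1, b2, b3) \<noteq> 0" by auto
  ultimately show "a1 = 0 \<and> a2 = 0 \<and> a3 = 0 \<and> b1 + b2 = i \<and> b2 + b3 = j" using bisuppD by blast
qed

lemma bisupp_LC: "bisupp i j Y \<Longrightarrow> bisupp i j (Lop q (Car f) Y)"
  by (rule bisuppI) (auto simp: LC_apply dest!: bisuppD)

lemma rho_e13': "rho q (e13' q) F = Lop q (Pos N2) (Lop q (Pos N1) F) - Lop q (Car (Qp q 1)) (Lop q (Pos N1) (Lop q (Pos N2) F))"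
  by (simp add: e13'_def rho_diff rho_mult rho_scl kconst_q)

text \<open>Since e13' = -q^(-1) e13 + (q^(-1) - q) e12 e23, the coefficient of e13^j in e13'^j is
  (-q^(-1))^j; the other monomials of this weight contain \<open>e12\<close> and
  \<open>e23\<close>.\<close>

lemma e13'_power:
  "bisupp j j (rho q (e13' q ^ j) (sing (0, 0, 0, 0, 0, 0) f)) \<and>
   rho q (e13' q ^ j) (sing (0, 0, 0, 0, 0, 0) f) (0, 0, 0, 0, j, 0) = (- Qp q (- 1)) ^ j * tau q (- int j) (- int j) f"
proof (induct j)
  case 0
  show ?case by (auto simp: bisupp_def sing_apply)
next
  case (Suc j)
  define Y where "Y = rho q (e13' q ^ j) (sing (0, 0, 0, 0, 0, 0) f)"
  have Y: "bisupp j j Y" "Y (0, 0, 0, 0, j, 0) = (- Qp q (- 1)) ^ j * tau q (- int j) (- int j) f"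
    using Suc by (simp_all add: Y_def)
  have e: "rho q (e13' q ^ Suc j) (sing (0, 0, 0, 0, 0, 0) f) = rho q (e13' q) Y"
    by (simp add: rho_mult Y_def)
  have t: "tau q x y ((- Qp q (- 1)) ^ n) = (- Qp q (- 1)) ^ n" for x y n
    by (induct n) (simp_all add: tau_mult tau_minus)
  have "bisupp (Suc j) (Suc j) (rho q (e13' q) Y)"
    unfolding rho_e13' by (intro bisupp_diff bisupp_LC bisupp_Pos1 bisupp_Pos2 Y)
  moreover have "rho q (e13' q) Y (0, 0, 0, 0, Suc j, 0) = (- Qp q (- 1)) ^ Suc j * tau q (- int (Suc j)) (- int (Suc j)) f"
    unfolding rho_e13' minus_apply LC_apply Pos1_bisupp[OF bisupp_Pos2[OF Y(1)]] Pos2_bisupp[OF bisupp_Pos1[OF Y(1)]]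
      Pos1_bisupp[OF Y(1)]
    by (simp add: Y(2) tau_mult t)
  ultimately show ?case unfolding e by blast
qed

lemma e12_power:
  assumes "bisupp i j Y"
  shows "bisupp (i + a) j (rho q (e12 ^ a) Y) \<and>
    rho q (e12 ^ a) Y (0, 0, 0, b1 + a, b2, b3) = tau q (- 2 * int a) (int a) (Y (0, 0, 0, b1, b2, b3))"
proof (induct a)
  case (Suc a)
  have "rho q (e12 ^ Suc a) Y = Lop q (Pos N1) (rho q (e12 ^ a) Y)" by (simp add: rho_mult)
  then show ?case using Suc bisupp_Pos1[of "i + a" j] Pos1_bisupp[of "i + a" j] by (simp add: algebra_simps)
qed (simp add: assms)

lemma e31_power:
  assumes "bisupp i j Y"
  shows "rho q (e31 q ^ k) Y (a1, a2, a3, B) = (if a1 = 0 \<and> a2 = k \<and> a3 = 0 then Y (0, 0, 0, B) else 0)"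
proof (induct k arbitrary: a1 a2 a3 B)
  case 0
  show ?case using bisupp_A[OF assms, of a1 a2 a3 B] by auto
next
  case (Suc k)
  show ?case by (auto simp: rho_mult rho_e31 L31_apply Suc)
qed

lemma e21_power:
  "rho q (e21 ^ k) Y (a1, a2, a3, B) = (if a1 < k then 0 else Y (a1 - k, a2, a3, B))"
proof (induct k arbitrary: a1)
  case (Suc k)
  show ?case by (auto simp: rho_mult Neg_apply Suc)
qed simp

lemma rho_scl_mult: "rho q (scl c * u) F m = kconst c * rho q u F m"
  by (simp add: rho_mult rho_scl LC_kconst)

lemma qnum_pos: "n > 0 \<Longrightarrow> qnum q n > 0"
proof -
  assume n: "n > 0"
  show ?thesis
  proof (cases "q > 1")
    case True
    then have "inverse q < 1" "1 < q ^ n" "inverse q ^ n < 1"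
      using n by (auto simp: one_less_power inverse_less_1_iff power_less_one_iff)
    then show ?thesis using True by (simp add: qnum_def)
  next
    case False
    then have q: "q < 1" using q_ne_1 by simp
    then have "1 < inverse q" "q ^ n < 1" using q_pos n by (auto simp: one_less_inverse power_less_one_iff)
    moreover from this(1) have "1 < inverse q ^ n" using n by (simp add: one_less_power del: inverse_eq_divide)
    ultimately show ?thesis using q by (simp add: qnum_def divide_neg_neg)
  qed
qed

lemma qfact_pos: "qfact q n > 0"
  unfolding qfact_def by (rule prod_pos) (simp add: qnum_pos)

section \<open>The terms of the sum, their total and the comparison with the projector\<close>

definition sterm :: "nat \<times> nat \<Rightarrow> series" where
  "sterm = (\<lambda>(n, k). to_taylor q (kk (Acoef q n k) * Rop_tilde q n k * Rop' q n k))"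

text \<open>The raising part is known only through its weight and its coefficient at e12^(n-k)
  e13^k. Its other monomials end in \<open>e23\<close> and vanish under reduction.\<close>

lemma sterm_form:
  assumes "k \<le> n"
  shows "\<exists>Y g. bisupp n k Y \<and> (\<forall>a1 a2 a3 B. sterm (n, k) (a1, a2, a3, B) = (if a1 = n - k \<and> a2 = k \<and> a3 = 0 then g * Y (0, 0, 0, B) else 0))
    \<and> g * Y (0, 0, 0, n - k, k, 0) = Ccoef (n - k) k"
proof -
  define a where "a = n - k"
  have n: "n = a + k" "n - a = k" using assms by (simp_all add: a_def)
  define h where "h = qH (- int n) (- int k)"
  define j where "j = real n / 2"
  define c where "c = sqrt (qfact q n / (qfact q a * qfact q k))"
  define c' where "c' = complex_of_real (c * q powr (- 2 * j\<^sup>2 + j))"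
  define c1 where "c1 = complex_of_real (c * q powr (2 * j\<^sup>2 - j))"
  define c2 where "c2 = mone_pow (real k - j) * of_real (q powr (real k - j))"
  define X where "X = rho q (e13' q ^ k) (sing (0, 0, 0, 0, 0, 0) h)"
  define Z where "Z = rho q (e12 ^ a) X"
  define Y where "Y = Lop q (Car h) Z"
  have X: "bisupp k k X" "X (0, 0, 0, 0, k, 0) = (- Qp q (- 1)) ^ k * tau q (- int k) (- int k) h"
    using e13'_power[of k h] by (simp_all add: X_def)
  have t: "tau q x y ((- Qp q (- 1)) ^ n) = (- Qp q (- 1)) ^ n" for x y n
    by (induct n) (simp_all add: tau_mult tau_minus)
  have Z: "bisupp n k Z" "Z (0, 0, 0, a, k, 0) = (- Qp q (- 1)) ^ k * tau q (- 2 * int a - int k) (int a - int k) h"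
  proof -
    show "bisupp n k Z" using e12_power[OF X(1), of a] by (simp add: Z_def n(1) add.commute)
    have "Z (0, 0, 0, a, k, 0) = tau q (- 2 * int a) (int a) (X (0, 0, 0, 0, k, 0))"
      using e12_power[OF X(1), of a 0 k 0] by (simp add: Z_def)
    also have "\<dots> = (- Qp q (- 1)) ^ k * tau q (- 2 * int a + - int k) (int a + - int k) h"
      by (simp only: X(2) tau_mult t tau_tau)
    finally show "Z (0, 0, 0, a, k, 0) = (- Qp q (- 1)) ^ k * tau q (- 2 * int a - int k) (int a - int k) h"
      by (simp only: diff_conv_add_uminus)
  qed
  have Y: "bisupp n k Y" unfolding Y_def by (rule bisupp_LC[OF Z(1)])
  define A where "A = tau q (- 2 * int a - int k) (int a - int k) (Acoef q n k)"
  define g where "g = A * kconst c2 * kconst c1 * kconst c'"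
  have vac: "Lop q (Car h) vac = sing (0, 0, 0, 0, 0, 0) h"
    by (auto simp: fun_eq_iff LC_apply sing_apply split: if_splits)
  have R': "rho q (Rop' q n k) vac = Lop q (Car (kconst c')) Z"
    by (simp add: Rop'_def Let_def rho_mult rho_scl vac Z_def X_def c'_def c_def j_def a_def h_def[symmetric])
  have R: "Rop_tilde q n k = scl c2 * (scl c1 * e21 ^ a * e31 q ^ k * kk h)"
    by (simp add: Rop_tilde_def Rop_def Let_def c2_def c1_def c_def j_def h_def n(2) mult.commute[of "qfact q a"] flip: a_def)
  have comm: "Lop q (Car h) (Lop q (Car (kconst c')) Z) = (\<lambda>m. kconst c' * Y m)"
    unfolding Y_def LC_mult[symmetric] by (subst mult.commute) (auto simp: LC_mult LC_kconst fun_eq_iff)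
  have bY: "bisupp n k (\<lambda>m. kconst c' * Y m)"
    using Y by (auto simp: bisupp_def)
  have st: "sterm (n, k) (a1, a2, a3, B) = (if a1 = a \<and> a2 = k \<and> a3 = 0 then g * Y (0, 0, 0, B) else 0)" for a1 a2 a3 B
  proof -
    have "sterm (n, k) = Lop q (Car (Acoef q n k)) (rho q (scl c2 * (scl c1 * (e21 ^ a * e31 q ^ k))) (\<lambda>m. kconst c' * Y m))"
      by (simp add: sterm_def to_taylor_eq rho_mult R' R comm mult.assoc)
    then show ?thesis
      by (auto simp: LC_apply rho_scl_mult rho_mult[of "e21 ^ a"] e21_power e31_power[OF bY] g_def A_def)
  qed
  have val: "g * Y (0, 0, 0, a, k, 0) = Ccoef a k"
  proof -
    \<comment> \<open>Exponent of q picked up when the Cartan power in \<open>Acoef\<close> moves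
      past e21^a e31^k; the factor h of \<open>Rop'\<close>, once moved past its raising factors,
      contributes -E/2.\<close>
    define E where "E = int n * (- 2 * int a - int k) + int k * (int a - int k)"
    define P where "P = qnumH q 1 0 (1 - 2 * int a - int k) * (\<Prod>s = k..n. inverse (qnumH q 1 0 (1 + int s - 2 * int a - int k)))
      * (\<Prod>s = 1..k. inverse (qnumH q 1 1 (2 + int s - int a - 2 * int k)))"
    have A: "A = kconst (mone_pow (3 * j) / of_real (qfact q n)) * P
      * (kconst (of_real (q powr (4 * j\<^sup>2 + j))) * (Qp q E * qH (2 * int n) (2 * int k)))"
    proof -
      have t12: "tau q (- 2 * int a - int k) (int a - int k) (phi12 q s) = qnumH q 1 0 (1 + int s - 2 * int a - int k)" for s
        by (simp add: phi12_def tau_qnumH algebra_simps)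
      have t13: "tau q (- 2 * int a - int k) (int a - int k) (phi13 q s) = qnumH q 1 1 (2 + int s - int a - 2 * int k)" for s
        by (simp add: phi13_def tau_qnumH algebra_simps)
      show ?thesis
        unfolding A_def Acoef_def Let_def j_def[symmetric] E_def P_def
        by (simp only: tau_mult tau_prod tau_inverse t12 t13 tau_kconst tau_qH2) (simp add: mult.assoc)
    qed
    have h: "tau q (- 2 * int a - int k) (int a - int k) h = kconst (of_real (q powr (- real_of_int E / 2))) * h"
      by (simp add: h_def tau_qH E_def algebra_simps)
    \<comment> \<open>Each tensor operator carries the inverse square root of the Cartan power in
      \<open>Acoef\<close>, so the three cancel.\<close>
    have hh: "h * h * qH (2 * int n) (2 * int k) = 1"
    proof -
      have "h * h = qH (- (2 * int n)) (- (2 * int k))"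
        by (simp add: h_def qH_add[symmetric])
      then show ?thesis by (simp add: qH_minus)
    qed
    have pw: "(- Qp q (- 1)) ^ k = kconst ((- 1) ^ k * of_real (q powr (- real k)))"
    proof (induct k)
      case (Suc k)
      have "q powr (- real (Suc k)) = q powr (- 1) * q powr (- real k)"
        by (simp only: powr_add[symmetric]) simp
      then have "(- 1) ^ Suc k * complex_of_real (q powr (- real (Suc k)))
        = - of_real (q powr (- 1)) * ((- 1) ^ k * of_real (q powr (- real k)))"
        by (simp only: power_Suc of_real_mult) (simp only: mult_minus_left mult_minus_right mult_1 mult_ac)
      note this[symmetric]
      moreover have "- Qp q (- 1) = kconst (- of_real (q powr (- 1)))"
        by (simp only: Qp_powr kconst_minus) simp
      then have "(- Qp q (- 1)) ^ Suc k
        = kconst (- of_real (q powr (- 1)) * ((- 1) ^ k * of_real (q powr (- real k))))"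
        unfolding power_Suc Suc by (simp only: kconst_mult)
      ultimately show ?case by (simp only:)
    qed simp
    have Y': "Y (0, 0, 0, a, k, 0) = h * (kconst ((- 1) ^ k * of_real (q powr (- real k)))
      * (kconst (of_real (q powr (- real_of_int E / 2))) * h))"
      unfolding Y_def LC_apply Z(2) h pw by simp
    have scalar: "mone_pow (3 * j) / of_real (qfact q n) * of_real (q powr (4 * j\<^sup>2 + j)) * of_real (q powr E) * c2 * c1 * c'
      * ((- 1) ^ k * of_real (q powr (- real k))) * of_real (q powr (- real_of_int E / 2))
      = (- 1) ^ n * of_real (q powr (real a * real k)) / of_real (qfact q a * qfact q k)"
    proof -
      \<comment> \<open>Here 3j + j_z = n + k, and the leading coefficient of e13'^k supplies
        another (-1)^k.\<close>
      have s: "mone_pow (3 * j) * mone_pow (real k - j) * (- 1) ^ k = (- 1) ^ n"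
      proof -
        have "mone_pow (3 * j) * mone_pow (real k - j) = mone_pow (real (n + k))"
          by (simp add: j_def flip: mone_pow_add)
        then show ?thesis unfolding mone_pow_nat by (simp add: power_add mult.assoc flip: power_mult_distrib)
      qed
      \<comment> \<open>The terms linear in j and k cancel; as 4 j^2 = (a+k)^2 and E/2 = -(a^2 + ak
        + k^2), the sum is ak.\<close>
      have p: "q powr (4 * j\<^sup>2 + j) * q powr E * q powr (real k - j) * q powr (2 * j\<^sup>2 - j) * q powr (- 2 * j\<^sup>2 + j)
        * q powr (- real k) * q powr (- real_of_int E / 2) = q powr (real a * real k)"
      proof -
        have "4 * j\<^sup>2 + j + E + (real k - j) + (2 * j\<^sup>2 - j) + (- 2 * j\<^sup>2 + j) + - real k + - real_of_int E / 2
          = real a * real k"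
          by (simp add: E_def j_def n(1) power2_eq_square field_simps)
        then show ?thesis by (simp only: powr_add[symmetric])
      qed
      have cc: "c * c = qfact q n / (qfact q a * qfact q k)"
        using qfact_pos[of n] qfact_pos[of a] qfact_pos[of k] by (simp add: c_def)
      have "mone_pow (3 * j) / of_real (qfact q n) * of_real (q powr (4 * j\<^sup>2 + j)) * of_real (q powr E) * c2 * c1 * c'
        * ((- 1) ^ k * of_real (q powr (- real k))) * of_real (q powr (- real_of_int E / 2))
        = (mone_pow (3 * j) * mone_pow (real k - j) * (- 1) ^ k) * of_real (c * c) / of_real (qfact q n)
          * of_real (q powr (4 * j\<^sup>2 + j) * q powr E * q powr (real k - j) * q powr (2 * j\<^sup>2 - j) * q powr (- 2 * j\<^sup>2 + j)
            * q powr (- real k) * q powr (- real_of_int E / 2))"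
        unfolding c1_def c2_def c'_def of_real_mult by (simp only: divide_inverse mult_ac)
      also have "\<dots> = (- 1) ^ n * of_real (q powr (real a * real k)) / of_real (qfact q a * qfact q k)"
        unfolding s p cc using qfact_pos[of n] by simp
      finally show ?thesis .
    qed
    have "g * Y (0, 0, 0, a, k, 0) = kconst (mone_pow (3 * j) / of_real (qfact q n) * of_real (q powr (4 * j\<^sup>2 + j))
        * of_real (q powr E) * c2 * c1 * c'
        * ((- 1) ^ k * of_real (q powr (- real k))) * of_real (q powr (- real_of_int E / 2)))
      * P * (h * h * qH (2 * int n) (2 * int k))"
      unfolding g_def A Y' Qp_powr kconst_mult by (simp only: mult_ac)
    also have "\<dots> = Ccoef a k"
    proof -
      have m: "kconst ((- 1) ^ n) = (- 1) ^ n" by (induct n) (simp_all add: kconst_mult kconst_minus)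
      have "Qp q (int a * int k) = kconst (of_real (q powr (real a * real k)))" by (simp add: Qp_powr)
      then show ?thesis
        unfolding scalar hh Ccoef_def P_def n(1)[symmetric] kconst_divide by (simp add: kconst_mult m mult.assoc)
    qed
    finally show ?thesis .
  qed
  show ?thesis
    using Y st val by (intro exI[of _ Y] exI[of _ g]) (simp add: a_def)
qed

lemma sterm_support:
  assumes "k \<le> n" "sterm (n, k) (a1, a2, a3, b1, b2, b3) \<noteq> 0"
  shows "a1 = n - k" "a2 = k" "a3 = 0" "b1 + b2 = n" "b2 + b3 = k"
  using sterm_form[OF assms(1)] assms(2) bisupp_0 by (fastforce split: if_splits)+

text \<open>The lowering exponents identify the term, through n = a1 + a2 and k = a2, so each
  monomial receives at most one contribution.\<close>

definition Ssum :: series where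
  "Ssum = (\<lambda>(a1, a2, a3, B). sterm (a1 + a2, a2) (a1, a2, a3, B))"

lemma Ssum_has_tsum: "has_tsum sterm {(n, k). k \<le> n} Ssum"
proof -
  have only: "i = (a1 + a2, a2)" if "i \<in> {(n, k). k \<le> n}" "sterm i (a1, a2, a3, B) \<noteq> 0" for i a1 a2 a3 B
    using that sterm_support[of "snd i" "fst i" a1 a2 a3 "fst B" "fst (snd B)" "snd (snd B)"] by (cases i) auto
  have "weight m = (0, 0)" if "Ssum m \<noteq> 0" for m
  proof -
    obtain a1 a2 a3 b1 b2 b3 where m: "m = (a1, a2, a3, b1, b2, b3)" by (metis prod_cases6)
    then have "sterm (a1 + a2, a2) (a1, a2, a3, b1, b2, b3) \<noteq> 0" using that by (simp add: Ssum_def)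
    from sterm_support[OF _ this] show ?thesis by (simp add: m)
  qed
  then have "weight ` {m. Ssum m \<noteq> 0} \<subseteq> {(0, 0)}" by auto
  then have "Ssum \<in> taylor" unfolding taylor_def using finite_subset by blast
  moreover have "finite {i \<in> {(n, k). k \<le> n}. sterm i m \<noteq> 0} \<and> Ssum m = (\<Sum>i | i \<in> {(n, k). k \<le> n} \<and> sterm i m \<noteq> 0. sterm i m)" for m
  proof -
    obtain a1 a2 a3 B where m: "m = (a1, a2, a3, B)" by (metis prod_cases4)
    let ?I = "{i \<in> {(n, k). k \<le> n}. sterm i m \<noteq> 0}"
    have sub: "?I \<subseteq> {(a1 + a2, a2)}" using only m by blast
    then have "finite ?I" using finite_subset by blast
    moreover have "Ssum m = sum (\<lambda>i. sterm i m) {(a1 + a2, a2)}" by (simp add: Ssum_def m)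
    moreover have "sum (\<lambda>i. sterm i m) {(a1 + a2, a2)} = sum (\<lambda>i. sterm i m) ?I"
      by (rule sum.mono_neutral_right) (use sub in auto)
    ultimately show ?thesis by simp
  qed
  ultimately show ?thesis by (simp add: has_tsum_def)
qed

lemma Phi_Ssum: "Phi Ssum = (\<lambda>(a, b, c, b1, b2, b3). if c = 0 \<and> b3 = 0 then if b1 = a \<and> b2 = b then Ccoef a b else 0 else 0)"
proof -
  have 1: "Ssum (a, b, 0, b1, b2, 0) = (if b1 = a \<and> b2 = b then Ccoef a b else 0)" for a b b1 b2
  proof (cases "b1 = a \<and> b2 = b")
    case True
    then show ?thesis using sterm_form[of b "a + b"] by (auto simp: Ssum_def)
  next
    case False
    then have "sterm (a + b, b) (a, b, 0, b1, b2, 0) = 0"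
      using sterm_support[of b "a + b" a b 0 b1 b2 0] by fastforce
    then show ?thesis using False by (auto simp: Ssum_def)
  qed
  have 2: "Ssum (a, b, Suc c, b1, b2, 0) = 0" for a b c b1 b2
    using sterm_support(3)[of b "a + b" a b "Suc c" b1 b2 0] by (fastforce simp: Ssum_def)
  show ?thesis
    using Phi_eqI[where F = Ssum and s = "\<lambda>(a, b, b1, b2). if b1 = a \<and> b2 = b then Ccoef a b else 0"] 1 2
    unfolding prod.case by blast
qed

lemma projector_eq:
  assumes p: "extremal_projector q p" and pT: "extremal_projector_T q pT"
  shows "p = tmul q (tmul q pT Ssum) pT"
proof -
  obtain w where w: "bdd w p" using p taylor_bdd by (auto simp: extremal_projector_def)
  obtain v where v: "bdd v Ssum" using Ssum_has_tsum taylor_bdd by (auto simp: has_tsum_def)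
  have "Lop q (Pos N2) p = 0"
    using p tmul_to_taylor[OF w, of e23] by (auto simp: extremal_projector_def zero_series)
  then have 1: "tmul q pT p = p" by (rule projector_T_absorb_left[OF pT w])
  have "tmul q p (to_taylor q e32) = 0" using p by (auto simp: extremal_projector_def zero_series)
  then have 2: "tmul q p pT = p" by (rule projector_T_absorb_right[OF pT w])
  have "p = tmul q (tmul q pT p) pT" by (simp add: 1 2)
  also have "\<dots> = tmul q (tmul q pT (Phi p)) pT" by (rule sandwich_Phi[OF pT w])
  also have "Phi p = Phi Ssum" by (simp only: Phi_projector[OF p] Phi_Ssum)
  also have "tmul q (tmul q pT (Phi Ssum)) pT = tmul q (tmul q pT Ssum) pT" by (rule sandwich_Phi[OF pT v, symmetric])
  finally show ?thesis .
qed

end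

theorem mainTheorem5:
  fixes q :: real and p pT :: series
  assumes "q > 0" and "q \<noteq> 1"
    and "extremal_projector q p"
    and "extremal_projector_T q pT"
  shows "\<exists>S. has_tsum (\<lambda>(n, k). to_taylor q (gn (Car (Acoef q n k)) * Rop_tilde q n k * Rop' q n k))
               {(n, k). k \<le> n} S
           \<and> p = tmul q (tmul q pT S) pT"
proof -
  interpret qparam q by unfold_locales (use assms in auto)
  show ?thesis
    using Ssum_has_tsum projector_eq[OF assms(3,4)] unfolding sterm_def by blast
qed

end
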